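(* Let $(T,\Sigma,\mu)$ be a complete saturated finite measure space, let $E$ be a separable real Banach space with norm dual $E^*$, and let $X$ be a Suslin space. Let $\Phi:T\times X\to E^*$ be an integrably bounded measurable function such that $\Phi(t,\cdot):X\to E^*$ is continuous in the weak$^*$ topology of $E^*$ for every $t\in T$, and let $U:T\twoheadrightarrow X$ be a compact-valued multifunction with $\mathrm{gph}\,U\in\Sigma\otimes\mathrm{Borel}(X)$. Then for every $\lambda\in\mathcal{R}(T,X)$ concentrated on $U$ there exists $f\in\mathcal{M}(T,X)$ with $f(t)\in U(t)$ a.e. $t\in T$ such that $$\int_T\int_X\Phi(t,x)\,\lambda(t,dx)\,d\mu=\int_T\Phi(t,f(t))\,d\mu .$$
   Context: A finite measure space $(T,\Sigma,\mu)$ is saturated if for every $S\in\Sigma$ with $\mu(S)>0$ the space $L^1_S(\mu)$ of $\mu$-integrable functions on $(S,\Sigma_S)$, $\Sigma_S=\{A\cap S: A\in\Sigma\}$, is nonseparable. $\Pi(X)$ is the set of Borel probability measures on $X$ with the topology of weak convergence, i.e. the coarsest topology making $P\mapsto\int u\,dP$ continuous for every bounded continuous $u:X\to\mathbb{R}$, and is given its Borel $\sigma$-algebra. $\mathcal{M}(T,X)$ is the set of measurable functions $T\to X$; $\mathcal{R}(T,X)$ is the set of measurable functions $\lambda:T\to\Pi(X)$ (relaxed controls), and $\lambda(t,dx)$ denotes integration with respect to $\lambda(t)$. A multifunction is a set-valued map with nonempty values, and $\mathrm{gph}\,U=\{(t,x): x\in U(t)\}$. $\lambda$ is concentrated on $U$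 if $\lambda(t)(U(t))=1$ a.e. $t\in T$. Measurability of $\Phi$ is with respect to $\Sigma\otimes\mathrm{Borel}(X)$ and the Borel $\sigma$-algebra of the weak$^*$ topology of $E^*$. $\Phi$ is integrably bounded if there is $\psi\in L^1(\mu)$ with $\|\Phi(t,x)\|\le\psi(t)$ for all $(t,x)\in T\times X$. All integrals of $E^*$-valued functions are Gelfand integrals: for a measure $\nu$ and $g$ with values in $E^*$ and $\langle g(\cdot),y\rangle$ $\nu$-integrable for all $y\in E$, $\int g\,d\nu\in E^*$ is the element with $\langle\int g\,d\nu,y\rangle=\int\langle g,y\rangle d\nu$ for every $y\in E$. *)

theory Defs
  imports "HOL-Probability.Probability"
begin

section \<open>Saturated measure spaces\<close>

text \<open>Separability of the (pseudo-)normed space of real integrable functions; passing to classes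
  modulo a.e. equality does not affect it.\<close>

definition separable_L1 :: "'t measure \<Rightarrow> bool" where
  "separable_L1 M \<longleftrightarrow>
     (\<exists>D. countable D \<and> D \<subseteq> {g. integrable M (g :: 't \<Rightarrow> real)} \<and>
       (\<forall>h. integrable M (h :: 't \<Rightarrow> real) \<longrightarrow>
         (\<forall>e>0. \<exists>g\<in>D. (\<integral>t. \<bar>h t - g t\<bar> \<partial>M) < e)))"

definition saturated_measure :: "'t measure \<Rightarrow> bool" where
  "saturated_measure M \<longleftrightarrow>
     (\<forall>S\<in>sets M. emeasure M S > 0 \<longrightarrow> \<not> separable_L1 (restrict_space M S))"


section \<open>Topological notions\<close>

text \<open>A Polish space has at most continuum many points, so up to homeomorphism it is a topology
  on a set of reals; quantifying over \<^typ>\<open>real topology\<close> therefore covers all Polish spaces.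
  The topology \<open>P\<close> need not be related to the usual topology of the reals.\<close>

definition Suslin_space :: "'x topology \<Rightarrow> bool" where
  "Suslin_space X \<longleftrightarrow> Hausdorff_space X \<and>
     (\<exists>(P :: real topology) p. completely_metrizable_space P \<and> separable_space P \<and>
        continuous_map P X p \<and> p ` topspace P = topspace X)"

definition borel_of :: "'a topology \<Rightarrow> 'a measure" where
  "borel_of X = sigma (topspace X) {V. openin X V}"

text \<open>On the norm dual, the strong operator topology is the topology of pointwise convergence on
  \<open>E\<close>, that is, the weak* topology.\<close>

abbreviation weak_star_topology :: "('e::real_normed_vector \<Rightarrow>\<^sub>L real) topology" where
  "weak_star_topology \<equiv> strong_operator_topology"


section \<open>Relaxed controls\<close>

definition borel_probabilities :: "'x::topological_space measure set" where
  "borel_probabilities = {P. sets P = sets borel \<and> prob_space P}"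

definition weak_topology :: "'x::topological_space measure topology" where
  "weak_topology = topology_generated_by
     {{P \<in> borel_probabilities. (\<integral>x. u x \<partial>P) \<in> V} | (u :: 'x \<Rightarrow> real) V.
        continuous_on UNIV u \<and> bounded (range u) \<and> open V}"

definition relaxed_controls :: "'t measure \<Rightarrow> ('t \<Rightarrow> 'x::topological_space measure) set" where
  "relaxed_controls M = M \<rightarrow>\<^sub>M borel_of weak_topology"

definition concentrated_on ::
    "'t measure \<Rightarrow> ('t \<Rightarrow> 'x measure) \<Rightarrow> ('t \<Rightarrow> 'x set) \<Rightarrow> bool" where
  "concentrated_on M lam U \<longleftrightarrow> (AE t in M. emeasure (lam t) (U t) = 1)"


section \<open>Gelfand integrals\<close>

definition has_gelfand_integral ::
    "'s measure \<Rightarrow> ('s \<Rightarrow> 'e::real_normed_vector \<Rightarrow>\<^sub>L real) \<Rightarrow> ('e \<Rightarrow>\<^sub>L real) \<Rightarrow> bool" where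
  "has_gelfand_integral N g I \<longleftrightarrow>
     (\<forall>y. integrable N (\<lambda>s. blinfun_apply (g s) y) \<and>
          blinfun_apply I y = (\<integral>s. blinfun_apply (g s) y \<partial>N))"

definition gelfand_integral ::
    "'s measure \<Rightarrow> ('s \<Rightarrow> 'e::real_normed_vector \<Rightarrow>\<^sub>L real) \<Rightarrow> ('e \<Rightarrow>\<^sub>L real)" where
  "gelfand_integral N g = (THE I. has_gelfand_integral N g I)"

definition integrably_bounded ::
    "'t measure \<Rightarrow> ('t \<Rightarrow> 'x \<Rightarrow> 'e::real_normed_vector) \<Rightarrow> bool" where
  "integrably_bounded M \<Phi> \<longleftrightarrow>
     (\<exists>\<psi> :: 't \<Rightarrow> real. integrable M \<psi> \<and> (\<forall>t\<in>space M. \<forall>x. norm (\<Phi> t x) \<le> \<psi> t))"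

lemma space_borel_of [simp]: "space (borel_of X) = topspace X"
  unfolding borel_of_def by (rule space_measure_of) (auto dest: openin_subset)

lemma sets_borel_of: "sets (borel_of X) = sigma_sets (topspace X) {V. openin X V}"
  unfolding borel_of_def by (rule sets_measure_of) (auto dest: openin_subset)

lemma borel_of_euclidean: "sets (borel_of euclidean) = sets borel"
  unfolding sets_borel_of borel_def by simp

lemma topspace_weak_topology [simp]: "topspace weak_topology = borel_probabilities"
proof -
  let ?B = "{{P \<in> borel_probabilities. (\<integral>x. u x \<partial>P) \<in> V} | (u :: 'x::topological_space \<Rightarrow> real) V.
        continuous_on UNIV u \<and> bounded (range u) \<and> open V}"
  have "borel_probabilities \<in> ?B"
    by (intro CollectI exI[of _ "\<lambda>_. 0"] exI[of _ UNIV]) auto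
  moreover have "\<Union>?B \<subseteq> borel_probabilities" by auto
  ultimately show ?thesis
    unfolding weak_topology_def topology_generated_by_topspace by blast
qed

lemma has_gelfand_integral_unique:
  assumes "has_gelfand_integral N g I" "has_gelfand_integral N g J"
  shows "I = J"
  using assms unfolding has_gelfand_integral_def by (intro blinfun_eqI) simp

lemma gelfand_integral_eqI: "has_gelfand_integral N g I \<Longrightarrow> gelfand_integral N g = I"
  unfolding gelfand_integral_def
  by (rule the_equality) (auto intro: has_gelfand_integral_unique)

lemma has_gelfand_integral_gelfand_integral:
  assumes int: "\<And>y. integrable N (\<lambda>s. blinfun_apply (g s) y)"
    and psi: "integrable N (\<psi> :: _ \<Rightarrow> real)" "\<And>s. s \<in> space N \<Longrightarrow> norm (g s) \<le> \<psi> s"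
  shows "has_gelfand_integral N g (gelfand_integral N g)"
proof -
  let ?I = "\<lambda>y. \<integral>s. blinfun_apply (g s) y \<partial>N"
  have "bounded_linear ?I"
  proof (rule bounded_linear_intro)
    fix y
    have "norm (?I y) \<le> (\<integral>s. norm (blinfun_apply (g s) y) \<partial>N)"
      by (rule integral_norm_bound)
    also have "\<dots> \<le> (\<integral>s. \<psi> s * norm y \<partial>N)"
    proof (rule integral_mono)
      fix s assume s: "s \<in> space N"
      have "norm (blinfun_apply (g s) y) \<le> norm (g s) * norm y" by (rule norm_blinfun)
      also have "\<dots> \<le> \<psi> s * norm y" by (intro mult_right_mono psi s) simp
      finally show "norm (blinfun_apply (g s) y) \<le> \<psi> s * norm y" .
    qed (use int psi in auto)
    finally have "norm (?I y) \<le> (\<integral>s. \<psi> s * norm y \<partial>N)" .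
    then show "norm (?I y) \<le> norm y * (\<integral>s. \<psi> s \<partial>N)" by (simp add: mult.commute)
  qed (simp_all add: blinfun.add_right blinfun.scaleR_right int)
  then have "has_gelfand_integral N g (Blinfun ?I)"
    unfolding has_gelfand_integral_def by (simp add: bounded_linear_Blinfun_apply int)
  then show ?thesis using gelfand_integral_eqI by metis
qed

end

theory Submission
  imports Defs
begin

text \<open>
  Let \<open>g\<close> send a point of \<open>X\<close> to the sequence of truth values of \<open>0 < u k x\<close>, where the countably many
  continuous functions \<open>u k\<close> separate all points that continuous functions separate at all
  (a general Suslin space need not have any other continuous functions than constants, so \<open>g\<close> need
  not be injective, and \<open>lam\<close> need not be a kernel for the Borel sets of \<open>X\<close>). The image of \<open>lam\<close>
  under \<open>g\<close> is a kernel \<open>K\<close> into the Cantor space.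

  Saturation says that, over any countably generated sub-\<open>\<sigma>\<close>-algebra \<open>F\<close>, every set of positive
  measure has a subset that is not a trace of a set in \<open>F\<close>. Hence sets can be split with prescribed
  conditional probability given \<open>F\<close>, and splitting along the binary tree yields \<open>f'\<close> with values in
  the Cantor space whose conditional law given \<open>F\<close> is \<open>K\<close>. If \<open>F\<close> makes countably many integrands
  measurable, then integrating them over the graph of \<open>f'\<close> is the same as integrating them against \<open>K\<close>.

  A measurable selection, up to null sets of the product of the measure with \<open>K\<close>, turns the code
  \<open>f' t\<close> into a point \<open>f t\<close> of \<open>U t\<close>. Since \<open>\<Phi> t\<close> is weak* continuous, its scalar components factor
  through \<open>g\<close>, so the integrals are preserved for all components in a countable dense set.
\<close>

section \<open>Polish spaces as images of the Baire space\<close>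

text \<open>The pair \<open>(t, f' t)\<close> has the joint law given by \<open>K\<close> only on
  \<open>F \<Otimes>\<^sub>M cantor\<close>. Over the full sigma-algebra of \<open>M\<close> this
  would force \<open>K t\<close> to be a Dirac measure for almost every \<open>t\<close>, so
  \<open>f'\<close> need not avoid a given null set of the product of \<open>M\<close> with
  \<open>K\<close>. Whatever it has to respect must be listed beforehand among countably many
  integrands. This fixes the order: the decoding is selected first, the indicator of the set on
  which it misses the graph of \<open>U\<close> joins the integrands, and only then are
  \<open>F\<close> and \<open>f'\<close> chosen. Separability of \<open>E\<close> keeps the list
  countable.

  Since \<open>lam\<close> is not a kernel, the inner integrals are not visibly measurable in
  \<open>t\<close>. They equal almost everywhere an integral against \<open>K\<close>, and
  completeness of \<open>M\<close> turns this into measurability. The components of \<Phi> have no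
  sign while the comparison of laws is made for nonnegative integrands, so each is shifted by its
  integrable bound and the shift is cancelled at the end.\<close>

lemma open_baire_coordinate: "open ((\<lambda>a :: nat \<Rightarrow> nat. a i) -` V)"
  by (rule open_vimage[OF _ continuous_on_product_coordinates]) (rule discrete_topology_class.open_discrete)

text \<open>A basic open set of the product constrains finitely many coordinates, so a prefix
  reaching past all of them decides membership; conversely each coordinate is discrete, so fixing a
  prefix is an open condition.\<close>

lemma open_baire_iff:
  fixes S :: "(nat \<Rightarrow> nat) set"
  shows "open S \<longleftrightarrow> (\<forall>a\<in>S. \<exists>k. \<forall>b. map b [0..<k] = map a [0..<k] \<longrightarrow> b \<in> S)"
proof
  assume "open S"
  then have S: "openin (product_topology (\<lambda>i::nat. euclidean) UNIV) S" by (simp add: open_fun_def)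
  show "\<forall>a\<in>S. \<exists>k. \<forall>b. map b [0..<k] = map a [0..<k] \<longrightarrow> b \<in> S"
  proof
    fix a assume "a \<in> S"
    from product_topology_open_contains_basis[OF S this]
    obtain X where X: "a \<in> (\<Pi>\<^sub>E i\<in>UNIV. X i)" "finite {i. X i \<noteq> UNIV}" "(\<Pi>\<^sub>E i\<in>UNIV. X i) \<subseteq> S"
      by auto
    obtain k where k: "\<forall>i\<in>{i. X i \<noteq> UNIV}. i < k" using X(2) finite_nat_set_iff_bounded by auto
    have "b \<in> S" if "map b [0..<k] = map a [0..<k]" for b
    proof -
      have "b i \<in> X i" for i
        using that X(1) k by (cases "X i = UNIV") (auto simp: PiE_iff)
      then show ?thesis using X(3) by auto
    qed
    then show "\<exists>k. \<forall>b. map b [0..<k] = map a [0..<k] \<longrightarrow> b \<in> S" by blast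
  qed
next
  assume *: "\<forall>a\<in>S. \<exists>k. \<forall>b. map b [0..<k] = map a [0..<k] \<longrightarrow> b \<in> S"
  show "open S"
  proof (subst open_subopen, safe)
    fix a assume "a \<in> S"
    then obtain k where k: "\<forall>b. map b [0..<k] = map a [0..<k] \<longrightarrow> b \<in> S" using * by blast
    have "open (\<Inter>i\<in>{..<k}. (\<lambda>b::nat\<Rightarrow>nat. b i) -` {a i})"
      by (intro open_INT ballI finite_lessThan open_baire_coordinate)
    moreover have "a \<in> (\<Inter>i\<in>{..<k}. (\<lambda>b::nat\<Rightarrow>nat. b i) -` {a i})" by auto
    moreover have "(\<Inter>i\<in>{..<k}. (\<lambda>b::nat\<Rightarrow>nat. b i) -` {a i}) \<subseteq> S"
      using k by auto
    ultimately show "\<exists>T. open T \<and> a \<in> T \<and> T \<subseteq> S" by blast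
  qed
qed

lemma open_cylinder: "open {a :: nat \<Rightarrow> nat. map a [0..<length s] = s}"
  unfolding open_baire_iff by (metis (mono_tags, lifting) length_map mem_Collect_eq)

section \<open>Coding points of a complete separable metric space by sequences of indices\<close>

context Metric_space
begin

context
  fixes e :: "nat \<Rightarrow> 'a"
  assumes e: "range e \<subseteq> M" and dense: "\<forall>x\<in>M. \<forall>r>0. \<exists>n. d x (e n) < r"
begin

text \<open>Follow the points listed by \<open>a\<close>, ignoring those that would spoil the Cauchy property.\<close>

primrec filtered_walk :: "(nat \<Rightarrow> nat) \<Rightarrow> nat \<Rightarrow> 'a" where
  "filtered_walk a 0 = e (a 0)"
| "filtered_walk a (Suc k) =
     (if d (filtered_walk a k) (e (a (Suc k))) < (1/2)^k then e (a (Suc k)) else filtered_walk a k)"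

lemma filtered_walk_in [simp]: "filtered_walk a k \<in> M"
  using e by (induction k) auto

lemma filtered_walk_step: "d (filtered_walk a k) (filtered_walk a (Suc k)) \<le> (1/2)^k"
  by auto

text \<open>The bound is the exact geometric sum of the step bounds; the subtracted term is what
  lets the induction on \<open>m\<close> close.\<close>

lemma filtered_walk_dist:
  "d (filtered_walk a k) (filtered_walk a (k + m)) \<le> 2 * (1/2)^k - 2 * (1/2)^(k + m)"
proof (induction m)
  case (Suc m)
  have "d (filtered_walk a k) (filtered_walk a (k + Suc m)) \<le>
     d (filtered_walk a k) (filtered_walk a (k + m)) + d (filtered_walk a (k+m)) (filtered_walk a (Suc (k + m)))"
    using triangle[of "filtered_walk a k" "filtered_walk a (k+m)" "filtered_walk a (Suc (k + m))"]
    by (simp del: filtered_walk.simps)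
  then show ?case using Suc filtered_walk_step[of a "k+m"] by (simp del: filtered_walk.simps)
qed simp

lemma filtered_walk_cong:
  "map b [0..<Suc k] = map a [0..<Suc k] \<Longrightarrow> filtered_walk b k = filtered_walk a k"
  by (induction k) auto

lemma MCauchy_filtered_walk: "MCauchy (filtered_walk a)"
  unfolding MCauchy_def
proof (intro conjI allI impI)
  fix r :: real assume "r > 0"
  then obtain N where N: "(1/2)^N < r/4" using real_arch_pow_inv[of "r/4" "1/2"] by auto
  have *: "d (filtered_walk a N) (filtered_walk a n) < r/2" if "N \<le> n" for n
  proof -
    have "d (filtered_walk a N) (filtered_walk a n) \<le> 2 * (1/2)^N"
      using filtered_walk_dist[of a N "n - N"] that by (smt (verit) le_add_diff_inverse zero_le_power divide_nonneg_nonneg)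
    then show ?thesis using N by linarith
  qed
  have "d (filtered_walk a n) (filtered_walk a n') < r" if "N \<le> n" "N \<le> n'" for n n'
    using *[OF that(1)] *[OF that(2)] triangle'[of "filtered_walk a n" "filtered_walk a N" "filtered_walk a n'"]
    by (simp add: commute)
  then show "\<exists>N. \<forall>n n'. N \<le> n \<longrightarrow> N \<le> n' \<longrightarrow> d (filtered_walk a n) (filtered_walk a n') < r" by blast
qed auto

definition walk_limit :: "(nat \<Rightarrow> nat) \<Rightarrow> 'a" where
  "walk_limit a = (SOME x. limitin mtopology (filtered_walk a) x sequentially)"

context
  assumes complete: mcomplete
begin

lemma walk_limit: "limitin mtopology (filtered_walk a) (walk_limit a) sequentially"
  unfolding walk_limit_def
  by (rule someI_ex) (use complete MCauchy_filtered_walk in \<open>auto simp: mcomplete_def\<close>)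

lemma walk_limit_in [simp]: "walk_limit a \<in> M"
  using limitin_topspace[OF walk_limit] by simp

text \<open>The constant 3 is 2 for the remaining walk plus 1 for a late point that is already
  within \<open>(1/2)^k\<close> of the limit.\<close>

lemma walk_limit_dist: "d (filtered_walk a k) (walk_limit a) \<le> 3 * (1/2)^k"
proof -
  have "\<forall>\<^sub>F n in sequentially. d (filtered_walk a n) (walk_limit a) < (1/2)^k"
    using walk_limit[of a] unfolding limit_metric_sequentially eventually_sequentially
    by (meson zero_less_divide_1_iff zero_less_numeral zero_less_power)
  then obtain n where n: "n \<ge> k" "d (filtered_walk a n) (walk_limit a) < (1/2)^k"
    unfolding eventually_sequentially by (metis nat_le_linear le_refl)
  have "d (filtered_walk a k) (filtered_walk a n) \<le> 2 * (1/2)^k"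
    using filtered_walk_dist[of a k "n - k"] n(1) by (smt (verit) le_add_diff_inverse zero_le_power divide_nonneg_nonneg)
  then show ?thesis
    using n(2) triangle[of "filtered_walk a k" "filtered_walk a n" "walk_limit a"] by simp
qed

text \<open>With \<open>e (a k)\<close> within \<open>(1/2)^k / 4\<close> of \<open>x\<close>,
  consecutive points are less than \<open>(1/2)^k / 4 + (1/2)^k / 8\<close> apart, so the filter
  rejects no step and the walk is the chosen sequence itself.\<close>

lemma walk_limit_surj:
  assumes "x \<in> M"
  shows "\<exists>a. walk_limit a = x"
proof -
  have "\<exists>n. d x (e n) < (1/2)^k / 4" for k :: nat
    using bspec[OF dense assms, THEN spec, of "(1/2)^k / 4"] by simp
  then obtain a where a: "\<And>k. d x (e (a k)) < (1/2)^k / 4" by metis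
  have walk: "filtered_walk a k = e (a k)" for k
  proof (induction k)
    case (Suc k)
    have "d (e (a k)) (e (a (Suc k))) \<le> d x (e (a k)) + d x (e (a (Suc k)))"
      using triangle'[of "e (a k)" x "e (a (Suc k))"] assms e by (auto simp: commute)
    also have "\<dots> < (1/2)^k / 4 + (1/2)^Suc k / 4" using a add_strict_mono by blast
    also have "\<dots> \<le> (1/2)^k" by simp
    finally show ?case using Suc by simp
  qed simp
  have "d x (walk_limit a) \<le> 4 * (1/2)^k" for k
  proof -
    have "d x (walk_limit a) \<le> d x (e (a k)) + d (e (a k)) (walk_limit a)"
      using e assms by (intro triangle) auto
    moreover have "0 \<le> (1/2 :: real)^k" by simp
    ultimately show ?thesis using a[of k] walk_limit_dist[of a k, unfolded walk] by linarith
  qed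
  moreover have "(\<lambda>k. 4 * (1/2)^k :: real) \<longlonglongrightarrow> 4 * 0"
    by (intro tendsto_mult tendsto_const LIMSEQ_power_zero) auto
  ultimately have "d x (walk_limit a) \<le> 0"
    by (intro LIMSEQ_le_const[of "\<lambda>k. 4 * (1/2)^k"]) auto
  then show ?thesis using assms by (metis mdist_pos_eq not_le walk_limit_in)
qed

text \<open>Sequences sharing the first \<open>Suc k\<close> entries are at the same point of the
  walk at time \<open>k\<close>, and each limit is within \<open>3 * (1/2)^k\<close> of it; hence
  the requirement \<open>(1/2)^k < r/6\<close>.\<close>

lemma continuous_walk_limit: "continuous_map euclidean mtopology walk_limit"
  unfolding continuous_map_to_metric
proof (intro ballI allI impI)
  fix a :: "nat \<Rightarrow> nat" and r :: real assume "r > 0"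
  then obtain k where k: "(1/2)^k < r/6" using real_arch_pow_inv[of "r/6" "1/2"] by auto
  let ?U = "{b. map b [0..<Suc k] = map a [0..<Suc k]}"
  have "open ?U" using open_cylinder[of "map a [0..<Suc k]"] by (simp del: upt_Suc)
  moreover have "walk_limit b \<in> mball (walk_limit a) r" if "b \<in> ?U" for b
  proof -
    have "filtered_walk b k = filtered_walk a k" using that filtered_walk_cong by blast
    then show ?thesis
      using walk_limit_dist[of a k] walk_limit_dist[of b k] k
        triangle'[of "walk_limit a" "filtered_walk a k" "walk_limit b"]
      by (simp add: commute)
  qed
  ultimately show "\<exists>U. openin euclidean U \<and> a \<in> U \<and> (\<forall>y\<in>U. walk_limit y \<in> mball (walk_limit a) r)"
    by (intro exI[of _ ?U]) (auto simp: open_openin[symmetric])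
qed

end
end
end

lemma Suslin_space_baire_surj:
  assumes "Suslin_space (euclidean :: 'x::topological_space topology)"
  obtains \<pi> :: "(nat \<Rightarrow> nat) \<Rightarrow> 'x::topological_space" where "continuous_on UNIV \<pi>" "surj \<pi>"
proof -
  obtain P :: "real topology" and p where P: "completely_metrizable_space P" "separable_space P"
    "continuous_map P euclidean p" "p ` topspace P = (UNIV :: 'x set)"
    using assms by (auto simp: Suslin_space_def)
  then obtain S d where S: "Metric_space S d" "Metric_space.mcomplete S d" and
    P_eq: "P = Metric_space.mtopology S d" unfolding completely_metrizable_space_def by auto
  interpret Metric_space S d by fact
  obtain C where C: "countable C" "C \<subseteq> S" "mtopology closure_of C = S"
    using P(2) unfolding P_eq separable_space_def by auto
  \<comment> \<open>The type \<open>'x\<close> is inhabited and covered by \<open>p\<close>; the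
    enumeration \<open>from_nat_into\<close> needs a nonempty set.\<close>
  have "S \<noteq> {}" using P(4) by (auto simp: P_eq)
  then have "C \<noteq> {}" using C by auto
  define e where "e = from_nat_into C"
  have e: "range e = C" unfolding e_def by (rule range_from_nat_into[OF \<open>C \<noteq> {}\<close> C(1)])
  have dense: "\<forall>x\<in>S. \<forall>r>0. \<exists>n. d x (e n) < r"
  proof (intro ballI allI impI)
    fix x and r :: real assume x: "x \<in> S" and r: "0 < r"
    have "x \<in> mtopology closure_of C" using x C by simp
    then obtain y where "y \<in> C" "y \<in> mball x r"
      using r unfolding metric_closure_of by blast
    moreover obtain n where "y = e n" using e \<open>y \<in> C\<close> by blast
    ultimately show "\<exists>n. d x (e n) < r" by auto
  qed
  have eS: "range e \<subseteq> S" using e C(2) by simp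
  note walk = continuous_walk_limit[OF eS dense S(2)] walk_limit_surj[OF eS dense S(2)]
  let ?L = "walk_limit e"
  have "continuous_map euclidean euclidean (p \<circ> ?L)"
    using walk(1) P(3) unfolding P_eq by (rule continuous_map_compose)
  then have "continuous_on UNIV (p \<circ> ?L)" by simp
  moreover have "\<exists>a. x = (p \<circ> ?L) a" for x
  proof -
    have "x \<in> p ` S" using P(4) by (simp add: P_eq)
    then obtain z where z: "z \<in> S" "x = p z" by blast
    show ?thesis using walk(2)[OF z(1)] z(2) by auto
  qed
  then have "surj (p \<circ> ?L)" unfolding surj_def by blast
  ultimately show ?thesis using that by blast
qed

section \<open>Measurable selections from analytic sets\<close>

text \<open>A Souslin scheme: \<open>c\<close> attaches a measurable set to each finite sequence,
  and the section of \<open>C\<close> at \<open>w\<close> consists of the sequences all of whose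
  prefixes \<open>s\<close> satisfy \<open>w \<in> c s\<close>. Every section is thus closed, in a
  way measurable in \<open>w\<close>.\<close>

definition cyl_closed :: "'w measure \<Rightarrow> ('w \<times> (nat \<Rightarrow> nat)) set \<Rightarrow> bool" where
  "cyl_closed N C \<longleftrightarrow> (\<exists>c. (\<forall>s. c s \<in> sets N) \<and> C = {(w, a). \<forall>k. w \<in> c (map a [0..<k])})"

text \<open>The parametrization \<pi> may change with the set, which leaves room to recode points in
  unions and intersections. The codes stay explicit because the selection is made among
  them.\<close>

definition analytic_in :: "'w measure \<Rightarrow> ('w \<times> 'x::topological_space) set \<Rightarrow> bool" where
  "analytic_in N A \<longleftrightarrow>
     (\<exists>C \<pi>. cyl_closed N C \<and> continuous_on UNIV \<pi> \<and> A = {(w, \<pi> a) | w a. (w, a) \<in> C})"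

lemma cyl_closed_INT:
  assumes "\<And>i::nat. cyl_closed N (C i)"
  shows "cyl_closed N (\<Inter>i. C i)"
proof -
  have "\<forall>i. \<exists>c. (\<forall>s. c s \<in> sets N) \<and> C i = {(w, a). \<forall>k. w \<in> c (map a [0..<k])}"
    using assms unfolding cyl_closed_def by blast
  from choice[OF this] obtain c where c: "\<And>i s. c i s \<in> sets N"
    "\<And>i. C i = {(w, a). \<forall>k. w \<in> c i (map a [0..<k])}" by blast
  show ?thesis unfolding cyl_closed_def
    by (rule exI[of _ "\<lambda>s. \<Inter>i. c i s"]) (auto simp: c)
qed

text \<open>The first digit picks the member of the family and the tail is the code inside it. At
  the empty list nothing is picked yet, so the scheme imposes only \<open>space N\<close>
  there.\<close>

lemma cyl_closed_glue:
  assumes "\<And>i::nat. cyl_closed N (C i)"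
  shows "cyl_closed N {(w, a). (w, \<lambda>i. a (Suc i)) \<in> C (a 0)}"
proof -
  have "\<forall>i. \<exists>c. (\<forall>s. c s \<in> sets N) \<and> C i = {(w, a). \<forall>k. w \<in> c (map a [0..<k])}"
    using assms unfolding cyl_closed_def by blast
  from choice[OF this] obtain c where c: "\<And>i s. c i s \<in> sets N"
    "\<And>i. C i = {(w, a). \<forall>k. w \<in> c i (map a [0..<k])}" by blast
  define c' where "c' s = (case s of [] \<Rightarrow> space N | i # t \<Rightarrow> c i t)" for s
  have map_eq: "map a [0..<Suc k] = a 0 # map (\<lambda>i. a (Suc i)) [0..<k]" for a :: "nat \<Rightarrow> nat" and k
    by (simp add: upt_conv_Cons map_Suc_upt[symmetric] comp_def del: upt_Suc)
  have "(w, \<lambda>i. a (Suc i)) \<in> C (a 0) \<longleftrightarrow> (\<forall>k. w \<in> c' (map a [0..<k]))" (is "?L \<longleftrightarrow> ?R") for w a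
  proof
    assume ?L
    then have *: "w \<in> c (a 0) (map (\<lambda>i. a (Suc i)) [0..<k])" for k by (simp add: c)
    show ?R
    proof
      fix k show "w \<in> c' (map a [0..<k])"
      proof (cases k)
        case 0
        then show ?thesis using * c(1) sets.sets_into_space by (fastforce simp: c'_def)
      next
        case (Suc j) then show ?thesis unfolding Suc map_eq using * by (simp add: c'_def)
      qed
    qed
  next
    assume R: ?R
    have "w \<in> c (a 0) (map (\<lambda>i. a (Suc i)) [0..<k])" for k
      using spec[OF R, of "Suc k"] unfolding map_eq by (simp add: c'_def)
    then show ?L by (simp add: c)
  qed
  then show ?thesis unfolding cyl_closed_def
    by (intro exI[of _ c']) (auto simp: c c'_def split: list.split)
qed

text \<open>\<open>T s\<close> collects the finite outputs forced by the input prefix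
  \<open>s\<close>; by continuity every prefix of \<open>\<theta> a\<close> is forced by some prefix
  of \<open>a\<close>. Lists being countable, the intersections over \<open>T s\<close> are
  measurable.\<close>

lemma cyl_closed_vimage:
  assumes "cyl_closed N C" and \<theta>: "continuous_on UNIV (\<theta> :: (nat \<Rightarrow> nat) \<Rightarrow> nat \<Rightarrow> nat)"
  shows "cyl_closed N {(w, a). (w, \<theta> a) \<in> C}"
proof -
  obtain c where c: "\<And>s. c s \<in> sets N" "C = {(w, a). \<forall>k. w \<in> c (map a [0..<k])}"
    using assms(1) unfolding cyl_closed_def by metis
  define T where "T s = {t. \<forall>b. map b [0..<length s] = s \<longrightarrow> map (\<theta> b) [0..<length t] = t}" for s
  have T: "[] \<in> T s" for s by (simp add: T_def)
  have meas: "(\<Inter>t\<in>T s. c t) \<in> sets N" for s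
    using c(1) T[of s] by (intro sets.countable_INT') auto
  have "(w, \<theta> a) \<in> C \<longleftrightarrow> (\<forall>k. w \<in> (\<Inter>t\<in>T (map a [0..<k]). c t))" (is "?L \<longleftrightarrow> ?R") for w a
  proof
    assume ?L
    then have *: "w \<in> c (map (\<theta> a) [0..<k])" for k by (simp add: c)
    show ?R
    proof (intro allI INT_I)
      fix k t assume "t \<in> T (map a [0..<k])"
      then have "map (\<theta> a) [0..<length t] = t" unfolding T_def by simp
      then show "w \<in> c t" using *[of "length t"] by simp
    qed
  next
    assume R: ?R
    have "w \<in> c (map (\<theta> a) [0..<k])" for k
    proof -
      let ?t = "map (\<theta> a) [0..<k]"
      have "open (\<theta> -` {b. map b [0..<length ?t] = ?t})"
        by (rule open_vimage[OF open_cylinder \<theta>])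
      moreover have "a \<in> \<theta> -` {b. map b [0..<length ?t] = ?t}" by simp
      ultimately obtain j where j: "\<forall>b. map b [0..<j] = map a [0..<j] \<longrightarrow> b \<in> \<theta> -` {b. map b [0..<length ?t] = ?t}"
        unfolding open_baire_iff by blast
      then have *: "map (\<theta> b) [0..<length ?t] = ?t" if "map b [0..<j] = map a [0..<j]" for b
        using that by blast
      have "map (\<theta> b) [0..<length ?t] = ?t" if "map b [0..<length (map a [0..<j])] = map a [0..<j]" for b
        by (rule *) (use that in \<open>simp only: length_map length_upt diff_zero\<close>)
      then have "?t \<in> T (map a [0..<j])"
        unfolding T_def by blast
      with spec[OF R, of j] show ?thesis by (rule INT_D)
    qed
    then show ?L by (simp add: c)
  qed
  then show ?thesis unfolding cyl_closed_def
    using meas by (intro exI[of _ "\<lambda>s. \<Inter>t\<in>T s. c t"]) simp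
qed

text \<open>\<open>S\<close> is attached to exactly the prefixes of members of \<open>F\<close>, and
  a closed set contains every sequence all of whose prefixes are such.\<close>

lemma cyl_closed_Times:
  assumes "S \<in> sets N" "closed F"
  shows "cyl_closed N (S \<times> F)"
proof -
  define c where "c s = (if \<exists>b\<in>F. map b [0..<length s] = s then S else {})" for s
  have "a \<in> F" if "\<forall>k. \<exists>b\<in>F. map b [0..<k] = map a [0..<k]" for a
  proof (rule ccontr)
    assume "a \<notin> F"
    moreover have "open (-F)" using assms(2) by (simp add: closed_def)
    ultimately obtain k where "\<forall>b. map b [0..<k] = map a [0..<k] \<longrightarrow> b \<in> -F"
      unfolding open_baire_iff by blast
    then show False using that by (metis ComplD)
  qed
  then have F: "a \<in> F \<longleftrightarrow> (\<forall>k. \<exists>b\<in>F. map b [0..<k] = map a [0..<k])" for a by blast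
  have cm: "w \<in> c (map a [0..<k]) \<longleftrightarrow> w \<in> S \<and> (\<exists>b\<in>F. map b [0..<k] = map a [0..<k])" for w a k
    by (simp add: c_def)
  have "S \<times> F = {(w, a). \<forall>k. w \<in> c (map a [0..<k])}"
    unfolding cm using F by blast
  then show ?thesis unfolding cyl_closed_def
    using assms(1) by (intro exI[of _ c]) (simp add: c_def)
qed

text \<open>The common parametrization spends its first digit on the index; it stays continuous
  because that digit is discrete.\<close>

lemma analytic_in_UN:
  assumes "\<And>i::nat. analytic_in N (A i)"
  shows "analytic_in N (\<Union>i. A i)"
proof -
  have "\<forall>i. \<exists>C \<pi>. cyl_closed N C \<and> continuous_on UNIV \<pi> \<and> A i = {(w, \<pi> a) | w a. (w, a) \<in> C}"
    using assms unfolding analytic_in_def by blast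
  from choice[OF this] obtain C where
    "\<forall>i. \<exists>\<pi>. cyl_closed N (C i) \<and> continuous_on UNIV \<pi> \<and> A i = {(w, \<pi> a) | w a. (w, a) \<in> C i}" ..
  from choice[OF this] obtain \<pi> where C: "\<And>i. cyl_closed N (C i)" "\<And>i. continuous_on UNIV (\<pi> i)"
    "\<And>i. A i = {(w, \<pi> i a) | w a. (w, a) \<in> C i}" by blast
  let ?t = "\<lambda>a :: nat \<Rightarrow> nat. \<lambda>i. a (Suc i)"
  let ?C = "{(w, a). (w, ?t a) \<in> C (a 0)}"
  let ?p = "\<lambda>a. \<pi> (a 0) (?t a)"
  have t: "continuous_on UNIV ?t"
    by (intro continuous_on_coordinatewise_then_product continuous_on_product_coordinates)
  have "continuous_on UNIV ?p"
  proof (subst continuous_on_open_vimage[OF open_UNIV], safe)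
    fix V :: "'b set" assume "open V"
    have "?p -` V \<inter> UNIV = (\<Union>i. (\<lambda>a. a 0) -` {i} \<inter> (\<lambda>a. \<pi> i (?t a)) -` V)" by auto
    moreover have "open ((\<lambda>a. \<pi> i (?t a)) -` V)" for i
      by (intro open_vimage \<open>open V\<close> continuous_on_compose2[OF C(2) t]) auto
    moreover have "open ((\<lambda>a :: nat \<Rightarrow> nat. a 0) -` {i})" for i
      by (rule open_baire_coordinate)
    ultimately show "open (?p -` V \<inter> UNIV)" by (metis (no_types, lifting) open_UN open_Int)
  qed
  moreover have "(\<Union>i. A i) = {(w, ?p a) | w a. (w, a) \<in> ?C}"
  proof (intro equalityI subsetI)
    fix z assume "z \<in> (\<Union>i. A i)"
    then obtain i w a where z: "z = (w, \<pi> i a)" "(w, a) \<in> C i" using C(3) by auto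
    have "?t (case_nat i a) = a" "case_nat i a 0 = i" by auto
    then show "z \<in> {(w, ?p a) | w a. (w, a) \<in> ?C}"
      using z by (intro CollectI exI[of _ w] exI[of _ "case_nat i a"]) auto
  next
    fix z assume "z \<in> {(w, ?p a) | w a. (w, a) \<in> ?C}"
    then obtain w a where "z = (w, ?p a)" "(w, ?t a) \<in> C (a 0)" by blast
    then have "z \<in> A (a 0)" unfolding C(3) by blast
    then show "z \<in> (\<Union>i. A i)" by blast
  qed
  ultimately show ?thesis
    unfolding analytic_in_def using cyl_closed_glue[OF C(1)]
    by (intro exI[of _ ?C] exI[of _ ?p] conjI)
qed

text \<open>One sequence stores codes for all the sets at once through \<open>prod_encode\<close>.
  The codes have to name the same point, a closed condition in a Hausdorff space: \<open>D 0\<close>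
  holds it, and \<open>D (Suc i)\<close> holds membership in the set with index
  \<open>i\<close>.\<close>

lemma analytic_in_INT:
  fixes A :: "nat \<Rightarrow> ('w \<times> 'x::t2_space) set"
  assumes "\<And>i::nat. analytic_in N (A i)"
  shows "analytic_in N (\<Inter>i. A i)"
proof -
  have "\<forall>i. \<exists>C \<pi>. cyl_closed N C \<and> continuous_on UNIV \<pi> \<and> A i = {(w, \<pi> a) | w a. (w, a) \<in> C}"
    using assms unfolding analytic_in_def by blast
  from choice[OF this] obtain C where
    "\<forall>i. \<exists>\<pi>. cyl_closed N (C i) \<and> continuous_on UNIV \<pi> \<and> A i = {(w, \<pi> a) | w a. (w, a) \<in> C i}" ..
  from choice[OF this] obtain \<pi> where C: "\<And>i. cyl_closed N (C i)" "\<And>i. continuous_on UNIV (\<pi> i)"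
    "\<And>i. A i = {(w, \<pi> i a) | w a. (w, a) \<in> C i}" by blast
  define \<theta> where "\<theta> i a = (\<lambda>k. a (prod_encode (i, k)))" for i and a :: "nat \<Rightarrow> nat"
  have \<theta>: "continuous_on UNIV (\<theta> i)" for i unfolding \<theta>_def
    by (intro continuous_on_coordinatewise_then_product continuous_on_product_coordinates)
  have \<pi>\<theta>: "continuous_on UNIV (\<lambda>a. \<pi> i (\<theta> i a))" for i
    by (intro continuous_on_compose2[OF C(2) \<theta>]) auto
  let ?F = "{a. \<forall>i. \<pi> i (\<theta> i a) = \<pi> 0 (\<theta> 0 a)}"
  have F: "closed ?F"
    by (intro closed_Collect_all closed_Collect_eq \<pi>\<theta>)
  define D where "D j = (case j of 0 \<Rightarrow> space N \<times> ?F | Suc i \<Rightarrow> {(w, a). (w, \<theta> i a) \<in> C i})" for j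
  have "cyl_closed N (D j)" for j
    unfolding D_def by (auto intro!: cyl_closed_Times F cyl_closed_vimage C \<theta> split: nat.split)
  then have "cyl_closed N (\<Inter>j. D j)" by (rule cyl_closed_INT)
  moreover have CN: "w \<in> space N" if "(w, a) \<in> C i" for w a i
  proof -
    obtain c where c: "\<forall>s. c s \<in> sets N" "C i = {(w, a). \<forall>k. w \<in> c (map a [0..<k])}"
      using C(1)[of i] unfolding cyl_closed_def by blast
    have "\<forall>k. w \<in> c (map a [0..<k])" using that unfolding c(2) by simp
    then have "w \<in> c []" by (metis list.map_disc_iff upt_0)
    then show ?thesis using c(1) sets.sets_into_space by blast
  qed
  have D: "(w, a) \<in> (\<Inter>j. D j) \<longleftrightarrow> a \<in> ?F \<and> (\<forall>i. (w, \<theta> i a) \<in> C i)" for w a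
  proof -
    have "(w, a) \<in> (\<Inter>j. D j) \<longleftrightarrow> (w, a) \<in> D 0 \<and> (\<forall>i. (w, a) \<in> D (Suc i))"
      by (auto, metis not0_implies_Suc)
    also have "\<dots> \<longleftrightarrow> a \<in> ?F \<and> (\<forall>i. (w, \<theta> i a) \<in> C i)" using CN[of w "\<theta> 0 a" 0] by (auto simp: D_def)
    finally show ?thesis .
  qed
  moreover have "(\<Inter>i. A i) = {(w, \<pi> 0 (\<theta> 0 a)) | w a. (w, a) \<in> (\<Inter>j. D j)}"
  proof (intro equalityI subsetI)
    fix z assume z: "z \<in> (\<Inter>i. A i)"
    have "\<exists>a. (fst z, a) \<in> C i \<and> snd z = \<pi> i a" for i
    proof -
      have "z \<in> A i" using z by simp
      then show ?thesis unfolding C(3) by auto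
    qed
    then obtain a where a: "\<And>i. (fst z, a i) \<in> C i" "\<And>i. snd z = \<pi> i (a i)" by metis
    let ?b = "\<lambda>m. case prod_decode m of (i, k) \<Rightarrow> a i k"
    have b: "\<theta> i ?b = a i" for i by (simp add: \<theta>_def)
    then have "?b \<in> ?F" using a(2) by simp
    then have "(fst z, ?b) \<in> (\<Inter>j. D j)" unfolding D using b a by simp
    moreover have "z = (fst z, \<pi> 0 (\<theta> 0 ?b))" using a(2)[of 0] b[of 0] by (simp add: prod_eq_iff)
    ultimately show "z \<in> {(w, \<pi> 0 (\<theta> 0 a)) | w a. (w, a) \<in> (\<Inter>j. D j)}" by blast
  next
    fix z assume "z \<in> {(w, \<pi> 0 (\<theta> 0 a)) | w a. (w, a) \<in> (\<Inter>j. D j)}"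
    then obtain w a where z: "z = (w, \<pi> 0 (\<theta> 0 a))" "(w, a) \<in> (\<Inter>j. D j)" by blast
    have "z \<in> A i" for i
    proof -
      have "\<pi> i (\<theta> i a) = \<pi> 0 (\<theta> 0 a)" "(w, \<theta> i a) \<in> C i" using z(2) unfolding D by auto
      then have "z = (w, \<pi> i (\<theta> i a))" "(w, \<theta> i a) \<in> C i" using z(1) by (simp_all only:)
      then show ?thesis unfolding C(3) by blast
    qed
    then show "z \<in> (\<Inter>i. A i)" by blast
  qed
  ultimately show ?thesis
    unfolding analytic_in_def using \<pi>\<theta>[of 0]
    by (intro exI[of _ "\<Inter>j. D j"] exI[of _ "\<lambda>a. \<pi> 0 (\<theta> 0 a)"] conjI)
qed

text \<open>Complements of analytic sets need not be analytic, so the induction over the product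
  sigma-algebra carries each set together with its complement, starting from rectangles with an open
  side.\<close>

lemma analytic_in_sets_pair:
  fixes \<beta> :: "(nat \<Rightarrow> nat) \<Rightarrow> 'x::t2_space"
  assumes \<beta>: "continuous_on UNIV \<beta>" "surj \<beta>" and A: "A \<in> sets (N \<Otimes>\<^sub>M (borel :: 'x measure))"
  shows "analytic_in N A"
proof -
  have rect: "analytic_in N (S \<times> \<beta> ` F)" if "S \<in> sets N" "closed F" for S F
    unfolding analytic_in_def using cyl_closed_Times[OF that] \<beta>(1)
    by (intro exI[of _ "S \<times> F"] exI[of _ \<beta>]) auto
  have closed: "analytic_in N (S \<times> F)" if "S \<in> sets N" "closed F" for S and F :: "'x set"
  proof -
    have "\<beta> ` (\<beta> -` F) = F" using \<beta>(2) by (rule surj_image_vimage_eq)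
    then show ?thesis using rect[OF that(1) closed_vimage[OF that(2) \<beta>(1)]] by simp
  qed
  have "open": "analytic_in N (S \<times> V)" if "S \<in> sets N" "open V" for S and V :: "'x set"
  proof -
    \<comment> \<open>An open set of sequences is a countable union of clopen cylinders;
      \<open>F\<close> enumerates those inside the preimage of \<open>V\<close>, with the empty set
      as filler.\<close>
    define F where "F n = (let s = from_nat n :: nat list; Z = {a. map a [0..<length s] = s} in
       if Z \<subseteq> \<beta> -` V then Z else {})" for n
    have "open (- {a :: nat \<Rightarrow> nat. map a [0..<length s] = s})" for s
      unfolding open_baire_iff by (metis (mono_tags, lifting) length_map mem_Collect_eq ComplD ComplI)
    then have "closed (F n)" for n unfolding F_def Let_def by (auto simp: closed_def)
    then have "analytic_in N (\<Union>n. S \<times> \<beta> ` F n)" by (intro analytic_in_UN rect that)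
    moreover have "(\<Union>n. F n) = \<beta> -` V"
    proof (intro equalityI subsetI)
      fix a assume "a \<in> \<beta> -` V"
      moreover have "open (\<beta> -` V)" by (rule open_vimage[OF that(2) \<beta>(1)])
      ultimately obtain k where "\<forall>b. map b [0..<k] = map a [0..<k] \<longrightarrow> b \<in> \<beta> -` V"
        unfolding open_baire_iff by blast
      then have "a \<in> F (to_nat (map a [0..<k]))" unfolding F_def Let_def by auto
      then show "a \<in> (\<Union>n. F n)" by blast
    qed (auto simp: F_def Let_def split: if_splits)
    then have "\<beta> ` (\<Union>n. F n) = V" using \<beta>(2) by (simp only: surj_image_vimage_eq)
    then have "(\<Union>n. S \<times> \<beta> ` F n) = S \<times> V" by blast
    ultimately show ?thesis by simp
  qed
  let ?\<Omega> = "space N \<times> (UNIV :: 'x set)"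
  let ?G = "{a \<times> b | a b. a \<in> sets N \<and> b \<in> {V :: 'x set. open V}}"
  have G: "?G \<subseteq> Pow ?\<Omega>" by (auto dest: sets.sets_into_space)
  have "sets (N \<Otimes>\<^sub>M (borel :: 'x measure)) = sets (sigma (space N \<times> space borel) ?G)"
    by (intro sets_pair_eq[where Ca="{space N}" and Cb="{UNIV}"])
       (auto simp: sets.sigma_sets_eq borel_def dest: sets.sets_into_space)
  then have "A \<in> sigma_sets ?\<Omega> ?G" using A G by simp
  then have "analytic_in N A \<and> analytic_in N (?\<Omega> - A)"
  proof (induction rule: sigma_sets.induct)
    case (Basic Z)
    then obtain S V where Z: "Z = S \<times> V" "S \<in> sets N" "open V" by blast
    define W where "W n = (if n = 0 then (space N - S) \<times> UNIV else space N \<times> (- V))" for n :: nat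
    have "analytic_in N (W n)" for n
      unfolding W_def using Z closed[of "space N - S" UNIV] closed[of "space N" "- V"] by auto
    then have "analytic_in N (\<Union>n. W n)" by (rule analytic_in_UN)
    moreover have "(\<Union>n. W n) = ?\<Omega> - Z"
      using sets.sets_into_space[OF Z(2)] unfolding W_def Z(1) by (auto split: if_splits)
    ultimately show ?case using Z "open" by simp
  next
    case Empty
    show ?case using closed[of "space N" UNIV] closed[of "{}" UNIV] by simp
  next
    case (Compl Z)
    then have "Z \<subseteq> ?\<Omega>" using sigma_sets_into_sp[OF G] by blast
    then have "?\<Omega> - (?\<Omega> - Z) = Z" by blast
    then show ?case using Compl.IH by simp
  next
    case (Union Z)
    have "?\<Omega> - (\<Union>i. Z i) = (\<Inter>i. ?\<Omega> - Z i)" by blast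
    then show ?case using analytic_in_UN[of N Z] analytic_in_INT[of N "\<lambda>i. ?\<Omega> - Z i"] Union.IH by simp
  qed
  then show ?thesis ..
qed

text \<open>Measurable envelopes of the projections of the cylinder pieces form, up to a null set, a tree
  in which every node is covered by its children; the selection is its leftmost branch.\<close>

lemma analytic_in_selection:
  assumes "finite_measure N" "analytic_in N A"
  obtains s D where "s \<in> N \<rightarrow>\<^sub>M borel" "D \<in> sets N" "fst ` A \<subseteq> D"
    "AE w in N. w \<in> D \<longrightarrow> (w, s w) \<in> A"
proof -
  interpret finite_measure N by fact
  obtain C \<pi> where C: "cyl_closed N C" and \<pi>: "continuous_on UNIV \<pi>"
    and A0: "A = {(w, \<pi> a) | w a. (w, a) \<in> C}"
    using assms(2) unfolding analytic_in_def by blast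
  obtain c where c: "\<And>s. c s \<in> sets N" and C_eq: "C = {(w, a). \<forall>k. w \<in> c (map a [0..<k])}"
    using C unfolding cyl_closed_def by blast
  have A: "A = {(w, \<pi> a) | w a. \<forall>k. w \<in> c (map a [0..<k])}"
    unfolding A0 C_eq by simp
  \<comment> \<open>\<open>P s\<close> is the set of \<open>w\<close> whose section has a branch
    through \<open>s\<close>. It is a projection and may fail to be measurable.\<close>
  define P where "P s = {w. \<exists>b. map b [0..<length s] = s \<and> (\<forall>k. w \<in> c (map b [0..<k]))}" for s
  have Pc: "P s \<subseteq> c s" for s unfolding P_def by (auto, metis)
  have "\<exists>E. measurable_envelope N (P s) E" for s
  proof -
    have "P s \<subseteq> (\<Union>n::nat. space N)" using Pc[of s] sets.sets_into_space[OF c[of s]] by auto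
    moreover have "emeasure N (space N) < \<infinity>"
      using emeasure_finite[of "space N"] by (simp add: less_top[symmetric])
    ultimately show ?thesis
      using measurable_envelopeI_countable_cover[of "P s" "\<lambda>_. space N" N] by blast
  qed
  then obtain E0 where E0: "\<And>s. measurable_envelope N (P s) (E0 s)" by metis
  \<comment> \<open>Cutting with \<open>c s\<close> makes every branch that stays inside the
    envelopes a branch of \<open>C\<close>.\<close>
  define E where "E s = E0 s \<inter> c s" for s
  have E_sets [measurable]: "E s \<in> sets N" for s
    unfolding E_def using measurable_envelopeD(2)[OF E0] c by auto
  have PE: "P s \<subseteq> E s" for s
    unfolding E_def using measurable_envelopeD(1)[OF E0] Pc by auto
  have "E s - (\<Union>n. E (s @ [n])) \<in> null_sets N" for s
  proof -
    have "P s \<subseteq> (\<Union>n. P (s @ [n]))"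
    proof
      fix w assume "w \<in> P s"
      then obtain b where b: "map b [0..<length s] = s" "\<forall>k. w \<in> c (map b [0..<k])"
        unfolding P_def by blast
      then have "w \<in> P (s @ [b (length s)])" unfolding P_def by auto
      then show "w \<in> (\<Union>n. P (s @ [n]))" by blast
    qed
    also have "\<dots> \<subseteq> (\<Union>n. E (s @ [n]))" by (intro UN_mono PE subset_refl)
    finally have "P s \<subseteq> (\<Union>n. E (s @ [n]))" .
    \<comment> \<open>The uncovered part of \<open>E s\<close> is measurable and disjoint from
      \<open>P s\<close>; an envelope leaves no mass for such a set.\<close>
    then have "E s - (\<Union>n. E (s @ [n])) \<subseteq> E0 s - P s" unfolding E_def by auto
    then show ?thesis
      using measurable_envelopeD1[OF E0[of s], of "E s - (\<Union>n. E (s @ [n]))"] by auto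
  qed
  then have "AE w in N. w \<notin> E s - (\<Union>n. E (s @ [n]))" for s by (rule AE_not_in)
  then have "AE w in N. \<forall>s. w \<notin> E s - (\<Union>n. E (s @ [n]))"
    unfolding AE_all_countable by blast
  then have step: "AE w in N. \<forall>s. w \<in> E s \<longrightarrow> (\<exists>n. w \<in> E (s @ [n]))" by simp
  define q where "q w = rec_nat [] (\<lambda>_ s. s @ [LEAST n. w \<in> E (s @ [n])])" for w
  have q0: "q w 0 = []" and qS: "q w (Suc k) = q w k @ [LEAST n. w \<in> E (q w k @ [n])]" for w k
    by (simp_all add: q_def)
  define a where "a w k = (LEAST n. w \<in> E (q w k @ [n]))" for w k
  have qa: "map (a w) [0..<k] = q w k" for w k
    by (induction k) (simp_all add: q0 qS a_def)
  have q_meas: "(\<lambda>w. q w k) \<in> N \<rightarrow>\<^sub>M count_space UNIV" for k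
  proof (induction k)
    case (Suc k)
    have "(\<lambda>w. s @ [LEAST n. w \<in> E (s @ [n])]) \<in> N \<rightarrow>\<^sub>M count_space UNIV" for s
    proof -
      have "(\<lambda>w. LEAST n. w \<in> E (s @ [n])) \<in> N \<rightarrow>\<^sub>M count_space UNIV" by measurable
      then show ?thesis by (rule measurable_compose) simp
    qed
    then show ?case unfolding qS
      by (rule measurable_compose_countable[where f="\<lambda>s w. s @ [LEAST n. w \<in> E (s @ [n])]", OF _ Suc])
  qed (simp add: q0)
  have "(\<lambda>w. a w k) \<in> borel_measurable N" for k
  proof -
    have "(\<lambda>w. LEAST n. w \<in> E (s @ [n])) \<in> borel_measurable N" for s
    proof -
      have "(\<lambda>w. LEAST n. w \<in> E (s @ [n])) \<in> N \<rightarrow>\<^sub>M count_space UNIV" by measurable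
      then show ?thesis by (rule measurable_compose) simp
    qed
    then show ?thesis unfolding a_def
      by (rule measurable_compose_countable[where f="\<lambda>s w. LEAST n. w \<in> E (s @ [n])", OF _ q_meas])
  qed
  then have "a \<in> borel_measurable N" by (rule measurable_coordinatewise_then_product)
  then have "(\<lambda>w. \<pi> (a w)) \<in> borel_measurable N"
    by (rule measurable_compose) (rule borel_measurable_continuous_onI[OF \<pi>])
  moreover have "fst ` A \<subseteq> P []"
  proof
    fix w assume "w \<in> fst ` A"
    then obtain a where "\<forall>k. w \<in> c (map a [0..<k])" unfolding A by auto
    then show "w \<in> P []" unfolding P_def by (intro CollectI exI[of _ a]) simp
  qed
  then have "fst ` A \<subseteq> E []" using PE by (rule subset_trans)
  moreover have "AE w in N. w \<in> E [] \<longrightarrow> (w, \<pi> (a w)) \<in> A"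
    using step
  proof eventually_elim
    case (elim w)
    show ?case
    proof
      assume "w \<in> E []"
      have "w \<in> E (q w k)" for k
      proof (induction k)
        case (Suc k)
        then have "\<exists>n. w \<in> E (q w k @ [n])" using elim by blast
        then show ?case unfolding qS by (rule LeastI_ex)
      qed (simp add: q0 \<open>w \<in> E []\<close>)
      then have "\<forall>k. w \<in> c (map (a w) [0..<k])" unfolding qa E_def by blast
      then show "(w, \<pi> (a w)) \<in> A" unfolding A by blast
    qed
  qed
  ultimately show ?thesis using that E_sets by blast
qed

section \<open>Saturation and countably generated algebras\<close>

definition lin_comb :: "(real \<times> 't set) list \<Rightarrow> 't \<Rightarrow> real" where
  "lin_comb xs t = (\<Sum>(r, C)\<leftarrow>xs. r * indicator C t)"

text \<open>Membership in the L1 closure of the rational span of the indicators of \<A>. Rational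
  coefficients and finite lists keep the approximating family countable whenever \<A> is.\<close>

definition L1_approx :: "'t measure \<Rightarrow> 't set set \<Rightarrow> ('t \<Rightarrow> real) \<Rightarrow> bool" where
  "L1_approx N \<A> f \<longleftrightarrow>
     (\<forall>e>0. \<exists>xs\<in>lists (\<rat> \<times> \<A>). (\<integral>t. \<bar>f t - lin_comb xs t\<bar> \<partial>N) < e)"

lemma lin_comb_Nil: "lin_comb [] = (\<lambda>_. 0)"
  and lin_comb_append: "lin_comb (xs @ ys) t = lin_comb xs t + lin_comb ys t"
  and lin_comb_scale: "lin_comb (map (\<lambda>(r, C). (c * r, C)) xs) t = c * lin_comb xs t"
  unfolding lin_comb_def by (auto simp: comp_def case_prod_unfold sum_list_const_mult mult.assoc)

context finite_measure
begin

lemma integrable_lin_comb: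
  assumes "xs \<in> lists (\<rat> \<times> \<A>)" "\<A> \<subseteq> sets M"
  shows "integrable M (lin_comb xs)"
  using assms(1)
proof (induction xs)
  case (Cons z xs)
  then show ?case using assms(2)
    by (auto simp: lin_comb_def less_top[symmetric] intro!: Bochner_Integration.integrable_add)
qed (simp add: lin_comb_Nil)

context
  fixes \<A> :: "'a set set"
  assumes \<A>: "\<A> \<subseteq> sets M"
begin

lemma L1_approx_add:
  assumes "integrable M f" "integrable M g" "L1_approx M \<A> f" "L1_approx M \<A> g"
  shows "L1_approx M \<A> (\<lambda>t. f t + g t)"
  unfolding L1_approx_def
proof (intro allI impI)
  fix e :: real assume "e > 0"
  then have e: "e / 2 > 0" by simp
  obtain xs where xs: "xs \<in> lists (\<rat> \<times> \<A>)" "(\<integral>t. \<bar>f t - lin_comb xs t\<bar> \<partial>M) < e/2"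
    using assms(3) e unfolding L1_approx_def by blast
  obtain ys where ys: "ys \<in> lists (\<rat> \<times> \<A>)" "(\<integral>t. \<bar>g t - lin_comb ys t\<bar> \<partial>M) < e/2"
    using assms(4) e unfolding L1_approx_def by blast
  note [simp] = assms(1,2) integrable_lin_comb[OF xs(1) \<A>] integrable_lin_comb[OF ys(1) \<A>]
  have "(\<integral>t. \<bar>f t + g t - lin_comb (xs @ ys) t\<bar> \<partial>M)
      \<le> (\<integral>t. \<bar>f t - lin_comb xs t\<bar> + \<bar>g t - lin_comb ys t\<bar> \<partial>M)"
    unfolding lin_comb_append by (intro integral_mono) auto
  also have "\<dots> < e" using xs(2) ys(2) by simp
  finally show "\<exists>zs\<in>lists (\<rat> \<times> \<A>). (\<integral>t. \<bar>f t + g t - lin_comb zs t\<bar> \<partial>M) < e"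
    using xs(1) ys(1) by (intro bexI[of _ "xs @ ys"]) auto
qed

lemma L1_approx_scale:
  assumes f: "integrable M f" and "L1_approx M \<A> f"
  shows "L1_approx M \<A> (\<lambda>t. c * f t)"
  unfolding L1_approx_def
proof (intro allI impI)
  fix e :: real assume e: "e > 0"
  \<comment> \<open>Two errors share \<open>e\<close>: passing from \<open>c\<close> to a rational
    \<open>q\<close> costs at most \<open>d\<close> times the norm of \<open>f\<close>, and the
    approximation error of \<open>f\<close> is multiplied by \<open>\<bar>q\<bar>\<close>, which
    \<open>d \<le> 1\<close> keeps below \<open>\<bar>c\<bar> + 1\<close>. The summand 1 keeps the
    divisor \<open>K\<close> positive.\<close>
  define K where "K = (\<integral>t. \<bar>f t\<bar> \<partial>M) + 1"
  have K: "K > 0" unfolding K_def by (intro add_nonneg_pos) auto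
  define d where "d = min 1 (e / (2 * K))"
  have d: "d > 0" using e K by (simp add: d_def)
  obtain q where q: "q \<in> \<rat>" "c < q" "q < c + d" using Rats_dense_in_real[of c "c + d"] d by auto
  have "0 < e / (2 * (\<bar>c\<bar> + 1))" using e by simp
  then obtain xs where xs: "xs \<in> lists (\<rat> \<times> \<A>)" "(\<integral>t. \<bar>f t - lin_comb xs t\<bar> \<partial>M) < e / (2 * (\<bar>c\<bar> + 1))"
    using assms(2) unfolding L1_approx_def by blast
  note [simp] = f integrable_lin_comb[OF xs(1) \<A>]
  let ?ys = "map (\<lambda>(r, C). (q * r, C)) xs"
  have ys: "?ys \<in> lists (\<rat> \<times> \<A>)" using xs(1) q(1) by (auto simp: in_lists_conv_set)
  have "(\<integral>t. \<bar>c * f t - lin_comb ?ys t\<bar> \<partial>M) \<le> (\<integral>t. d * \<bar>f t\<bar> + \<bar>q\<bar> * \<bar>f t - lin_comb xs t\<bar> \<partial>M)"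
  proof (intro integral_mono)
    fix t
    have "c * f t - lin_comb ?ys t = (c - q) * f t + q * (f t - lin_comb xs t)"
      unfolding lin_comb_scale by (simp add: algebra_simps)
    then have "\<bar>c * f t - lin_comb ?ys t\<bar> \<le> \<bar>c - q\<bar> * \<bar>f t\<bar> + \<bar>q\<bar> * \<bar>f t - lin_comb xs t\<bar>"
      by (metis abs_mult abs_triangle_ineq)
    also have "\<bar>c - q\<bar> * \<bar>f t\<bar> \<le> d * \<bar>f t\<bar>" using q by (intro mult_right_mono) auto
    finally show "\<bar>c * f t - lin_comb ?ys t\<bar> \<le> d * \<bar>f t\<bar> + \<bar>q\<bar> * \<bar>f t - lin_comb xs t\<bar>" by simp
  qed (use integrable_lin_comb[OF ys \<A>] in auto)
  also have "\<dots> = d * (\<integral>t. \<bar>f t\<bar> \<partial>M) + \<bar>q\<bar> * (\<integral>t. \<bar>f t - lin_comb xs t\<bar> \<partial>M)" by simp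
  also have "\<dots> < e / 2 + e / 2"
  proof (rule add_le_less_mono)
    have "d * (\<integral>t. \<bar>f t\<bar> \<partial>M) \<le> e / (2 * K) * K"
      using d K e by (intro mult_mono) (auto simp: d_def K_def)
    then show "d * (\<integral>t. \<bar>f t\<bar> \<partial>M) \<le> e / 2" using K by simp
    have "\<bar>q\<bar> \<le> \<bar>c\<bar> + 1" using q d_def by auto
    then have "\<bar>q\<bar> * (\<integral>t. \<bar>f t - lin_comb xs t\<bar> \<partial>M) \<le> (\<bar>c\<bar> + 1) * (\<integral>t. \<bar>f t - lin_comb xs t\<bar> \<partial>M)"
      by (intro mult_right_mono) auto
    also have "\<dots> < (\<bar>c\<bar> + 1) * (e / (2 * (\<bar>c\<bar> + 1)))"
      using xs(2) by (intro mult_strict_left_mono) auto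
    also have "\<dots> = e / 2" by (simp add: field_simps)
    finally show "\<bar>q\<bar> * (\<integral>t. \<bar>f t - lin_comb xs t\<bar> \<partial>M) < e / 2" .
  qed
  finally show "\<exists>zs\<in>lists (\<rat> \<times> \<A>). (\<integral>t. \<bar>c * f t - lin_comb zs t\<bar> \<partial>M) < e"
    using ys by (intro bexI[of _ ?ys]) auto
qed

lemma L1_approx_closed:
  assumes f: "integrable M f"
    and "\<And>e. e > 0 \<Longrightarrow> \<exists>g. integrable M g \<and> L1_approx M \<A> g \<and> (\<integral>t. \<bar>f t - g t\<bar> \<partial>M) < e"
  shows "L1_approx M \<A> f"
  unfolding L1_approx_def
proof (intro allI impI)
  fix e :: real assume "e > 0"
  then have e: "e / 2 > 0" by simp
  obtain g where g: "integrable M g" "L1_approx M \<A> g" "(\<integral>t. \<bar>f t - g t\<bar> \<partial>M) < e/2"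
    using assms(2)[OF e] by blast
  obtain xs where xs: "xs \<in> lists (\<rat> \<times> \<A>)" "(\<integral>t. \<bar>g t - lin_comb xs t\<bar> \<partial>M) < e/2"
    using g(2) e unfolding L1_approx_def by blast
  note [simp] = f g(1) integrable_lin_comb[OF xs(1) \<A>]
  have "(\<integral>t. \<bar>f t - lin_comb xs t\<bar> \<partial>M) \<le> (\<integral>t. \<bar>f t - g t\<bar> + \<bar>g t - lin_comb xs t\<bar> \<partial>M)"
    by (intro integral_mono) auto
  also have "\<dots> < e" using xs(2) g(3) by simp
  finally show "\<exists>zs\<in>lists (\<rat> \<times> \<A>). (\<integral>t. \<bar>f t - lin_comb zs t\<bar> \<partial>M) < e"
    using xs(1) by blast
qed

lemma L1_approx_cong:
  assumes "\<And>t. t \<in> space M \<Longrightarrow> f t = g t"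
  shows "L1_approx M \<A> f \<longleftrightarrow> L1_approx M \<A> g"
  unfolding L1_approx_def using assms by (simp cong: Bochner_Integration.integral_cong)

lemma L1_approx_tendsto:
  assumes "integrable M f" "\<And>i. integrable M (s i)" "\<And>i. L1_approx M \<A> (s i)"
    and "(\<lambda>i. \<integral>t. \<bar>f t - s i t\<bar> \<partial>M) \<longlonglongrightarrow> 0"
  shows "L1_approx M \<A> f"
proof (rule L1_approx_closed[OF assms(1)])
  fix e :: real assume "e > 0"
  then have "\<forall>\<^sub>F i in sequentially. (\<integral>t. \<bar>f t - s i t\<bar> \<partial>M) < e"
    by (rule order_tendstoD(2)[OF assms(4)])
  then obtain i where "(\<integral>t. \<bar>f t - s i t\<bar> \<partial>M) < e" by (auto simp: eventually_sequentially)
  then show "\<exists>g. integrable M g \<and> L1_approx M \<A> g \<and> (\<integral>t. \<bar>f t - g t\<bar> \<partial>M) < e"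
    using assms(2,3) by blast
qed

text \<open>A Dynkin argument: complements are linear combinations with the indicator of
  \<open>space M\<close>, and a disjoint union is the L1 limit of its finite partial unions.\<close>

lemma L1_approx_indicator:
  assumes "Int_stable \<A>" "space M \<in> \<A>" "A \<in> sigma_sets (space M) \<A>"
  shows "L1_approx M \<A> (indicator A)"
proof -
  have ind [simp]: "integrable M (indicator B :: _ \<Rightarrow> real)" if "B \<in> sets M" for B
    using that emeasure_finite[of B] by (simp add: less_top[symmetric])
  have sub: "B \<in> sets M" if "B \<in> sigma_sets (space M) \<A>" for B
    using that sets.sigma_sets_subset[OF \<A>] by blast
  have basic: "L1_approx M \<A> (indicator B)" if "B \<in> \<A>" for B
  proof -
    have "lin_comb [(1, B)] = indicator B" by (auto simp: lin_comb_def)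
    then show ?thesis unfolding L1_approx_def
      using that by (intro allI impI bexI[of _ "[(1, B)]"]) auto
  qed
  have "\<A> \<subseteq> Pow (space M)" using \<A> sets.sets_into_space by blast
  from assms(1) this assms(3) show ?thesis
  proof (induction rule: sigma_sets_induct_disjoint)
    case (compl B)
    note B = compl
    have "L1_approx M \<A> (\<lambda>t. indicator (space M) t + (-1) * indicator B t)"
      using sub[OF B(1)] basic[OF assms(2)]
      by (intro L1_approx_add L1_approx_scale B(2)) auto
    then show ?case
      by (subst L1_approx_cong[where g="\<lambda>t. indicator (space M) t + (-1) * indicator B t"])
         (auto simp: indicator_def)
  next
    case (union B)
    note B = union
    have Bs [measurable]: "B i \<in> sets M" for i using B(2) sub by blast
    have part: "L1_approx M \<A> (indicator (\<Union>i<n. B i))" for n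
    proof (induction n)
      case 0
      have "L1_approx M \<A> (\<lambda>t. 0 * indicator (space M) t)"
        using basic[OF assms(2)] by (intro L1_approx_scale) auto
      then show ?case by (simp add: indicator_def[abs_def])
    next
      case (Suc n)
      have "t \<notin> B i" if "t \<in> B n" "i < n" for i t
        using B(1) that unfolding disjoint_family_on_def by (metis IntI UNIV_I empty_iff less_irrefl)
      then have "indicator (\<Union>i<Suc n. B i) = (\<lambda>t. indicator (B n) t + indicator (\<Union>i<n. B i) t :: real)"
        by (auto simp: lessThan_Suc indicator_def fun_eq_iff)
      then show ?case using B(3) Suc by (simp add: L1_approx_add)
    qed
    show ?case
    proof (rule L1_approx_tendsto[OF _ _ part])
      have "(\<lambda>n. measure M (\<Union>i<n. B i)) \<longlonglongrightarrow> measure M (\<Union>n. \<Union>i<n. B i)"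
        by (intro finite_Lim_measure_incseq incseq_SucI UN_mono) auto
      moreover have "(\<Union>n. \<Union>i<n. B i) = (\<Union>i. B i)" by auto
      ultimately have "(\<lambda>n. measure M (\<Union>i. B i) - measure M (\<Union>i<n. B i)) \<longlonglongrightarrow> 0"
        by (auto intro!: tendsto_eq_intros)
      moreover have "(\<integral>t. \<bar>indicator (\<Union>i. B i) t - indicator (\<Union>i<n. B i) t\<bar> \<partial>M)
          = measure M (\<Union>i. B i) - measure M (\<Union>i<n. B i)" for n
      proof -
        have "(\<lambda>t. \<bar>indicator (\<Union>i. B i) t - indicator (\<Union>i<n. B i) t\<bar>) =
          (\<lambda>t. indicator (\<Union>i. B i) t - indicator (\<Union>i<n. B i) t :: real)"
          by (auto simp: fun_eq_iff indicator_def)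
        then show ?thesis by simp
      qed
      ultimately show "(\<lambda>n. (\<integral>t. \<bar>indicator (\<Union>i. B i) t - indicator (\<Union>i<n. B i) t :: real\<bar> \<partial>M)) \<longlonglongrightarrow> 0"
        by (simp only:)
    qed auto
  next
    case empty
    show ?case unfolding L1_approx_def by (intro allI impI bexI[of _ "[]"]) (auto simp: lin_comb_Nil)
  qed (use basic in auto)
qed

end

text \<open>The dense family consists of rational combinations of finite intersections from \<A>.
  Generation is asked only modulo null sets, which L1 does not see; saturation is contradicted in
  this form.\<close>

lemma separable_L1I:
  assumes \<A>: "countable \<A>" "\<A> \<subseteq> sets M"
    and gen: "\<And>A. A \<in> sets M \<Longrightarrow> \<exists>B\<in>sigma_sets (space M) \<A>. sym_diff A B \<in> null_sets M"
  shows "separable_L1 M"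
proof -
  \<comment> \<open>The empty subfamily contributes \<open>space M\<close>, so closing under finite
    intersections also supplies the unit needed for complements.\<close>
  define \<C> where "\<C> = (\<lambda>F. space M \<inter> \<Inter>F) ` {F. finite F \<and> F \<subseteq> \<A>}"
  have \<C>_sets: "\<C> \<subseteq> sets M"
  proof
    fix C assume "C \<in> \<C>"
    then obtain F where "C = space M \<inter> \<Inter>F" "finite F" "F \<subseteq> \<A>" by (auto simp: \<C>_def)
    then show "C \<in> sets M" using \<A>(2) by (cases "F = {}") (auto intro!: sets.Int sets.finite_INT[of F "\<lambda>x. x", simplified])
  qed
  have "countable \<C>" unfolding \<C>_def by (intro countable_image countable_Collect_finite_subset \<A>)
  have "Int_stable \<C>"
  proof (rule Int_stableI)
    fix A B assume "A \<in> \<C>" "B \<in> \<C>"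
    then obtain F G where "A = space M \<inter> \<Inter>F" "finite F" "F \<subseteq> \<A>" "B = space M \<inter> \<Inter>G" "finite G" "G \<subseteq> \<A>"
      by (auto simp: \<C>_def)
    then show "A \<inter> B \<in> \<C>" unfolding \<C>_def by (intro image_eqI[of _ _ "F \<union> G"]) auto
  qed
  have "space M \<in> \<C>" unfolding \<C>_def by (intro image_eqI[of _ _ "{}"]) auto
  have "\<A> \<subseteq> \<C>"
  proof
    fix A assume "A \<in> \<A>"
    then show "A \<in> \<C>" using \<A>(2) sets.sets_into_space unfolding \<C>_def
      by (intro image_eqI[of _ _ "{A}"]) auto
  qed
  have ind: "L1_approx M \<C> (indicator A)" if A [measurable]: "A \<in> sets M" for A
  proof -
    obtain B where B: "B \<in> sigma_sets (space M) \<A>" "sym_diff A B \<in> null_sets M" using gen[OF A] by blast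
    then have [measurable]: "B \<in> sets M" using sets.sigma_sets_subset[OF \<A>(2)] by blast
    have "B \<in> sigma_sets (space M) \<C>" using B(1) sigma_sets_mono'[OF \<open>\<A> \<subseteq> \<C>\<close>] by blast
    then have "L1_approx M \<C> (indicator B)"
      by (rule L1_approx_indicator[OF \<C>_sets \<open>Int_stable \<C>\<close> \<open>space M \<in> \<C>\<close>])
    moreover have "(\<integral>t. \<bar>indicator A t - indicator B t\<bar> \<partial>M) = (\<integral>t. 0 \<partial>M :: real)"
      by (intro integral_cong_AE) (use AE_not_in[OF B(2)] in \<open>auto simp: indicator_def elim!: eventually_mono\<close>)
    ultimately show ?thesis
      by (intro L1_approx_closed[OF \<C>_sets])
         (auto simp: less_top[symmetric] intro!: exI[of _ "indicator B"])
  qed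
  have "L1_approx M \<C> h" if "integrable M h" for h
    using that
  proof (induct rule: integrable_induct)
    case (base A c)
    then have "L1_approx M \<C> (\<lambda>t. c * indicator A t)"
      by (intro L1_approx_scale[OF \<C>_sets] ind) auto
    then show ?case by (simp add: mult.commute)
  next
    case (add f g)
    then show ?case by (intro L1_approx_add[OF \<C>_sets])
  next
    case (lim f s)
    note [measurable] = borel_measurable_integrable[OF lim(1)] borel_measurable_integrable[OF lim(5)]
    have "(\<lambda>i. \<integral>t. \<bar>f t - s i t\<bar> \<partial>M) \<longlonglongrightarrow> (\<integral>t. 0 \<partial>M)"
    \<comment> \<open>\<open>integrable_induct\<close> bounds the approximants by
      \<open>2 * norm (f t)\<close>; the difference from \<open>f\<close> adds one more.\<close>
    proof (rule integral_dominated_convergence[where w="\<lambda>t. 3 * norm (f t)"])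
      show "AE t in M. (\<lambda>i. \<bar>f t - s i t\<bar>) \<longlonglongrightarrow> 0"
        using lim(3) by (intro AE_I2 tendsto_rabs_zero) (auto intro!: tendsto_eq_intros)
      show "AE t in M. norm \<bar>f t - s i t\<bar> \<le> 3 * norm (f t)" for i
        using lim(4)[of _ i] by (intro AE_I2) (fastforce simp: abs_le_iff)
    qed (use lim in auto)
    then show ?case using lim by (intro L1_approx_tendsto[OF \<C>_sets, of f s]) auto
  qed
  moreover have "countable (lin_comb ` lists (\<rat> \<times> \<C>))"
    using \<open>countable \<C>\<close> by (intro countable_image countable_lists countable_SIGMA countable_rat)
  moreover have "lin_comb ` lists (\<rat> \<times> \<C>) \<subseteq> {g. integrable M g}"
    using integrable_lin_comb[OF _ \<C>_sets] by auto
  ultimately show ?thesis unfolding separable_L1_def L1_approx_def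
    by (intro exI[of _ "lin_comb ` lists (\<rat> \<times> \<C>)"]) auto
qed

end

text \<open>By contraposition: if every measurable subset of \<open>S\<close> were a trace of the
  generated sigma-algebra up to a null set, the countable family of traces of \<A> would make the
  integrable functions on \<open>S\<close> separable.\<close>

lemma saturated_not_generated:
  assumes "finite_measure M" "saturated_measure M" "countable \<A>" "\<A> \<subseteq> sets M"
    and S: "S \<in> sets M" "emeasure M S > 0"
  shows "\<exists>A\<in>sets M. A \<subseteq> S \<and> (\<forall>B\<in>sigma_sets (space M) \<A>. sym_diff A (B \<inter> S) \<notin> null_sets M)"
proof (rule ccontr)
  assume neg: "\<not> ?thesis"
  interpret finite_measure M by fact
  let ?N = "restrict_space M S"
  have SM: "S \<inter> space M = S" using S(1) sets.sets_into_space by blast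
  interpret N: finite_measure ?N
    by (rule finite_measure_restrict_space) (use S finite_measure_axioms SM in auto)
  have space_N: "space ?N = S" using SM by (simp add: space_restrict_space)
  have sets_N: "A \<in> sets ?N \<longleftrightarrow> A \<subseteq> S \<and> A \<in> sets M" for A
    using S(1) by (intro sets_restrict_space_iff) simp
  have trace: "B \<inter> S \<in> sigma_sets S ((\<lambda>A. A \<inter> S) ` \<A>)" if "B \<in> sigma_sets (space M) \<A>" for B
    using that
  proof (induction rule: sigma_sets.induct)
    case (Compl B)
    have "(space M - B) \<inter> S = S - (B \<inter> S)" using SM by auto
    then show ?case using Compl.IH by (simp add: sigma_sets.Compl)
  next
    case (Union B)
    then show ?case using sigma_sets.Union[of "\<lambda>i. B i \<inter> S"] by simp
  qed (auto intro: sigma_sets.intros)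
  have "separable_L1 ?N"
  proof (rule N.separable_L1I)
    show "countable ((\<lambda>A. A \<inter> S) ` \<A>)" using assms(3) by simp
    show "(\<lambda>A. A \<inter> S) ` \<A> \<subseteq> sets ?N" using assms(4) S by (auto simp: sets_N)
    fix A assume "A \<in> sets ?N"
    then have A: "A \<subseteq> S" "A \<in> sets M" by (auto simp: sets_N)
    have "\<not> (\<forall>B\<in>sigma_sets (space M) \<A>. sym_diff A (B \<inter> S) \<notin> null_sets M)"
      using neg A by blast
    then obtain B where B: "B \<in> sigma_sets (space M) \<A>" "sym_diff A (B \<inter> S) \<in> null_sets M"
      by blast
    have "sym_diff A (B \<inter> S) \<subseteq> S" using A by auto
    then have "sym_diff A (B \<inter> S) \<in> null_sets ?N"
      using B(2) S SM by (auto simp: null_sets_restrict_space)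
    then show "\<exists>B\<in>sigma_sets (space ?N) ((\<lambda>A. A \<inter> S) ` \<A>). sym_diff A B \<in> null_sets ?N"
      using trace[OF B(1)] unfolding space_N by blast
  qed
  then show False using assms(2) S unfolding saturated_measure_def by blast
qed

section \<open>Splitting sets with prescribed conditional probability\<close>

context finite_measure_subalgebra
begin

lemma sets_F: "B \<in> sets F \<Longrightarrow> B \<in> sets M"
  using subalg by (auto simp: subalgebra_def)

lemma set_integrable_F: "integrable M g \<Longrightarrow> B \<in> sets F \<Longrightarrow> set_integrable M B (g :: 'a \<Rightarrow> real)"
  unfolding set_integrable_def by (intro integrable_mult_indicator sets_F)

lemma integrable_cond_prob: "A \<in> sets M \<Longrightarrow> integrable M (real_cond_exp M F (indicator A))"
  using emeasure_finite[of A] by (intro real_cond_exp_int(1)) (simp add: less_top[symmetric])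

text \<open>It translates pointwise bounds on conditional probabilities into bounds on
  \<open>measure M (A \<inter> B)\<close> for all \<open>B\<close> in \<open>F\<close> at
  once.\<close>

lemma measure_Int_eq_cond_prob:
  assumes A: "A \<in> sets M" and B: "B \<in> sets F"
  shows "measure M (A \<inter> B) = (\<integral>x\<in>B. real_cond_exp M F (indicator A) x \<partial>M)"
proof -
  have "integrable M (indicator A :: 'a \<Rightarrow> real)"
    using A emeasure_finite[of A] by (simp add: less_top[symmetric])
  then have "(\<integral>x\<in>B. real_cond_exp M F (indicator A) x \<partial>M) = (\<integral>x\<in>B. indicator A x \<partial>M)"
    using real_cond_exp_intA[OF _ B] by metis
  also have "\<dots> = (\<integral>x. indicator (A \<inter> B) x \<partial>M)"
    unfolding set_lebesgue_integral_def
    by (intro Bochner_Integration.integral_cong) (auto simp: indicator_def)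
  finally show ?thesis using A sets_F[OF B] by simp
qed

text \<open>Absence of conditional atoms over \<open>F\<close>: no set of positive measure has all
  its measurable subsets cut out by sets of \<open>F\<close> up to null sets.\<close>

definition conditionally_diffuse :: bool where
  "conditionally_diffuse \<longleftrightarrow> (\<forall>S\<in>sets M. measure M S > 0 \<longrightarrow>
     (\<exists>A\<in>sets M. A \<subseteq> S \<and> (\<forall>B\<in>sets F. sym_diff A (B \<inter> S) \<notin> null_sets M)))"

context
  assumes diffuse: conditionally_diffuse
begin

text \<open>Start from a subset \<open>A\<close> that is not a trace of \<open>F\<close>. Where its
  conditional probability is at most half that of \<open>S\<close>, keep \<open>A\<close>; elsewhere
  keep \<open>S - A\<close>. One of the two pieces has positive measure, for otherwise
  \<open>A\<close> would be the trace of \<open>B2\<close> on \<open>S\<close> up to a null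
  set.\<close>

lemma conditional_halving:
  assumes S: "S \<in> sets M" "measure M S > 0"
  shows "\<exists>A\<in>sets M. A \<subseteq> S \<and> measure M A > 0 \<and> (\<forall>B\<in>sets F. measure M (A \<inter> B) \<le> measure M (S \<inter> B) / 2)"
proof -
  from bspec[OF diffuse[unfolded conditionally_diffuse_def] S(1), THEN mp, OF S(2)]
  obtain A where A: "A \<in> sets M" "A \<subseteq> S \<and> (\<forall>B\<in>sets F. sym_diff A (B \<inter> S) \<notin> null_sets M)"
    by (rule bexE)
  note AS = conjunct1[OF A(2)] and A_diff = bspec[OF conjunct2[OF A(2)]]
  let ?a = "real_cond_exp M F (indicator A)" and ?s = "real_cond_exp M F (indicator S)"
  have int [simp]: "integrable M ?a" "integrable M ?s" using A(1) S by (auto intro: integrable_cond_prob)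
  define B1 where "B1 = {x \<in> space F. ?a x \<le> ?s x / 2}"
  have B1: "B1 \<in> sets F" unfolding B1_def by measurable
  define B2 where "B2 = space F - B1"
  have B2: "B2 \<in> sets F" unfolding B2_def using B1 by auto
  have [simp]: "B1 \<in> sets M" "B2 \<in> sets M" using B1 B2 sets_F by auto
  have half: "measure M (S \<inter> (C \<inter> B)) / 2 \<le> measure M (S \<inter> B) / 2" if "B \<in> sets F" "C \<in> sets F" for B C
    using S sets_F that by (auto intro!: finite_measure_mono)
  have 1: "measure M (A \<inter> B1 \<inter> B) \<le> measure M (S \<inter> B) / 2" if B: "B \<in> sets F" for B
  proof -
    have BB: "B1 \<inter> B \<in> sets F" using B1 B by auto
    have "measure M (A \<inter> (B1 \<inter> B)) \<le> (\<integral>x\<in>B1 \<inter> B. ?s x / 2 \<partial>M)"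
      unfolding measure_Int_eq_cond_prob[OF A(1) BB]
      using BB by (intro set_integral_mono set_integrable_F) (auto simp: B1_def)
    also have "\<dots> = measure M (S \<inter> (B1 \<inter> B)) / 2"
      unfolding measure_Int_eq_cond_prob[OF S(1) BB] by simp
    also have "\<dots> \<le> measure M (S \<inter> B) / 2" by (rule half[OF B B1])
    finally show ?thesis by (simp add: Int_assoc)
  qed
  have 2: "measure M ((S - A) \<inter> B2 \<inter> B) \<le> measure M (S \<inter> B) / 2" if B: "B \<in> sets F" for B
  proof -
    have BB: "B2 \<inter> B \<in> sets F" using B2 B by auto
    have eq: "(S - A) \<inter> B2 \<inter> B = S \<inter> (B2 \<inter> B) - A \<inter> (B2 \<inter> B)" by auto
    have "measure M ((S - A) \<inter> B2 \<inter> B) = measure M (S \<inter> (B2 \<inter> B)) - measure M (A \<inter> (B2 \<inter> B))"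
      unfolding eq using A(1) AS S sets_F[OF BB] by (intro finite_measure_Diff) auto
    moreover have "measure M (A \<inter> (B2 \<inter> B)) \<ge> (\<integral>x\<in>B2 \<inter> B. ?s x / 2 \<partial>M)"
      unfolding measure_Int_eq_cond_prob[OF A(1) BB]
      using BB by (intro set_integral_mono set_integrable_F) (auto simp: B1_def B2_def)
    moreover have "(\<integral>x\<in>B2 \<inter> B. ?s x / 2 \<partial>M) = measure M (S \<inter> (B2 \<inter> B)) / 2"
      unfolding measure_Int_eq_cond_prob[OF S(1) BB] by simp
    ultimately have "measure M ((S - A) \<inter> B2 \<inter> B) \<le> measure M (S \<inter> (B2 \<inter> B)) / 2" by simp
    also have "\<dots> \<le> measure M (S \<inter> B) / 2" by (rule half[OF B B2])
    finally show ?thesis .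
  qed
  show ?thesis
  proof (cases "measure M (A \<inter> B1) > 0 \<or> measure M ((S - A) \<inter> B2) > 0")
    case True
    then show ?thesis
    proof
      assume "measure M (A \<inter> B1) > 0"
      then show ?thesis using 1 A(1) AS by (intro bexI[of _ "A \<inter> B1"]) auto
    next
      assume "measure M ((S - A) \<inter> B2) > 0"
      then show ?thesis using 2 A(1) S by (intro bexI[of _ "(S - A) \<inter> B2"]) auto
    qed
  next
    case False
    have "space F = space M" using subalg by (simp add: subalgebra_def)
    then have "sym_diff A (B2 \<inter> S) = (A \<inter> B1) \<union> ((S - A) \<inter> B2)"
      using AS sets.sets_into_space[OF S(1)] unfolding B2_def by auto
    moreover have "A \<inter> B1 \<in> null_sets M" "(S - A) \<inter> B2 \<in> null_sets M"
      using False A(1) S by (auto simp: null_sets_def emeasure_eq_measure not_less measure_le_0_iff)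
    ultimately have "sym_diff A (B2 \<inter> S) \<in> null_sets M" by (simp only: null_sets.Un)
    with A_diff[OF B2] show ?thesis by contradiction
  qed
qed

lemma conditional_small_subset:
  assumes S: "S \<in> sets M" "measure M S > 0"
  shows "\<exists>A\<in>sets M. A \<subseteq> S \<and> measure M A > 0 \<and> (\<forall>B\<in>sets F. measure M (A \<inter> B) \<le> measure M (S \<inter> B) / 2 ^ n)"
proof (induction n)
  case 0
  then show ?case using S by (intro bexI[of _ S]) auto
next
  case (Suc n)
  then obtain A where A: "A \<in> sets M" "A \<subseteq> S" "measure M A > 0"
    "\<And>B. B \<in> sets F \<Longrightarrow> measure M (A \<inter> B) \<le> measure M (S \<inter> B) / 2 ^ n" by blast
  obtain A' where A': "A' \<in> sets M" "A' \<subseteq> A" "measure M A' > 0"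
    "\<And>B. B \<in> sets F \<Longrightarrow> measure M (A' \<inter> B) \<le> measure M (A \<inter> B) / 2"
    using conditional_halving[OF A(1,3)] by blast
  have "measure M (A' \<inter> B) \<le> measure M (S \<inter> B) / 2 ^ Suc n" if "B \<in> sets F" for B
  proof -
    have "measure M (A' \<inter> B) \<le> measure M (S \<inter> B) / 2 ^ n / 2"
      using order_trans[OF A'(4)[OF that] divide_right_mono[OF A(4)[OF that], of 2]] by simp
    then show ?thesis by (simp add: mult.commute)
  qed
  then show ?case using A' A by (intro bexI[of _ A']) auto
qed

text \<open>Exhaustion: each step comes within \<open>1 / Suc n\<close> of the largest measure
  attainable above the current set, and continuity from below keeps the union dominated.\<close>

lemma exists_maximal_dominated_subset:
  fixes h :: "'a \<Rightarrow> real"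
  assumes h: "\<And>x. h x \<ge> 0" and S: "S \<in> sets M"
  defines "\<FF> \<equiv> {A \<in> sets M. A \<subseteq> S \<and> (\<forall>B\<in>sets F. measure M (A \<inter> B) \<le> (\<integral>x\<in>B. h x \<partial>M))}"
  shows "\<exists>A\<in>\<FF>. \<forall>A'\<in>\<FF>. A \<subseteq> A' \<longrightarrow> measure M A' \<le> measure M A"
proof -
  have "{} \<in> \<FF>" unfolding \<FF>_def using h by (auto simp: set_lebesgue_integral_def)
  define m where "m A = (SUP A'\<in>{A'\<in>\<FF>. A \<subseteq> A'}. measure M A')" for A
  have bdd: "bdd_above (measure M ` {A'\<in>\<FF>. A \<subseteq> A'})" for A
    by (intro bdd_aboveI2[where M="measure M (space M)"] bounded_measure)
  have "\<exists>A. \<forall>n. A n \<in> \<FF> \<and> (A n \<subseteq> A (Suc n) \<and> measure M (A (Suc n)) > m (A n) - 1 / Suc n)"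
  proof (rule dependent_nat_choice)
    fix A and n :: nat assume A: "A \<in> \<FF>"
    have "m A - 1 / Suc n < m A" by simp
    then have "\<exists>A'\<in>{A'\<in>\<FF>. A \<subseteq> A'}. m A - 1 / Suc n < measure M A'"
      unfolding m_def using A by (subst (asm) less_cSUP_iff[OF _ bdd]) auto
    then show "\<exists>A'. A' \<in> \<FF> \<and> A \<subseteq> A' \<and> m A - 1 / Suc n < measure M A'" by blast
  qed (use \<open>{} \<in> \<FF>\<close> in auto)
  then obtain A where A: "\<And>n. A n \<in> \<FF>" "\<And>n. A n \<subseteq> A (Suc n)" "\<And>n. measure M (A (Suc n)) > m (A n) - 1 / Suc n"
    by blast
  have A_sets [measurable]: "A n \<in> sets M" for n using A(1) by (auto simp: \<FF>_def)
  have "(\<Union>n. A n) \<in> \<FF>"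
    unfolding \<FF>_def
  proof (intro CollectI conjI ballI)
    show "(\<Union>n. A n) \<subseteq> S" using A(1) by (auto simp: \<FF>_def)
    fix B assume B: "B \<in> sets F"
    have "(\<lambda>n. measure M (A n \<inter> B)) \<longlonglongrightarrow> measure M (\<Union>n. A n \<inter> B)"
      using A(2) sets_F[OF B] by (intro finite_Lim_measure_incseq incseq_SucI) auto
    moreover have "measure M (A n \<inter> B) \<le> (\<integral>x\<in>B. h x \<partial>M)" for n
      using A(1)[of n] B unfolding \<FF>_def by blast
    ultimately have "measure M (\<Union>n. A n \<inter> B) \<le> (\<integral>x\<in>B. h x \<partial>M)"
      by (intro LIMSEQ_le_const2) auto
    then show "measure M ((\<Union>n. A n) \<inter> B) \<le> (\<integral>x\<in>B. h x \<partial>M)" by simp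
  qed auto
  moreover have "measure M A' \<le> measure M (\<Union>n. A n)" if A': "A' \<in> \<FF>" "(\<Union>n. A n) \<subseteq> A'" for A'
  proof -
    have "measure M A' \<le> measure M (\<Union>n. A n) + 1 / Suc n" for n
    proof -
      have "measure M A' \<le> m (A n)" unfolding m_def using A' by (intro cSUP_upper bdd) auto
      also have "\<dots> \<le> measure M (A (Suc n)) + 1 / Suc n" using A(3)[of n] by simp
      also have "measure M (A (Suc n)) \<le> measure M (\<Union>n. A n)" by (intro finite_measure_mono) auto
      finally show ?thesis by simp
    qed
    moreover have "(\<lambda>n. measure M (\<Union>n. A n) + 1 / Suc n) \<longlonglongrightarrow> measure M (\<Union>n. A n) + 0"
      by (intro tendsto_add tendsto_const LIMSEQ_inverse_real_of_nat[unfolded inverse_eq_divide])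
    ultimately show ?thesis by (intro LIMSEQ_le_const[of _ "measure M (\<Union>n. A n)"]) auto
  qed
  ultimately show ?thesis by blast
qed

text \<open>A maximal set dominated by \<open>h\<close> already attains it. If its conditional
  probability fell short by more than \<open>1 / 2 ^ n\<close> on a set of positive measure,
  \<open>le\<close> would leave room in \<open>S - A\<close> there, and a piece of conditional share
  at most \<open>1 / 2 ^ n\<close> could be added.\<close>

lemma conditional_splitting:
  fixes h :: "'a \<Rightarrow> real"
  assumes h: "h \<in> borel_measurable F" "\<And>x. h x \<ge> 0" "integrable M h"
    and S: "S \<in> sets M"
    and le: "\<And>B. B \<in> sets F \<Longrightarrow> (\<integral>x\<in>B. h x \<partial>M) \<le> measure M (S \<inter> B)"
  shows "\<exists>A\<in>sets M. A \<subseteq> S \<and> (\<forall>B\<in>sets F. measure M (A \<inter> B) = (\<integral>x\<in>B. h x \<partial>M))"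
proof -
  note [measurable] = h(1)
  note [simp] = h(3)
  define \<FF> where "\<FF> = {A \<in> sets M. A \<subseteq> S \<and> (\<forall>B\<in>sets F. measure M (A \<inter> B) \<le> (\<integral>x\<in>B. h x \<partial>M))}"
  from exists_maximal_dominated_subset[of h S, OF h(2) S, folded \<FF>_def]
  obtain A where A: "A \<in> \<FF>" and max0: "\<forall>A'\<in>\<FF>. A \<subseteq> A' \<longrightarrow> measure M A' \<le> measure M A"
    by (rule bexE)
  note max = bspec[OF max0, THEN mp]
  have AM: "A \<in> sets M" "A \<subseteq> S" and A_le: "\<And>B. B \<in> sets F \<Longrightarrow> measure M (A \<inter> B) \<le> (\<integral>x\<in>B. h x \<partial>M)"
    using A by (auto simp: \<FF>_def)
  let ?a = "real_cond_exp M F (indicator A)"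
  have int [simp]: "integrable M ?a" by (rule integrable_cond_prob[OF AM(1)])
  define B0 where "B0 n = {x \<in> space F. h x - ?a x > 1 / 2 ^ n}" for n :: nat
  have B0: "B0 n \<in> sets F" for n unfolding B0_def by measurable
  have spF: "space F = space M" using subalg by (simp add: subalgebra_def)
  have null: "measure M (B0 n) = 0" for n
  proof (rule ccontr)
    assume "measure M (B0 n) \<noteq> 0"
    then have pos: "measure M (B0 n) > 0" by (simp add: zero_less_measure_iff)
    define S' where "S' = (S - A) \<inter> B0 n"
    have S': "S' \<in> sets M" unfolding S'_def using S AM sets_F[OF B0] by auto
    have eq: "S' = S \<inter> B0 n - A \<inter> B0 n" unfolding S'_def by auto
    have "measure M S' = measure M (S \<inter> B0 n) - measure M (A \<inter> B0 n)"
      unfolding eq using S AM sets_F[OF B0] by (intro finite_measure_Diff) auto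
    also have "\<dots> \<ge> (\<integral>x\<in>B0 n. h x \<partial>M) - (\<integral>x\<in>B0 n. ?a x \<partial>M)"
      using le[OF B0] measure_Int_eq_cond_prob[OF AM(1) B0] by simp
    also have "(\<integral>x\<in>B0 n. h x \<partial>M) - (\<integral>x\<in>B0 n. ?a x \<partial>M) = (\<integral>x\<in>B0 n. h x - ?a x \<partial>M)"
      by (intro set_integral_diff(2)[symmetric] set_integrable_F B0) auto
    also have "\<dots> \<ge> (\<integral>x\<in>B0 n. 1 / 2 ^ n \<partial>M)"
      by (intro set_integral_mono set_integrable_F B0) (auto simp: B0_def)
    also have "(\<integral>x\<in>B0 n. 1 / 2 ^ n \<partial>M) = measure M (B0 n) / 2 ^ n"
      using sets_F[OF B0] by (simp add: set_lebesgue_integral_def)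
    finally have "measure M S' > 0" using pos by (smt (verit) divide_pos_pos zero_less_power)
    from conditional_small_subset[OF S' this, of n] obtain A' where
      A': "A' \<in> sets M" "A' \<subseteq> S'" "measure M A' > 0"
        "\<And>B. B \<in> sets F \<Longrightarrow> measure M (A' \<inter> B) \<le> measure M (S' \<inter> B) / 2 ^ n" by blast
    have disj: "A \<inter> A' = {}" using A'(2) S'_def by auto
    have "A \<union> A' \<in> \<FF>"
      unfolding \<FF>_def
    proof (intro CollectI conjI ballI)
      show "A \<union> A' \<subseteq> S" using AM A'(2) S'_def by auto
      fix B assume B: "B \<in> sets F"
      \<comment> \<open>Off \<open>B0 n\<close> nothing is added and the old domination suffices; on
        \<open>B0 n\<close> the gap between \<open>h\<close> and \<open>?a\<close> pays for
        \<open>A'\<close>.\<close>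
      let ?C = "B \<inter> B0 n" and ?D = "B - B0 n"
      have C: "?C \<in> sets F" and D: "?D \<in> sets F" using B B0 by auto
      have "(A \<union> A') \<inter> B = A \<inter> ?C \<union> A \<inter> ?D \<union> A' \<inter> B" by auto
      also have "measure M \<dots> = measure M (A \<inter> ?C) + measure M (A \<inter> ?D) + measure M (A' \<inter> B)"
        using AM A' sets_F B B0 disj by (subst finite_measure_Union; auto)+
      also have "measure M (A' \<inter> B) \<le> measure M ?C / 2 ^ n"
      proof (rule order_trans[OF A'(4)[OF B]])
        show "measure M (S' \<inter> B) / 2 ^ n \<le> measure M ?C / 2 ^ n"
          using S'_def sets_F[OF C] by (intro divide_right_mono finite_measure_mono) auto
      qed
      also have "measure M ?C / 2 ^ n = (\<integral>x\<in>?C. 1 / 2 ^ n \<partial>M)"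
        using sets_F[OF C] by (simp add: set_lebesgue_integral_def)
      also have "measure M (A \<inter> ?C) = (\<integral>x\<in>?C. ?a x \<partial>M)" by (rule measure_Int_eq_cond_prob[OF AM(1) C])
      also have "measure M (A \<inter> ?D) \<le> (\<integral>x\<in>?D. h x \<partial>M)" by (rule A_le[OF D])
      also have "(\<integral>x\<in>?C. ?a x \<partial>M) + (\<integral>x\<in>?D. h x \<partial>M) + (\<integral>x\<in>?C. 1 / 2 ^ n \<partial>M) =
          (\<integral>x\<in>?C. ?a x + 1 / 2 ^ n \<partial>M) + (\<integral>x\<in>?D. h x \<partial>M)"
        using C by (subst set_integral_add(2)) (auto intro!: set_integrable_F)
      also have "(\<integral>x\<in>?C. ?a x + 1 / 2 ^ n \<partial>M) \<le> (\<integral>x\<in>?C. h x \<partial>M)"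
        using C by (intro set_integral_mono set_integrable_F) (auto simp: B0_def)
      also have "(\<integral>x\<in>?C. h x \<partial>M) + (\<integral>x\<in>?D. h x \<partial>M) = (\<integral>x\<in>?C \<union> ?D. h x \<partial>M)"
        using C D by (intro set_integral_Un[symmetric] set_integrable_F) auto
      also have "?C \<union> ?D = B" by auto
      finally show "measure M ((A \<union> A') \<inter> B) \<le> (\<integral>x\<in>B. h x \<partial>M)" by simp
    qed (use AM A' in auto)
    then have "measure M (A \<union> A') \<le> measure M A" by (rule max) auto
    moreover have "measure M (A \<union> A') = measure M A + measure M A'"
      using AM A' disj by (intro finite_measure_Union) auto
    ultimately show False using A'(3) by simp
  qed
  have "AE x in M. \<forall>n. x \<notin> B0 n"
    unfolding AE_all_countable using null sets_F[OF B0]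
    by (intro allI AE_not_in) (auto simp: null_sets_def emeasure_eq_measure)
  then have ae: "AE x in M. h x \<le> ?a x"
    using AE_space
  proof eventually_elim
    case (elim x)
    then have "h x - ?a x \<le> (1 / 2) ^ n" for n unfolding B0_def spF by (auto simp: not_less power_one_over)
    moreover have "(\<lambda>n. (1 / 2) ^ n :: real) \<longlonglongrightarrow> 0" by (rule LIMSEQ_power_zero) simp
    ultimately have "h x - ?a x \<le> 0" by (intro LIMSEQ_le_const) auto
    then show ?case by simp
  qed
  have "measure M (A \<inter> B) = (\<integral>x\<in>B. h x \<partial>M)" if B: "B \<in> sets F" for B
  proof (rule antisym[OF A_le[OF B]])
    show "(\<integral>x\<in>B. h x \<partial>M) \<le> measure M (A \<inter> B)"
      unfolding measure_Int_eq_cond_prob[OF AM(1) B]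
      using ae B by (intro set_integral_mono_AE set_integrable_F) auto
  qed
  then show ?thesis using AM by blast
qed

end
end

section \<open>Maps into the Cantor space with a prescribed conditional law\<close>

lemma sets_sigma_pair_mono:
  assumes "\<D> \<subseteq> \<D>'" "\<D>' \<subseteq> Pow \<Omega>"
  shows "sets (sigma \<Omega> \<D> \<Otimes>\<^sub>M N) \<subseteq> sets (sigma \<Omega> \<D>' \<Otimes>\<^sub>M N)"
proof -
  have "sigma_sets \<Omega> \<D> \<subseteq> sigma_sets \<Omega> \<D>'" using assms(1) by (rule sigma_sets_mono')
  moreover have "\<D> \<subseteq> Pow \<Omega>" using assms by auto
  ultimately show ?thesis unfolding sets_pair_measure
    using assms(2) by (simp, intro sigma_sets_mono' Collect_mono) blast
qed

text \<open>The sets that need only countably many members of \<open>sets M\<close> contain the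
  rectangles and are closed under complements and countable unions. Only the first factor is thinned
  out; \<open>N\<close> stays whole.\<close>

lemma sets_pair_countably_generated:
  assumes "A \<in> sets (M \<Otimes>\<^sub>M N)"
  shows "\<exists>\<D>. countable \<D> \<and> \<D> \<subseteq> sets M \<and> A \<in> sets (sigma (space M) \<D> \<Otimes>\<^sub>M N)"
proof -
  have Pow: "\<D> \<subseteq> Pow (space M)" if "\<D> \<subseteq> sets M" for \<D>
    using that sets.sets_into_space by blast
  have "A \<in> sigma_sets (space M \<times> space N) {a \<times> b |a b. a \<in> sets M \<and> b \<in> sets N}"
    using assms by (simp add: sets_pair_measure)
  then show ?thesis
  proof (induction rule: sigma_sets.induct)
    case (Basic A)
    then obtain a b where A: "A = a \<times> b" "a \<in> sets M" "b \<in> sets N" by blast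
    have "a \<in> sets (sigma (space M) {a})" using Pow[of "{a}"] A by auto
    then have "A \<in> sets (sigma (space M) {a} \<Otimes>\<^sub>M N)" unfolding A(1) by (intro pair_measureI A(3))
    then show ?case using A by (intro exI[of _ "{a}"]) auto
  next
    case Empty
    show ?case by (intro exI[of _ "{}"]) auto
  next
    case (Compl A)
    then obtain \<D> where \<D>: "countable \<D>" "\<D> \<subseteq> sets M" "A \<in> sets (sigma (space M) \<D> \<Otimes>\<^sub>M N)" by blast
    then have "space (sigma (space M) \<D> \<Otimes>\<^sub>M N) - A \<in> sets (sigma (space M) \<D> \<Otimes>\<^sub>M N)" by (intro sets.compl_sets)
    then show ?case using \<D> Pow[OF \<D>(2)] by (intro exI[of _ \<D>]) (simp add: space_pair_measure)
  next
    case (Union A)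
    from choice[OF allI[OF Union.IH]] obtain \<D> where
      *: "\<forall>i. countable (\<D> i) \<and> \<D> i \<subseteq> sets M \<and> A i \<in> sets (sigma (space M) (\<D> i) \<Otimes>\<^sub>M N)" by (rule exE)
    have \<D>: "countable (\<D> i)" "\<D> i \<subseteq> sets M" "A i \<in> sets (sigma (space M) (\<D> i) \<Otimes>\<^sub>M N)" for i
      using spec[OF *, of i] by simp_all
    have sub: "(\<Union>i. \<D> i) \<subseteq> sets M" using \<D>(2) by blast
    have "A i \<in> sets (sigma (space M) (\<Union>i. \<D> i) \<Otimes>\<^sub>M N)" for i
      using sets_sigma_pair_mono[of "\<D> i" "\<Union>i. \<D> i" "space M" N] Pow[OF sub] \<D>(3)[of i] by blast
    then have "(\<Union>i. A i) \<in> sets (sigma (space M) (\<Union>i. \<D> i) \<Otimes>\<^sub>M N)" by blast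
    then show ?case using sub \<D>(1) by (intro exI[of _ "\<Union>i. \<D> i"]) auto
  qed
qed

text \<open>A countable base of the target reduces the function to countably many preimages.\<close>

lemma measurable_pair_countably_generated:
  fixes h :: "'a \<times> 'b \<Rightarrow> 'c::second_countable_topology"
  assumes "h \<in> borel_measurable (M \<Otimes>\<^sub>M N)"
  shows "\<exists>\<D>. countable \<D> \<and> \<D> \<subseteq> sets M \<and> h \<in> borel_measurable (sigma (space M) \<D> \<Otimes>\<^sub>M N)"
proof -
  obtain B :: "'c set set" where B: "countable B" "topological_basis B" using ex_countable_basis by blast
  have "h -` b \<inter> space (M \<Otimes>\<^sub>M N) \<in> sets (M \<Otimes>\<^sub>M N)" if "b \<in> B" for b
    using measurable_sets[OF assms borel_open[OF topological_basis_open[OF B(2) that]]] .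
  then have "\<forall>b\<in>B. \<exists>\<D>. countable \<D> \<and> \<D> \<subseteq> sets M \<and>
      h -` b \<inter> space (M \<Otimes>\<^sub>M N) \<in> sets (sigma (space M) \<D> \<Otimes>\<^sub>M N)"
    by (intro ballI sets_pair_countably_generated)
  from bchoice[OF this] obtain \<D> where *: "\<forall>b\<in>B. countable (\<D> b) \<and> \<D> b \<subseteq> sets M \<and>
    h -` b \<inter> space (M \<Otimes>\<^sub>M N) \<in> sets (sigma (space M) (\<D> b) \<Otimes>\<^sub>M N)" by (rule exE)
  have \<D>: "countable (\<D> b)" "\<D> b \<subseteq> sets M"
    "h -` b \<inter> space (M \<Otimes>\<^sub>M N) \<in> sets (sigma (space M) (\<D> b) \<Otimes>\<^sub>M N)" if "b \<in> B" for b
    using bspec[OF * that] by simp_all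
  let ?D = "\<Union>b\<in>B. \<D> b"
  have sub: "?D \<subseteq> sets M" using \<D>(2) by blast
  then have Pow: "?D \<subseteq> Pow (space M)" using sets.sets_into_space by blast
  have "h \<in> measurable (sigma (space M) ?D \<Otimes>\<^sub>M N) (sigma UNIV B)"
  proof (rule measurable_measure_of)
    fix b assume b: "b \<in> B"
    have "h -` b \<inter> space (M \<Otimes>\<^sub>M N) \<in> sets (sigma (space M) ?D \<Otimes>\<^sub>M N)"
      using sets_sigma_pair_mono[of "\<D> b" ?D "space M" N] Pow \<D>(3)[OF b] b by blast
    then show "h -` b \<inter> space (sigma (space M) ?D \<Otimes>\<^sub>M N) \<in> sets (sigma (space M) ?D \<Otimes>\<^sub>M N)"
      using Pow by (simp add: space_pair_measure)
  qed auto
  then have "h \<in> borel_measurable (sigma (space M) ?D \<Otimes>\<^sub>M N)"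
    by (simp only: borel_eq_countable_basis[OF B])
  then show ?thesis using sub \<D>(1) B(1) by (intro exI[of _ ?D]) auto
qed

lemma measurable_family_countably_generated:
  fixes H :: "('a \<times> 'b \<Rightarrow> 'c::second_countable_topology) set"
  assumes "countable H" "\<And>h. h \<in> H \<Longrightarrow> h \<in> borel_measurable (M \<Otimes>\<^sub>M N)"
  shows "\<exists>\<D>. countable \<D> \<and> \<D> \<subseteq> sets M \<and> (\<forall>h\<in>H. h \<in> borel_measurable (sigma (space M) \<D> \<Otimes>\<^sub>M N))"
proof -
  have "\<forall>h\<in>H. \<exists>\<D>. countable \<D> \<and> \<D> \<subseteq> sets M \<and> h \<in> borel_measurable (sigma (space M) \<D> \<Otimes>\<^sub>M N)"
    by (intro ballI measurable_pair_countably_generated assms(2))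
  from bchoice[OF this] obtain \<D> where *: "\<forall>h\<in>H. countable (\<D> h) \<and> \<D> h \<subseteq> sets M \<and>
    h \<in> borel_measurable (sigma (space M) (\<D> h) \<Otimes>\<^sub>M N)" by (rule exE)
  have \<D>: "countable (\<D> h)" "\<D> h \<subseteq> sets M"
    "h \<in> borel_measurable (sigma (space M) (\<D> h) \<Otimes>\<^sub>M N)" if "h \<in> H" for h
    using bspec[OF * that] by simp_all
  let ?D = "\<Union>h\<in>H. \<D> h"
  have sub: "?D \<subseteq> sets M" using \<D>(2) by blast
  then have Pow: "?D \<subseteq> Pow (space M)" using sets.sets_into_space by blast
  show ?thesis
  proof (intro exI[of _ ?D] conjI sub ballI)
    show "countable ?D" using assms(1) \<D>(1) by auto
    fix h assume h: "h \<in> H"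
    have "\<D> h \<subseteq> Pow (space M)" using Pow h by blast
    then have "space (sigma (space M) (\<D> h) \<Otimes>\<^sub>M N) = space (sigma (space M) ?D \<Otimes>\<^sub>M N)"
      using Pow by (simp add: space_pair_measure)
    moreover have "sets (sigma (space M) (\<D> h) \<Otimes>\<^sub>M N) \<subseteq> sets (sigma (space M) ?D \<Otimes>\<^sub>M N)"
      using h Pow by (intro sets_sigma_pair_mono) auto
    ultimately show "h \<in> borel_measurable (sigma (space M) ?D \<Otimes>\<^sub>M N)"
      using \<D>(3)[OF h] by (auto simp: measurable_def)
  qed
qed

text \<open>The most recent coordinate is at the head of the list.\<close>

primrec cyl :: "bool list \<Rightarrow> (nat \<Rightarrow> bool) set" where
  "cyl [] = UNIV"
| "cyl (b # s) = {q \<in> cyl s. q (length s) = b}"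

text \<open>The empty set makes the generator stable under intersection, two cylinders being nested
  or disjoint; measures can then be compared on cylinders alone.\<close>

definition cantor :: "(nat \<Rightarrow> bool) measure" where
  "cantor = sigma UNIV (insert {} (range cyl))"

lemma space_cantor [simp]: "space cantor = UNIV"
  by (simp add: cantor_def)

lemma sets_cantor: "sets cantor = sigma_sets UNIV (insert {} (range cyl))"
  by (simp add: cantor_def)

lemma cyl_in_cantor [measurable]: "cyl s \<in> sets cantor"
  by (auto simp: sets_cantor)

lemma cyl_eq: "cyl s = {q. \<forall>i<length s. q i = rev s ! i}"
  by (induction s) (auto simp: nth_append less_Suc_eq)

lemma cyl_subset_or_disjoint:
  assumes "length s \<le> length t"
  shows "cyl t \<subseteq> cyl s \<or> cyl s \<inter> cyl t = {}"
proof (cases "cyl s \<inter> cyl t = {}")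
  case False
  then obtain q where "q \<in> cyl s" "q \<in> cyl t" by blast
  then have *: "\<forall>i<length s. q i = rev s ! i" "\<forall>i<length t. q i = rev t ! i" unfolding cyl_eq by auto
  have "cyl t \<subseteq> cyl s" unfolding cyl_eq
  proof (intro subsetI CollectI allI impI)
    fix r i assume "r \<in> {q. \<forall>i<length t. q i = rev t ! i}" and i: "i < length s"
    then have "r i = q i" using *(2) assms by simp
    then show "r i = rev s ! i" using *(1) i by simp
  qed
  then show ?thesis ..
qed simp

lemma Int_stable_cyl: "Int_stable (insert {} (range cyl))"
proof (rule Int_stableI)
  have *: "cyl s \<inter> cyl t \<in> insert {} (range cyl)" for s t
  proof (cases "length s \<le> length t")
    case True
    from cyl_subset_or_disjoint[OF this] show ?thesis by (auto simp: Int_absorb1)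
  next
    case False
    then have "length t \<le> length s" by simp
    from cyl_subset_or_disjoint[OF this] show ?thesis by (auto simp: Int_absorb2 Int_commute)
  qed
  fix a b assume "a \<in> insert {} (range cyl)" "b \<in> insert {} (range cyl)"
  then show "a \<inter> b \<in> insert {} (range cyl)" using * by auto
qed

text \<open>A prefix of \<open>q\<close> of length \<open>Suc k\<close> fixes the digit
  \<open>k\<close>, so one implication is enough. Equality of codes thus becomes countably many
  measurable conditions.\<close>

lemma cyl_separate: "(\<forall>s. q \<in> cyl s \<longrightarrow> q' \<in> cyl s) \<longleftrightarrow> q = q'"
proof
  assume *: "\<forall>s. q \<in> cyl s \<longrightarrow> q' \<in> cyl s"
  show "q = q'"
  proof
    fix k
    let ?s = "rev (map q [0..<Suc k])"
    have "q \<in> cyl ?s" unfolding cyl_eq by (simp del: upt_Suc)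
    then have "q' \<in> cyl ?s" using * by blast
    then have "q' k = map q [0..<Suc k] ! k" unfolding cyl_eq by (simp del: upt_Suc)
    then show "q k = q' k" by (simp del: upt_Suc)
  qed
qed simp

lemma measurable_cantorI:
  assumes "\<And>s. {t \<in> space M. f t \<in> cyl s} \<in> sets M"
  shows "f \<in> M \<rightarrow>\<^sub>M cantor"
  unfolding cantor_def
proof (rule measurable_measure_of)
  fix y assume "y \<in> insert {} (range cyl)"
  then consider "y = {}" | s where "y = cyl s" by blast
  then show "f -` y \<inter> space M \<in> sets M"
  proof cases
    case (2 s)
    then have "f -` y \<inter> space M = {t \<in> space M. f t \<in> cyl s}" by auto
    then show ?thesis using assms by simp
  qed simp
qed auto

section \<open>Maps with a prescribed conditional law over a subalgebra\<close>

context finite_measure_subalgebra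
begin

lemma subalgebra_measurable: "f \<in> F \<rightarrow>\<^sub>M N \<Longrightarrow> f \<in> M \<rightarrow>\<^sub>M N"
  by (rule measurable_from_subalg[OF subalg])

text \<open>The node \<open>A s\<close> is to have conditional probability
  \<open>measure (K t) (cyl s)\<close> given \<open>F\<close>. Its child \<open>True\<close> is cut
  out by \<open>conditional_splitting\<close>, the child \<open>False\<close> is the remainder, and
  \<open>f t\<close> is the branch of nodes containing \<open>t\<close>.\<close>

lemma exists_conditional_law:
  assumes diffuse: conditionally_diffuse and K: "K \<in> F \<rightarrow>\<^sub>M prob_algebra cantor"
  obtains f where "f \<in> M \<rightarrow>\<^sub>M cantor"
    "\<And>B s. B \<in> sets F \<Longrightarrow> measure M ({t \<in> space M. f t \<in> cyl s} \<inter> B) = (\<integral>t\<in>B. measure (K t) (cyl s) \<partial>M)"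
proof -
  have spF: "space F = space M" using subalg by (simp add: subalgebra_def)
  let ?k = "\<lambda>s t. measure (K t) (cyl s)"
  have k [measurable]: "?k s \<in> borel_measurable F" for s
    using K by measurable
  have prob: "prob_space (K t)" and sets_K: "sets (K t) = sets cantor" if "t \<in> space M" for t
    using measurable_space[OF K] that by (auto simp: spF space_prob_algebra)
  have kint: "integrable M (?k s)" for s
    using prob subalgebra_measurable[OF k]
    by (intro integrable_const_bound[where B=1] AE_I2) (auto simp: prob_space.prob_le_1)
  have k_mono: "?k (b # s) t \<le> ?k s t" if "t \<in> space M" for b s t
  proof -
    interpret P: prob_space "K t" by (rule prob[OF that])
    have "cyl s \<in> sets (K t)" unfolding sets_K[OF that] by (rule cyl_in_cantor)
    then show ?thesis by (intro P.finite_measure_mono) auto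
  qed
  have k_diff: "?k (False # s) t = ?k s t - ?k (True # s) t" if "t \<in> space M" for s t
  proof -
    interpret P: prob_space "K t" by (rule prob[OF that])
    have sets: "cyl u \<in> sets (K t)" for u unfolding sets_K[OF that] by (rule cyl_in_cantor)
    have "cyl (False # s) = cyl s - cyl (True # s)" by auto
    then have "?k (False # s) t = measure (K t) (cyl s - cyl (True # s))" by (rule arg_cong)
    also have "\<dots> = ?k s t - ?k (True # s) t" by (intro P.finite_measure_Diff sets) auto
    finally show ?thesis .
  qed
  have split: "\<exists>A\<in>sets M. A \<subseteq> S \<and> (\<forall>B\<in>sets F. measure M (A \<inter> B) = (\<integral>t\<in>B. ?k (True # s) t \<partial>M))"
    if S: "S \<in> sets M" "\<And>B. B \<in> sets F \<Longrightarrow> measure M (S \<inter> B) = (\<integral>t\<in>B. ?k s t \<partial>M)" for S s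
  proof (rule conditional_splitting[OF diffuse k _ kint S(1)])
    fix B assume B: "B \<in> sets F"
    show "(\<integral>t\<in>B. ?k (True # s) t \<partial>M) \<le> measure M (S \<inter> B)"
      unfolding S(2)[OF B] using sets.sets_into_space[OF B] spF
      by (intro set_integral_mono set_integrable_F kint B k_mono) auto
  qed simp
  \<comment> \<open>The invariant of a node stands as a premise, so that a single choice function
    \<open>T\<close> is available before the nodes are defined.\<close>
  have "\<forall>S s. \<exists>A. S \<in> sets M \<and> (\<forall>B\<in>sets F. measure M (S \<inter> B) = (\<integral>t\<in>B. ?k s t \<partial>M)) \<longrightarrow>
      A \<in> sets M \<and> A \<subseteq> S \<and> (\<forall>B\<in>sets F. measure M (A \<inter> B) = (\<integral>t\<in>B. ?k (True # s) t \<partial>M))"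
  proof (intro allI)
    fix S s
    show "\<exists>A. S \<in> sets M \<and> (\<forall>B\<in>sets F. measure M (S \<inter> B) = (\<integral>t\<in>B. ?k s t \<partial>M)) \<longrightarrow>
      A \<in> sets M \<and> A \<subseteq> S \<and> (\<forall>B\<in>sets F. measure M (A \<inter> B) = (\<integral>t\<in>B. ?k (True # s) t \<partial>M))" (is "\<exists>A. ?P \<longrightarrow> ?Q A")
    proof (cases ?P)
      case True
      with split[of S s] have "\<exists>A\<in>sets M. A \<subseteq> S \<and> (\<forall>B\<in>sets F. measure M (A \<inter> B) = (\<integral>t\<in>B. ?k (True # s) t \<partial>M))"
        by simp
      then obtain A where "?Q A" by (rule bexE) simp
      then show ?thesis by (intro exI[of _ A]) simp
    next
      case False
      show ?thesis by (rule exI[of _ S], rule impI) (rule notE[OF False])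
    qed
  qed
  then have "\<exists>T. \<forall>S s. S \<in> sets M \<and> (\<forall>B\<in>sets F. measure M (S \<inter> B) = (\<integral>t\<in>B. ?k s t \<partial>M)) \<longrightarrow>
      T S s \<in> sets M \<and> T S s \<subseteq> S \<and> (\<forall>B\<in>sets F. measure M (T S s \<inter> B) = (\<integral>t\<in>B. ?k (True # s) t \<partial>M))"
    unfolding choice_iff .
  then obtain T where "\<forall>S s. S \<in> sets M \<and> (\<forall>B\<in>sets F. measure M (S \<inter> B) = (\<integral>t\<in>B. ?k s t \<partial>M)) \<longrightarrow>
      T S s \<in> sets M \<and> T S s \<subseteq> S \<and> (\<forall>B\<in>sets F. measure M (T S s \<inter> B) = (\<integral>t\<in>B. ?k (True # s) t \<partial>M))"
    by (rule exE)
  note T = this[THEN spec, THEN spec, THEN mp]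
  define A where "A = rec_list (space M) (\<lambda>b s S. if b then T S s else S - T S s)"
  have A0: "A [] = space M" and AT: "A (True # s) = T (A s) s" and AF: "A (False # s) = A s - T (A s) s" for s
    by (simp_all add: A_def)
  have A: "A s \<in> sets M \<and> (\<forall>B\<in>sets F. measure M (A s \<inter> B) = (\<integral>t\<in>B. ?k s t \<partial>M))" for s
  proof (induction s)
    case Nil
    have "measure M (space M \<inter> B) = (\<integral>t\<in>B. ?k [] t \<partial>M)" if B: "B \<in> sets F" for B
    proof -
      have "?k [] t = 1" if "t \<in> space M" for t
        using prob_space.prob_space[OF prob[OF that]] sets_eq_imp_space_eq[OF sets_K[OF that]] by simp
      then have "(\<integral>t\<in>B. ?k [] t \<partial>M) = (\<integral>t\<in>B. 1 \<partial>M)"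
        unfolding set_lebesgue_integral_def by (intro Bochner_Integration.integral_cong) auto
      then show ?thesis using sets_F[OF B] sets.sets_into_space[OF sets_F[OF B]]
        by (simp add: set_lebesgue_integral_def Int_absorb1)
    qed
    then show ?case by (simp add: A0)
  next
    case (Cons b s)
    have T: "T (A s) s \<in> sets M" "T (A s) s \<subseteq> A s"
      "\<And>B. B \<in> sets F \<Longrightarrow> measure M (T (A s) s \<inter> B) = (\<integral>t\<in>B. ?k (True # s) t \<partial>M)"
      using T[of "A s" s] Cons by auto
    show ?case
    proof (cases b)
      case True
      then have "b = True" by simp
      show ?thesis unfolding \<open>b = True\<close> AT using T(1,3) by blast
    next
      case False
      have "measure M ((A s - T (A s) s) \<inter> B) = (\<integral>t\<in>B. ?k (False # s) t \<partial>M)" if B: "B \<in> sets F" for B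
      proof -
        have "(A s - T (A s) s) \<inter> B = A s \<inter> B - T (A s) s \<inter> B" by auto
        also have "measure M \<dots> = measure M (A s \<inter> B) - measure M (T (A s) s \<inter> B)"
          using T Cons sets_F[OF B] by (intro finite_measure_Diff) auto
        also have "\<dots> = (\<integral>t\<in>B. ?k s t - ?k (True # s) t \<partial>M)"
          using T(3)[OF B] Cons B
          by (subst set_integral_diff(2)) (simp_all add: set_integrable_F kint del: cyl.simps)
        also have "\<dots> = (\<integral>t\<in>B. ?k (False # s) t \<partial>M)"
          unfolding set_lebesgue_integral_def
          by (intro Bochner_Integration.integral_cong) (simp_all only: k_diff)
        finally show ?thesis .
      qed
      moreover have "A s - T (A s) s \<in> sets M" using T(1) Cons by (intro sets.Diff) auto
      moreover have "b = False" using False by simp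
      ultimately show ?thesis by (simp only: AF) blast
    qed
  qed
  have A_sub: "A (b # s) \<subseteq> A s" for b s
    using T[of "A s" s] A[of s] by (cases b) (auto simp: AT AF)
  \<comment> \<open>For \<open>t\<close> in the space, \<open>q t k\<close> is the node of depth
    \<open>k\<close> containing \<open>t\<close>, latest digit first as in \<open>cyl\<close>;
    testing the child \<open>True\<close> is enough.\<close>
  define q where "q t = rec_nat [] (\<lambda>_ s. (t \<in> A (True # s)) # s)" for t
  have q0: "q t 0 = []" and qS: "q t (Suc k) = (t \<in> A (True # q t k)) # q t k" for t k
    by (simp_all add: q_def)
  define f where "f t k \<longleftrightarrow> t \<in> A (True # q t k)" for t k
  have fq: "q t (length s) = s" if "f t \<in> cyl s" for t s
    using that by (induction s) (auto simp: q0 qS f_def)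
  have f: "f t \<in> cyl s \<longleftrightarrow> t \<in> A s" if t: "t \<in> space M" for t s
  proof (induction s)
    case (Cons b s)
    show ?case
    proof (cases "f t \<in> cyl s")
      case True
      then have "f t (length s) = (t \<in> A (True # s))" by (simp add: f_def fq)
      moreover have "t \<in> A s" using True Cons by simp
      ultimately show ?thesis using True by (cases b) (auto simp: AT AF)
    next
      case False
      then show ?thesis using Cons A_sub[of b s] by auto
    qed
  qed (simp add: A0 t)
  have f_eq: "{t \<in> space M. f t \<in> cyl s} = A s" for s
    using f sets.sets_into_space A[of s] by blast
  show ?thesis
  proof (rule that)
    show "f \<in> M \<rightarrow>\<^sub>M cantor" using A by (intro measurable_cantorI) (simp add: f_eq)
  qed (use A in \<open>simp add: f_eq\<close>)
qed

text \<open>By \<open>law\<close>, the image of \<open>M\<close> under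
  \<open>t \<mapsto> (t, f t)\<close> and the product of \<open>M\<close> with \<open>K\<close>
  agree on rectangles \<open>B \<times> cyl s\<close>. These form an intersection-stable generator,
  so the two measures coincide on \<open>F \<Otimes>\<^sub>M cantor\<close>, and the two integrals
  of \<open>h\<close> are taken against them.\<close>

lemma nn_integral_conditional_law:
  fixes h :: "'a \<times> (nat \<Rightarrow> bool) \<Rightarrow> ennreal"
  assumes K: "K \<in> F \<rightarrow>\<^sub>M prob_algebra cantor" and f: "f \<in> M \<rightarrow>\<^sub>M cantor"
    and law: "\<And>B s. B \<in> sets F \<Longrightarrow>
      measure M ({t \<in> space M. f t \<in> cyl s} \<inter> B) = (\<integral>t\<in>B. measure (K t) (cyl s) \<partial>M)"
    and h: "h \<in> borel_measurable (F \<Otimes>\<^sub>M cantor)"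
  shows "(\<integral>\<^sup>+t. h (t, f t) \<partial>M) = (\<integral>\<^sup>+t. \<integral>\<^sup>+q. h (t, q) \<partial>K t \<partial>M)"
proof (cases "space M = {}")
  case True
  then show ?thesis by (simp add: nn_integral_empty)
next
  case False
  have spF: "space F = space M" using subalg by (simp add: subalgebra_def)
  let ?R = "restr_to_subalg M F"
  have sets_R: "sets ?R = sets F" by (rule sets_restr_to_subalg[OF subalg])
  have [measurable]: "f \<in> M \<rightarrow>\<^sub>M cantor" by fact
  have [measurable]: "(\<lambda>t. t) \<in> M \<rightarrow>\<^sub>M F" by (rule subalgebra_measurable) simp
  have KF: "K \<in> F \<rightarrow>\<^sub>M subprob_algebra cantor" using K by (rule measurable_prob_algebraD)
  have KR: "(\<lambda>t. distr (K t) (F \<Otimes>\<^sub>M cantor) (\<lambda>q. (t, q))) \<in> ?R \<rightarrow>\<^sub>M subprob_algebra (F \<Otimes>\<^sub>M cantor)"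
  proof -
    have "(\<lambda>t. distr (K t) (F \<Otimes>\<^sub>M cantor) (Pair t)) \<in> F \<rightarrow>\<^sub>M subprob_algebra (F \<Otimes>\<^sub>M cantor)"
      by (rule measurable_distr2[OF _ KF]) simp
    then show ?thesis using measurable_cong_sets[OF sets_R refl] by blast
  qed
  have prob: "prob_space (K t)" and sets_K [measurable_cong]: "sets (K t) = sets cantor" if "t \<in> space M" for t
    using measurable_space[OF K] that by (auto simp: spF space_prob_algebra)
  have Pair_meas: "Pair t \<in> K t \<rightarrow>\<^sub>M F \<Otimes>\<^sub>M cantor" if "t \<in> space M" for t
    using that spF measurable_cong_sets[OF sets_K[OF that] refl] by (metis measurable_Pair1')
  define \<rho> where "\<rho> = ?R \<bind> (\<lambda>t. distr (K t) (F \<Otimes>\<^sub>M cantor) (\<lambda>q. (t, q)))"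
  define \<nu> where "\<nu> = distr M (F \<Otimes>\<^sub>M cantor) (\<lambda>t. (t, f t))"
  let ?E = "{B \<times> C | B C. B \<in> sets F \<and> C \<in> insert {} (range cyl)}"
  have sets_E: "sets (F \<Otimes>\<^sub>M cantor) = sigma_sets (space M \<times> UNIV) ?E"
  proof -
    have "sets (F \<Otimes>\<^sub>M cantor) = sets (sigma (space F \<times> space cantor) ?E)"
      by (intro sets_pair_eq[where Ca="{space F}" and Cb="{UNIV}"])
         (auto simp: sets.sigma_sets_eq sets_cantor dest: sets.sets_into_space intro: range_eqI[of _ _ "[]"])
    moreover have "?E \<subseteq> Pow (space F \<times> space cantor)" using sets.sets_into_space[of _ F] by fastforce
    ultimately show ?thesis by (simp add: spF)
  qed
  have eq: "emeasure \<nu> (B \<times> C) = emeasure \<rho> (B \<times> C)" if B: "B \<in> sets F" and C: "C \<in> insert {} (range cyl)" for B C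
  proof (cases "C = {}")
    case False
    then obtain s where s: "C = cyl s" using C by blast
    note [measurable] = B
    have BC: "B \<times> cyl s \<in> sets (F \<Otimes>\<^sub>M cantor)" by measurable
    have k [measurable]: "(\<lambda>t. measure (K t) (cyl s)) \<in> borel_measurable F" using K by measurable
    have kint: "integrable M (\<lambda>t. measure (K t) (cyl s))"
      using prob subalgebra_measurable[OF k]
      by (intro integrable_const_bound[where B=1] AE_I2) (auto simp: prob_space.prob_le_1)
    have "emeasure \<nu> (B \<times> cyl s) = emeasure M ((\<lambda>t. (t, f t)) -` (B \<times> cyl s) \<inter> space M)"
      unfolding \<nu>_def using BC by (intro emeasure_distr) auto
    also have "(\<lambda>t. (t, f t)) -` (B \<times> cyl s) \<inter> space M = {t \<in> space M. f t \<in> cyl s} \<inter> B"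
      using sets.sets_into_space[OF B] spF by auto
    also have "emeasure M \<dots> = ennreal (\<integral>t\<in>B. measure (K t) (cyl s) \<partial>M)"
      unfolding emeasure_eq_measure law[OF B] ..
    also have "\<dots> = (\<integral>\<^sup>+t. ennreal (indicator B t * measure (K t) (cyl s)) \<partial>M)"
      using set_integrable_F[OF kint B] unfolding set_lebesgue_integral_def set_integrable_def
      by (subst nn_integral_eq_integral) auto
    also have "\<dots> = (\<integral>\<^sup>+t. ennreal (indicator B t * measure (K t) (cyl s)) \<partial>?R)"
      by (intro nn_integral_subalgebra2[symmetric] subalg) measurable
    also have "\<dots> = (\<integral>\<^sup>+t. emeasure (distr (K t) (F \<Otimes>\<^sub>M cantor) (\<lambda>q. (t, q))) (B \<times> cyl s) \<partial>?R)"
    proof (rule nn_integral_cong)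
      fix t assume "t \<in> space ?R"
      then have t: "t \<in> space M" by (simp add: space_restr_to_subalg)
      interpret P: prob_space "K t" by (rule prob[OF t])
      have "emeasure (distr (K t) (F \<Otimes>\<^sub>M cantor) (\<lambda>q. (t, q))) (B \<times> cyl s)
          = emeasure (K t) (Pair t -` (B \<times> cyl s) \<inter> space (K t))"
        using Pair_meas[OF t] BC by (rule emeasure_distr)
      also have "Pair t -` (B \<times> cyl s) \<inter> space (K t) = (if t \<in> B then cyl s else {})"
        using sets_eq_imp_space_eq[OF sets_K[OF t]] by auto
      finally show "ennreal (indicator B t * measure (K t) (cyl s)) =
          emeasure (distr (K t) (F \<Otimes>\<^sub>M cantor) (\<lambda>q. (t, q))) (B \<times> cyl s)"
        by (simp add: P.emeasure_eq_measure)
    qed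
    also have "\<dots> = emeasure \<rho> (B \<times> cyl s)"
      unfolding \<rho>_def using False \<open>space M \<noteq> {}\<close> BC
      by (intro emeasure_bind[OF _ KR, symmetric]) (auto simp: space_restr_to_subalg)
    finally show ?thesis unfolding s .
  qed simp
  have "\<nu> = \<rho>"
  proof (rule measure_eqI_generator_eq[of ?E "space M \<times> UNIV" _ _ "\<lambda>_. space M \<times> UNIV"])
    show "Int_stable ?E"
    proof (rule Int_stableI)
      fix a b assume "a \<in> ?E" "b \<in> ?E"
      then obtain B C B' C' where ab: "a = B \<times> C" "b = B' \<times> C'" "B \<in> sets F" "B' \<in> sets F"
        "C \<in> insert {} (range cyl)" "C' \<in> insert {} (range cyl)" by blast
      have "a \<inter> b = (B \<inter> B') \<times> (C \<inter> C')" unfolding ab by (rule Times_Int_Times)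
      moreover have "C \<inter> C' \<in> insert {} (range cyl)" using ab Int_stable_cyl by (auto simp only: Int_stable_def)
      moreover have "B \<inter> B' \<in> sets F" using ab by auto
      ultimately show "a \<inter> b \<in> ?E" by blast
    qed
    show "?E \<subseteq> Pow (space M \<times> UNIV)" using sets.sets_into_space[of _ F] unfolding spF by fastforce
    show "sets \<nu> = sigma_sets (space M \<times> UNIV) ?E" unfolding \<nu>_def by (simp add: sets_E)
    show "sets \<rho> = sigma_sets (space M \<times> UNIV) ?E" unfolding \<rho>_def sets_E[symmetric]
      using False by (intro sets_bind) (auto simp: space_restr_to_subalg)
    have "UNIV = cyl []" by simp
    then show "range (\<lambda>_. space M \<times> UNIV) \<subseteq> ?E" using sets.top[of F] unfolding spF by blast
    have "finite_measure \<nu>" unfolding \<nu>_def by (intro finite_measure_distr) measurable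
    then show "emeasure \<nu> (space M \<times> UNIV) \<noteq> \<infinity>" by (simp add: finite_measure.emeasure_finite)
  qed (use eq in auto)
  have "(\<integral>\<^sup>+t. h (t, f t) \<partial>M) = (\<integral>\<^sup>+z. h z \<partial>\<nu>)"
    unfolding \<nu>_def using h by (intro nn_integral_distr[symmetric]) measurable
  also have "\<dots> = (\<integral>\<^sup>+t. \<integral>\<^sup>+z. h z \<partial>distr (K t) (F \<Otimes>\<^sub>M cantor) (\<lambda>q. (t, q)) \<partial>?R)"
    unfolding \<open>\<nu> = \<rho>\<close> \<rho>_def by (rule nn_integral_bind[OF h KR])
  also have "\<dots> = (\<integral>\<^sup>+t. \<integral>\<^sup>+q. h (t, q) \<partial>K t \<partial>?R)"
    using h Pair_meas by (intro nn_integral_cong nn_integral_distr) (auto simp: space_restr_to_subalg)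
  also have "\<dots> = (\<integral>\<^sup>+t. \<integral>\<^sup>+q. h (t, q) \<partial>K t \<partial>M)"
    using h by (intro nn_integral_subalgebra2 subalg nn_integral_measurable_subprob_algebra2[OF _ KF]) simp
  finally show ?thesis .
qed

end

text \<open>\<open>F\<close> is generated by the countably many sets on which the integrands and the
  kernel depend; its being countably generated is what lets saturation provide
  \<open>conditionally_diffuse\<close>.\<close>

theorem saturated_purification:
  fixes H :: "('t \<times> (nat \<Rightarrow> bool) \<Rightarrow> ennreal) set"
  assumes "finite_measure M" "saturated_measure M" and K: "K \<in> M \<rightarrow>\<^sub>M prob_algebra cantor"
    and H: "countable H" "\<And>h. h \<in> H \<Longrightarrow> h \<in> borel_measurable (M \<Otimes>\<^sub>M cantor)"
  obtains f where "f \<in> M \<rightarrow>\<^sub>M cantor"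
    "\<And>h. h \<in> H \<Longrightarrow> (\<integral>\<^sup>+t. h (t, f t) \<partial>M) = (\<integral>\<^sup>+t. \<integral>\<^sup>+q. h (t, q) \<partial>K t \<partial>M)"
proof -
  \<comment> \<open>The argument \<open>q\<close> is a dummy that puts the cylinder probabilities of
    \<open>K\<close> into the same family of functions as \<open>H\<close>.\<close>
  let ?k = "\<lambda>s (t, q :: nat \<Rightarrow> bool). emeasure (K t) (cyl s)"
  have KS: "K \<in> M \<rightarrow>\<^sub>M subprob_algebra cantor" using K by (rule measurable_prob_algebraD)
  have k: "?k s \<in> borel_measurable (M \<Otimes>\<^sub>M cantor)" for s
    using KS by measurable
  have HK: "countable (H \<union> range ?k)" using H(1) by simp
  have "h \<in> borel_measurable (M \<Otimes>\<^sub>M cantor)" if "h \<in> H \<union> range ?k" for h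
    using that H(2) k by auto
  from measurable_family_countably_generated[OF HK this]
  obtain \<D> where *: "countable \<D> \<and> \<D> \<subseteq> sets M \<and>
      (\<forall>h\<in>H \<union> range ?k. h \<in> borel_measurable (sigma (space M) \<D> \<Otimes>\<^sub>M cantor))" by (rule exE)
  then have \<D>: "countable \<D>" "\<D> \<subseteq> sets M"
    "\<And>h. h \<in> H \<union> range ?k \<Longrightarrow> h \<in> borel_measurable (sigma (space M) \<D> \<Otimes>\<^sub>M cantor)" by blast+
  define F where "F = sigma (space M) \<D>"
  have Pow: "\<D> \<subseteq> Pow (space M)" using \<D>(2) sets.sets_into_space by blast
  have sF: "sets F = sigma_sets (space M) \<D>" using Pow by (simp add: F_def)
  have spF: "space F = space M" using Pow by (simp add: F_def)
  have sub: "subalgebra M F"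
    unfolding subalgebra_def using sets.sigma_sets_subset[OF \<D>(2)] by (simp add: sF spF)
  interpret finite_measure_subalgebra M F
    using assms(1) sub by (simp add: finite_measure_subalgebra_def finite_measure_subalgebra_axioms_def)
  have diffuse: conditionally_diffuse
    unfolding conditionally_diffuse_def
  proof (intro ballI impI)
    fix S assume "S \<in> sets M" "measure M S > 0"
    then have "emeasure M S > 0" by (simp add: emeasure_eq_measure)
    from saturated_not_generated[OF assms(1,2) \<D>(1,2) \<open>S \<in> sets M\<close> this]
    show "\<exists>A\<in>sets M. A \<subseteq> S \<and> (\<forall>B\<in>sets F. sym_diff A (B \<inter> S) \<notin> null_sets M)"
      unfolding sF .
  qed
  have KF: "K \<in> F \<rightarrow>\<^sub>M prob_algebra cantor"
  proof (rule measurable_prob_algebra_generated[OF sets_cantor Int_stable_cyl])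
    fix t assume "t \<in> space F"
    then show "prob_space (K t)" "sets (K t) = sets cantor"
      using measurable_space[OF K] by (auto simp: spF space_prob_algebra)
  next
    have "(\<lambda>t. emeasure (K t) (cyl s)) \<in> borel_measurable F" for s
    proof -
      have "?k s \<in> borel_measurable (F \<Otimes>\<^sub>M cantor)" unfolding F_def by (intro \<D>(3)) blast
      moreover have "(\<lambda>t. (t, \<lambda>_. False)) \<in> F \<rightarrow>\<^sub>M F \<Otimes>\<^sub>M cantor" by simp
      ultimately show ?thesis using measurable_compose[of _ F "F \<Otimes>\<^sub>M cantor" "?k s" borel] by force
    qed
    then show "(\<lambda>t. emeasure (K t) A) \<in> borel_measurable F" if "A \<in> insert {} (range cyl)" for A
      using that by auto
  qed auto
  obtain f where f: "f \<in> M \<rightarrow>\<^sub>M cantor"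
    "\<And>B s. B \<in> sets F \<Longrightarrow> measure M ({t \<in> space M. f t \<in> cyl s} \<inter> B) = (\<integral>t\<in>B. measure (K t) (cyl s) \<partial>M)"
    using exists_conditional_law[OF diffuse KF] by blast
  show ?thesis
  proof (rule that[OF f(1)])
    fix h assume "h \<in> H"
    then have "h \<in> borel_measurable (F \<Otimes>\<^sub>M cantor)" unfolding F_def by (intro \<D>(3)) blast
    then show "(\<integral>\<^sup>+t. h (t, f t) \<partial>M) = (\<integral>\<^sup>+t. \<integral>\<^sup>+q. h (t, q) \<partial>K t \<partial>M)"
      by (intro nn_integral_conditional_law[OF KF f(1)] f(2))
  qed
qed

section \<open>Coding relaxed controls in the Cantor space\<close>

text \<open>The pairs that a continuous function separates at a given threshold pull back along
  \<beta> to an open set of pairs of sequences. That space is second countable, so by Lindelof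
  countably many functions with thresholds separate every pair that can be separated.\<close>

lemma countable_separating_functions:
  fixes \<beta> :: "(nat \<Rightarrow> nat) \<Rightarrow> 'x::topological_space"
  assumes \<beta>: "continuous_on UNIV \<beta>" "surj \<beta>"
  obtains u :: "nat \<Rightarrow> 'x \<Rightarrow> real" where "\<And>k. continuous_on UNIV (u k)" "\<And>k x. u k x \<in> {0..1}"
    "\<And>x x' (v :: 'x \<Rightarrow> real). (\<And>k. 0 < u k x \<longleftrightarrow> 0 < u k x') \<Longrightarrow> continuous_on UNIV v \<Longrightarrow> v x = v x'"
proof -
  define W where "W p = {a. fst p (\<beta> (fst a)) > snd p \<and> fst p (\<beta> (snd a)) < snd p}"
    for p :: "('x \<Rightarrow> real) \<times> real"
  let ?P = "{p :: ('x \<Rightarrow> real) \<times> real. continuous_on UNIV (fst p)}"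
  have openW: "open (W p)" if "p \<in> ?P" for p
  proof -
    have "continuous_on UNIV (\<lambda>a. fst p (\<beta> (fst a)))" "continuous_on UNIV (\<lambda>a. fst p (\<beta> (snd a)))"
      using that \<beta>(1) by (auto intro!: continuous_on_compose2[of UNIV "fst p"] continuous_on_compose2[of UNIV \<beta>]
        continuous_on_fst continuous_on_snd continuous_on_id)
    then show ?thesis unfolding W_def
      by (intro open_Collect_conj open_Collect_less continuous_on_const)
  qed
  obtain \<W> where \<W>: "\<W> \<subseteq> W ` ?P" "countable \<W>" "\<Union>\<W> = \<Union>(W ` ?P)"
    using Lindelof[of "W ` ?P"] openW by blast
  obtain Q0 where Q0: "countable Q0" "Q0 \<subseteq> ?P" "\<W> = W ` Q0"
    using \<W>(1,2) by (metis countable_subset_image)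
  \<comment> \<open>The dummy entry keeps \<open>Q\<close> nonempty, so that it can be
    enumerated.\<close>
  define Q where "Q = insert (\<lambda>_. 0, 0) Q0"
  have Q: "countable Q" "Q \<subseteq> ?P" "Q \<noteq> {}" using Q0 by (auto simp: Q_def)
  define p where "p = from_nat_into Q"
  have p: "range p = Q" unfolding p_def by (rule range_from_nat_into[OF Q(3,1)])
  have pk: "continuous_on UNIV (fst (p k))" for k using Q(2) p by blast
  \<comment> \<open>Truncation turns the set where the function exceeds its threshold into the set
    \<open>0 < u k x\<close> and makes the function a bounded test function for the weak
    topology.\<close>
  define u where "u k x = max 0 (min 1 (fst (p k) x - snd (p k)))" for k x
  have sep: "\<exists>k. \<not> (0 < u k x \<longleftrightarrow> 0 < u k x')" if v: "continuous_on UNIV v" "v x' < v x" for x x' and v :: "'x \<Rightarrow> real"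
  proof -
    obtain a a' where a: "x = \<beta> a" "x' = \<beta> a'" using \<beta>(2) by (metis surjD)
    have "(a, a') \<in> W (v, (v x + v x') / 2)" using v a by (simp add: W_def)
    moreover have "(v, (v x + v x') / 2) \<in> ?P" using v by simp
    ultimately have "(a, a') \<in> \<Union>\<W>" unfolding \<W>(3) by blast
    then obtain z where z: "z \<in> Q0" "(a, a') \<in> W z" unfolding Q0(3) by blast
    then obtain k where "z = p k" using p unfolding Q_def by blast
    then have "0 < u k x" "\<not> 0 < u k x'" using z(2) a by (auto simp: W_def u_def)
    then show ?thesis by blast
  qed
  show ?thesis
  proof (rule that[of u])
    show "continuous_on UNIV (u k)" for k unfolding u_def by (intro continuous_intros pk)
    show "u k x \<in> {0..1}" for k x by (auto simp: u_def)
    fix x x' and v :: "'x \<Rightarrow> real"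
    assume *: "\<And>k. 0 < u k x \<longleftrightarrow> 0 < u k x'" and v: "continuous_on UNIV v"
    show "v x = v x'"
    proof (rule ccontr)
      assume "v x \<noteq> v x'"
      then consider "v x' < v x" | "v x < v x'" by linarith
      then show False using sep[OF v, of x' x] sep[OF v, of x x'] * by cases auto
    qed
  qed
qed

section \<open>Measurability of coded relaxed controls\<close>

lemma relaxed_controlsD:
  fixes lam :: "'t \<Rightarrow> 'x::topological_space measure"
  assumes "lam \<in> relaxed_controls M" "t \<in> space M"
  shows "sets (lam t) = sets borel" "prob_space (lam t)"
  using measurable_space[OF assms(1)[unfolded relaxed_controls_def] assms(2)]
  by (auto simp: borel_probabilities_def)

lemma relaxed_control_integral_measurable:
  fixes lam :: "'t \<Rightarrow> 'x::topological_space measure" and u :: "'x \<Rightarrow> real"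
  assumes lam: "lam \<in> relaxed_controls M" and u: "continuous_on UNIV u" "bounded (range u)"
  shows "(\<lambda>t. \<integral>x. u x \<partial>lam t) \<in> borel_measurable M"
proof (rule borel_measurableI)
  fix V :: "real set" assume V: "open V"
  let ?B = "{P \<in> borel_probabilities. (\<integral>x. u x \<partial>P) \<in> V}"
  have "openin weak_topology ?B"
    unfolding weak_topology_def using u V by (intro topology_generated_by_Basis) blast
  then have "?B \<in> sets (borel_of weak_topology)" by (auto simp: sets_borel_of)
  then have "lam -` ?B \<inter> space M \<in> sets M"
    using lam unfolding relaxed_controls_def by (rule measurable_sets[rotated])
  moreover have "lam t \<in> borel_probabilities" if "t \<in> space M" for t
    using measurable_space[OF lam[unfolded relaxed_controls_def] that] by simp
  then have "lam -` ?B \<inter> space M = (\<lambda>t. \<integral>x. u x \<partial>lam t) -` V \<inter> space M" by auto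
  ultimately show "(\<lambda>t. \<integral>x. u x \<partial>lam t) -` V \<inter> space M \<in> sets M" by simp
qed

text \<open>The bounded continuous functions \<open>min 1 (real n * u x)\<close> increase to the
  indicator of the cozero set, so its measure is a limit of test integrals.\<close>

lemma relaxed_control_cozero_measurable:
  fixes lam :: "'t \<Rightarrow> 'x::topological_space measure" and u :: "'x \<Rightarrow> real"
  assumes lam: "lam \<in> relaxed_controls M" and u: "continuous_on UNIV u" "\<And>x. u x \<in> {0..1}"
  shows "(\<lambda>t. measure (lam t) {x. 0 < u x}) \<in> borel_measurable M"
proof (rule borel_measurable_LIMSEQ_metric)
  let ?s = "\<lambda>(n::nat) x. min 1 (real n * u x)"
  have s: "continuous_on UNIV (?s n)" for n by (intro continuous_intros u)
  have "norm (?s n x) \<le> 1" for n x using u(2)[of x] by (auto simp: min_def)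
  then have "bounded (range (?s n))" for n unfolding bounded_iff by blast
  then show "(\<lambda>t. \<integral>x. ?s n x \<partial>lam t) \<in> borel_measurable M" for n
    by (rule relaxed_control_integral_measurable[OF lam s])
  fix t assume t: "t \<in> space M"
  note [measurable_cong] = relaxed_controlsD(1)[OF lam t]
  interpret P: prob_space "lam t" by (rule relaxed_controlsD(2)[OF lam t])
  have [measurable]: "u \<in> borel_measurable borel" by (rule borel_measurable_continuous_onI[OF u(1)])
  have "(\<lambda>n. \<integral>x. ?s n x \<partial>lam t) \<longlonglongrightarrow> (\<integral>x. indicator {x. 0 < u x} x \<partial>lam t)"
  proof (rule integral_dominated_convergence[where w="\<lambda>_. 1"])
    show "AE x in lam t. (\<lambda>n. ?s n x) \<longlonglongrightarrow> indicator {x. 0 < u x} x"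
    proof (intro AE_I2)
      fix x
      show "(\<lambda>n. ?s n x) \<longlonglongrightarrow> indicator {x. 0 < u x} x"
      proof (cases "0 < u x")
        case True
        then obtain N :: nat where "1 < real N * u x" using reals_Archimedean3 by blast
        then have "?s n x = 1" if "n \<ge> N" for n
          using that True by (smt (verit) mult_right_mono of_nat_mono)
        then have "\<forall>\<^sub>F n in sequentially. ?s n x = 1" unfolding eventually_sequentially by blast
        then show ?thesis using True by (simp add: tendsto_eventually)
      next
        case False
        then have "u x = 0" using u(2)[of x] by auto
        then show ?thesis by simp
      qed
    qed
    show "AE x in lam t. norm (?s n x) \<le> 1" for n
      using u(2) by (intro AE_I2) (auto simp: min_def)
  qed auto
  moreover have "{x. 0 < u x} \<in> sets (lam t)" unfolding relaxed_controlsD(1)[OF lam t] by measurable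
  ultimately show "(\<lambda>n. \<integral>x. ?s n x \<partial>lam t) \<longlonglongrightarrow> measure (lam t) {x. 0 < u x}" by simp
qed

definition coding :: "(nat \<Rightarrow> 'x \<Rightarrow> real) \<Rightarrow> 'x \<Rightarrow> nat \<Rightarrow> bool" where
  "coding u x k \<longleftrightarrow> 0 < u k x"

lemma coding_measurable:
  assumes "\<And>k. continuous_on UNIV (u k :: 'x::topological_space \<Rightarrow> real)"
  shows "coding u \<in> borel \<rightarrow>\<^sub>M cantor"
proof (rule measurable_cantorI)
  fix s show "{x \<in> space borel. coding u x \<in> cyl s} \<in> sets borel"
  proof (induction s)
    case (Cons b s)
    have [measurable]: "u k \<in> borel_measurable borel" for k
      by (rule borel_measurable_continuous_onI[OF assms])
    have "{x \<in> space borel. coding u x \<in> cyl (b # s)} =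
      {x \<in> space borel. coding u x \<in> cyl s} \<inter> {x \<in> space borel. (0 < u (length s) x) = b}"
      by (auto simp: coding_def)
    then show ?case using Cons.IH by auto
  qed simp
qed

text \<open>Induction on \<open>s\<close> with a weight \<open>w\<close>: a digit
  \<open>True\<close> replaces \<open>w\<close> by its minimum with the next function, a digit
  \<open>False\<close> is a difference of two such sets. Letting \<open>w\<close> vary keeps both
  within the induction hypothesis; in the end \<open>w\<close> is constantly 1.\<close>

lemma relaxed_control_coding_measurable:
  fixes lam :: "'t \<Rightarrow> 'x::topological_space measure" and u :: "nat \<Rightarrow> 'x \<Rightarrow> real"
  assumes lam: "lam \<in> relaxed_controls M" and u: "\<And>k. continuous_on UNIV (u k)" "\<And>k x. u k x \<in> {0..1}"
  shows "(\<lambda>t. distr (lam t) cantor (coding u)) \<in> M \<rightarrow>\<^sub>M prob_algebra cantor"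
proof -
  let ?E = "\<lambda>w s. {x. 0 < w x \<and> coding u x \<in> cyl s}"
  have u_meas [measurable]: "u k \<in> borel_measurable borel" for k
    by (rule borel_measurable_continuous_onI[OF u(1)])
  have cod [measurable]: "coding u \<in> borel \<rightarrow>\<^sub>M cantor" by (rule coding_measurable[OF u(1)])
  have *: "(\<lambda>t. measure (lam t) (?E w s)) \<in> borel_measurable M"
    if "continuous_on UNIV w" "\<And>x. w x \<in> {0..1}" for w :: "'x \<Rightarrow> real" and s
    using that
  proof (induction s arbitrary: w)
    case Nil
    then show ?case using relaxed_control_cozero_measurable[OF lam Nil] by simp
  next
    case (Cons b s)
    let ?k = "length s"
    let ?w = "\<lambda>x. min (w x) (u ?k x)"
    have [measurable]: "w \<in> borel_measurable borel" by (rule borel_measurable_continuous_onI[OF Cons.prems(1)])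
    have w': "continuous_on UNIV ?w" by (intro continuous_on_min Cons.prems u)
    have w'': "?w x \<in> {0..1}" for x using Cons.prems(2)[of x] u(2)[of ?k x] by auto
    have T: "?E w (True # s) = ?E ?w s" by (auto simp: coding_def)
    have F: "?E w (False # s) = ?E w s - ?E ?w s" by (auto simp: coding_def)
    have IH: "(\<lambda>t. measure (lam t) (?E w s)) \<in> borel_measurable M"
      "(\<lambda>t. measure (lam t) (?E ?w s)) \<in> borel_measurable M"
      using Cons.IH[OF Cons.prems] Cons.IH[OF w' w''] by blast+
    show ?case
    proof (cases b)
      case True
      then have "b = True" by simp
      show ?thesis unfolding \<open>b = True\<close> T by (rule IH)
    next
      case False
      then have "b = False" by simp
      have "measure (lam t) (?E w s - ?E ?w s) = measure (lam t) (?E w s) - measure (lam t) (?E ?w s)"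
        if t: "t \<in> space M" for t
      proof -
        interpret P: prob_space "lam t" by (rule relaxed_controlsD(2)[OF lam t])
        have "?E w s \<in> sets borel" "?E ?w s \<in> sets borel" by measurable
        then show ?thesis using relaxed_controlsD(1)[OF lam t]
          by (intro P.finite_measure_Diff) auto
      qed
      then show ?thesis unfolding \<open>b = False\<close> F using IH
        by (subst measurable_cong[where g="\<lambda>t. measure (lam t) (?E w s) - measure (lam t) (?E ?w s)"]) auto
    qed
  qed
  have cod_t: "coding u \<in> lam t \<rightarrow>\<^sub>M cantor" if "t \<in> space M" for t
    using cod measurable_cong_sets[OF relaxed_controlsD(1)[OF lam that] refl] by blast
  have prob: "prob_space (distr (lam t) cantor (coding u))" if "t \<in> space M" for t
    by (rule prob_space.prob_space_distr[OF relaxed_controlsD(2)[OF lam that] cod_t[OF that]])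
  show ?thesis
  proof (rule measurable_prob_algebra_generated[OF sets_cantor Int_stable_cyl])
    have cyl_meas: "(\<lambda>t. emeasure (distr (lam t) cantor (coding u)) (cyl s)) \<in> borel_measurable M" for s
    proof -
      have eq: "emeasure (distr (lam t) cantor (coding u)) (cyl s) = ennreal (measure (lam t) (?E (\<lambda>_. 1 :: real) s))"
        if t: "t \<in> space M" for t
      proof -
        interpret P: prob_space "lam t" by (rule relaxed_controlsD(2)[OF lam t])
        have "space (lam t) = UNIV" using sets_eq_imp_space_eq[OF relaxed_controlsD(1)[OF lam t]] by simp
        then have "coding u -` cyl s \<inter> space (lam t) = ?E (\<lambda>_. 1 :: real) s" by auto
        then show ?thesis using cod_t[OF t] by (simp add: emeasure_distr P.emeasure_eq_measure)
      qed
      have "(\<lambda>t. ennreal (measure (lam t) (?E (\<lambda>_. 1 :: real) s))) \<in> borel_measurable M"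
        using *[of "\<lambda>_. 1 :: real" s] by simp
      then show ?thesis by (subst measurable_cong[OF eq])
    qed
    then show "(\<lambda>t. emeasure (distr (lam t) cantor (coding u)) A) \<in> borel_measurable M"
      if "A \<in> insert {} (range cyl)" for A
      using that by (elim insertE rangeE) simp_all
  qed (simp_all add: prob)
qed

section \<open>Decoding and the main theorem\<close>

text \<open>The selection recovers from a pair \<open>(t, q)\<close> a point of \<open>U t\<close> with code \<open>q\<close>; by fullness of
  \<open>lam t\<close> on \<open>U t\<close> it is defined for almost every \<open>t\<close> and almost every code.\<close>

lemma exists_decoding:
  fixes lam :: "'t \<Rightarrow> 'x::t2_space measure" and g :: "'x \<Rightarrow> nat \<Rightarrow> bool"
  assumes "finite_measure M" "space M \<noteq> {}"
    and \<beta>: "continuous_on UNIV \<beta>" "surj (\<beta> :: (nat \<Rightarrow> nat) \<Rightarrow> 'x)"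
    and U: "{(t, x). t \<in> space M \<and> x \<in> U t} \<in> sets (M \<Otimes>\<^sub>M borel)"
    and lam: "\<And>t. t \<in> space M \<Longrightarrow> sets (lam t) = sets borel" "\<And>t. t \<in> space M \<Longrightarrow> prob_space (lam t)"
    and g: "g \<in> borel \<rightarrow>\<^sub>M cantor"
    and K: "(\<lambda>t. distr (lam t) cantor g) \<in> M \<rightarrow>\<^sub>M prob_algebra cantor"
    and conc: "concentrated_on M lam U"
  obtains s where "s \<in> M \<Otimes>\<^sub>M cantor \<rightarrow>\<^sub>M borel"
    "AE t in M. AE x in lam t. s (t, g x) \<in> U t \<and> g (s (t, g x)) = g x"
proof -
  interpret finite_measure M by fact
  let ?K = "\<lambda>t. distr (lam t) cantor g"
  let ?\<Omega> = "M \<Otimes>\<^sub>M cantor"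
  have g_t: "g \<in> lam t \<rightarrow>\<^sub>M cantor" if "t \<in> space M" for t
    using g measurable_cong_sets[OF lam(1)[OF that] refl] by blast
  \<comment> \<open>The product of \<open>M\<close> with the coded kernel, whose null sets the
    selection may ignore. It is formed on codes because measurability in \<open>t\<close> is
    available for \<open>?K\<close>, not for \<open>lam\<close>.\<close>
  define \<rho> where "\<rho> = M \<bind> (\<lambda>t. distr (?K t) ?\<Omega> (\<lambda>q. (t, q)))"
  have kern: "(\<lambda>t. distr (?K t) ?\<Omega> (\<lambda>q. (t, q))) \<in> M \<rightarrow>\<^sub>M subprob_algebra ?\<Omega>"
    using measurable_prob_algebraD[OF K] by (intro measurable_distr2[of Pair]) simp_all
  have sets_\<rho> [measurable_cong]: "sets \<rho> = sets ?\<Omega>"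
    unfolding \<rho>_def using assms(2) by (intro sets_bind) simp_all
  have space_\<rho>: "space \<rho> = space M \<times> UNIV"
    using sets_eq_imp_space_eq[OF sets_\<rho>] by (simp add: space_pair_measure)
  have slice: "{x. (t, g x) \<in> D} \<in> sets borel" if t: "t \<in> space M" and D: "D \<in> sets ?\<Omega>" for t D
  proof -
    have "(\<lambda>x. (t, g x)) \<in> borel \<rightarrow>\<^sub>M ?\<Omega>" using t g by simp
    from measurable_sets[OF this D] show ?thesis by (simp add: vimage_def)
  qed
  have \<rho>_eq: "emeasure \<rho> D = (\<integral>\<^sup>+t. emeasure (lam t) {x. (t, g x) \<in> D} \<partial>M)" if D: "D \<in> sets ?\<Omega>" for D
  proof -
    have "emeasure \<rho> D = (\<integral>\<^sup>+t. emeasure (distr (?K t) ?\<Omega> (\<lambda>q. (t, q))) D \<partial>M)"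
      unfolding \<rho>_def by (rule emeasure_bind[OF assms(2) kern D])
    also have "\<dots> = (\<integral>\<^sup>+t. emeasure (lam t) {x. (t, g x) \<in> D} \<partial>M)"
    proof (rule nn_integral_cong)
      fix t assume t: "t \<in> space M"
      have sp: "space (lam t) = UNIV" using sets_eq_imp_space_eq[OF lam(1)[OF t]] by simp
      have "distr (?K t) ?\<Omega> (\<lambda>q. (t, q)) = distr (lam t) ?\<Omega> (\<lambda>x. (t, g x))"
        using t g_t[OF t] by (subst distr_distr) (auto simp: comp_def)
      then show "emeasure (distr (?K t) ?\<Omega> (\<lambda>q. (t, q))) D = emeasure (lam t) {x. (t, g x) \<in> D}"
        using t g_t[OF t] D sp by (simp add: emeasure_distr vimage_def)
    qed
    finally show ?thesis .
  qed
  have "finite_measure \<rho>"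
  proof (rule finite_measureI)
    have "emeasure \<rho> (space \<rho>) = (\<integral>\<^sup>+t. emeasure (lam t) {x. (t, g x) \<in> space ?\<Omega>} \<partial>M)"
      using sets_eq_imp_space_eq[OF sets_\<rho>] by (simp only: \<rho>_eq[OF sets.top])
    also have "\<dots> \<le> (\<integral>\<^sup>+t. 1 \<partial>M)"
      using lam(2) by (intro nn_integral_mono prob_space.emeasure_le_1)
    also have "\<dots> < \<infinity>" using emeasure_finite[of "space M"] by (simp add: less_top[symmetric])
    finally show "emeasure \<rho> (space \<rho>) \<noteq> \<infinity>" by simp
  qed
  \<comment> \<open>Parameter, code, and a point of \<open>U t\<close> with that code; a selection
    from \<open>A\<close> over the pairs \<open>(t, q)\<close> is a decoding.\<close>
  define A where "A = {z \<in> space (\<rho> \<Otimes>\<^sub>M (borel :: 'x measure)). snd z \<in> U (fst (fst z)) \<and> g (snd z) = snd (fst z)}"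
  have A: "A \<in> sets (\<rho> \<Otimes>\<^sub>M (borel :: 'x measure))"
  proof -
    note [measurable] = g U
    let ?G = "{(t, x). t \<in> space M \<and> x \<in> U t}"
    have "A = {z \<in> space (\<rho> \<Otimes>\<^sub>M borel). (fst (fst z), snd z) \<in> ?G \<and>
      (\<forall>s. snd (fst z) \<in> cyl s \<longrightarrow> g (snd z) \<in> cyl s)}"
      unfolding A_def cyl_separate by (auto simp: space_pair_measure space_\<rho>)
    also have "\<dots> \<in> sets (\<rho> \<Otimes>\<^sub>M borel)" by measurable
    finally show ?thesis .
  qed
  have A_iff: "((t, q), x) \<in> A \<longleftrightarrow> t \<in> space M \<and> x \<in> U t \<and> g x = q" for t q x
    by (auto simp: A_def space_pair_measure space_\<rho>)
  obtain s D where s: "s \<in> \<rho> \<rightarrow>\<^sub>M borel" and D: "D \<in> sets \<rho>" "fst ` A \<subseteq> D"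
    and sel: "AE w in \<rho>. w \<in> D \<longrightarrow> (w, s w) \<in> A"
    using analytic_in_selection[OF \<open>finite_measure \<rho>\<close> analytic_in_sets_pair[OF \<beta> A]] by blast
  have s' [measurable]: "s \<in> ?\<Omega> \<rightarrow>\<^sub>M borel" using s measurable_cong_sets[OF sets_\<rho> refl] by blast
  have "AE t in M. emeasure (lam t) (U t) = 1" using conc by (simp add: concentrated_on_def)
  \<comment> \<open>Each \<open>x \<in> U t\<close> itself shows that \<open>(t, g x)\<close> lies
    in the projection of \<open>A\<close>, so concentration on \<open>U\<close> makes
    \<open>D\<close> full.\<close>
  then have D_full: "AE t in M. AE x in lam t. (t, g x) \<in> D"
    using AE_space
  proof eventually_elim
    case (elim t)
    interpret P: prob_space "lam t" by (rule lam(2)) (use elim in simp)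
    have DO: "D \<in> sets ?\<Omega>" using D(1) by (simp only: sets_\<rho>)
    have meas: "{x. (t, g x) \<in> D} \<in> sets (lam t)" using slice[OF elim(2) DO] lam(1)[OF elim(2)] by simp
    have "U t \<subseteq> {x. (t, g x) \<in> D}"
    proof
      fix x assume "x \<in> U t"
      then have "((t, g x), x) \<in> A" using elim(2) A_iff by blast
      then have "(t, g x) \<in> fst ` A" by force
      then show "x \<in> {x. (t, g x) \<in> D}" using D(2) by blast
    qed
    then have "1 \<le> emeasure (lam t) {x. (t, g x) \<in> D}"
      using emeasure_mono[OF _ meas] elim(1) by metis
    then have "P.prob {x. (t, g x) \<in> D} = 1"
      using P.prob_le_1 by (auto simp: P.emeasure_eq_measure intro: antisym)
    then show ?case using P.AE_prob_1 by fastforce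
  qed
  \<comment> \<open>\<open>Z\<close> is where the selection fails. It is null for \<rho>, and
    \<open>\<rho>_eq\<close> disintegrates this into null sets of \<open>lam t\<close> for almost
    every \<open>t\<close>.\<close>
  define Z where "Z = {w \<in> space ?\<Omega>. \<not> (w \<in> D \<longrightarrow> (w, s w) \<in> A)}"
  have Z: "Z \<in> sets ?\<Omega>"
  proof -
    have [measurable]: "D \<in> sets ?\<Omega>" "A \<in> sets (?\<Omega> \<Otimes>\<^sub>M borel)"
      using D(1) A sets_\<rho> sets_pair_measure_cong[OF sets_\<rho> refl] by blast+
    show ?thesis unfolding Z_def by measurable
  qed
  have "emeasure \<rho> Z = 0"
    using sel Z sets_eq_imp_space_eq[OF sets_\<rho>] unfolding Z_def
    by (subst AE_iff_measurable[symmetric, where P="\<lambda>w. w \<in> D \<longrightarrow> (w, s w) \<in> A"]) (simp_all add: sets_\<rho>)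
  then have int0: "(\<integral>\<^sup>+t. emeasure (lam t) {x. (t, g x) \<in> Z} \<partial>M) = 0" using \<rho>_eq[OF Z] by simp
  have "AE t in M. emeasure (lam t) {x. (t, g x) \<in> Z} = 0"
  proof -
    have "(\<lambda>t. emeasure (distr (?K t) ?\<Omega> (\<lambda>q. (t, q))) Z) \<in> borel_measurable M"
      using kern Z by measurable
    moreover have "emeasure (distr (?K t) ?\<Omega> (\<lambda>q. (t, q))) Z = emeasure (lam t) {x. (t, g x) \<in> Z}"
      if t: "t \<in> space M" for t
    proof -
      have sp: "space (lam t) = UNIV" using sets_eq_imp_space_eq[OF lam(1)[OF t]] by simp
      have "distr (?K t) ?\<Omega> (\<lambda>q. (t, q)) = distr (lam t) ?\<Omega> (\<lambda>x. (t, g x))"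
        using t g_t[OF t] by (subst distr_distr) (auto simp: comp_def)
      then show ?thesis using t g_t[OF t] Z sp by (simp add: emeasure_distr vimage_def)
    qed
    ultimately have "(\<lambda>t. emeasure (lam t) {x. (t, g x) \<in> Z}) \<in> borel_measurable M"
      by (subst measurable_cong[symmetric]) auto
    then show ?thesis using int0 by (simp add: nn_integral_0_iff_AE)
  qed
  then have Z_null: "AE t in M. AE x in lam t. (t, g x) \<notin> Z"
    using AE_space
  proof eventually_elim
    case (elim t)
    have "{x. (t, g x) \<in> Z} \<in> null_sets (lam t)"
      using elim slice[OF elim(2) Z] lam(1)[OF elim(2)] by auto
    then show ?case by (rule AE_not_in[THEN eventually_mono]) simp
  qed
  from D_full Z_null AE_space
  have "AE t in M. AE x in lam t. s (t, g x) \<in> U t \<and> g (s (t, g x)) = g x"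
  proof eventually_elim
    case (elim t)
    from elim(1,2) show ?case
    proof eventually_elim
      case (elim x)
      then have "((t, g x), s (t, g x)) \<in> A"
        using \<open>t \<in> space M\<close> by (auto simp: Z_def space_pair_measure)
      then show ?case by (simp add: A_iff)
    qed
  qed
  with s' show ?thesis by (rule that)
qed

text \<open>The first conclusion supplies the measurability of the inner integrals, which has to be
  derived through the codes and so holds only up to null sets. In the second, adding
  \<open>b y t\<close> makes the integrands nonnegative, as \<open>saturated_purification\<close>
  works in \<open>ennreal\<close>.\<close>

lemma scalar_purification:
  fixes lam :: "'t \<Rightarrow> 'x::t2_space measure" and \<phi> :: "'i \<Rightarrow> 't \<Rightarrow> 'x \<Rightarrow> real"
  assumes "finite_measure M" "saturated_measure M" "space M \<noteq> {}"
    and X: "Suslin_space (euclidean :: 'x topology)"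
    and U: "{(t, x). t \<in> space M \<and> x \<in> U t} \<in> sets (M \<Otimes>\<^sub>M borel)"
    and lam: "lam \<in> relaxed_controls M" "concentrated_on M lam U"
    and \<phi>: "\<And>y. (\<lambda>(t, x). \<phi> y t x) \<in> borel_measurable (M \<Otimes>\<^sub>M borel)"
      "\<And>y t. t \<in> space M \<Longrightarrow> continuous_on UNIV (\<phi> y t)"
      "\<And>y t x. t \<in> space M \<Longrightarrow> \<bar>\<phi> y t x\<bar> \<le> b y t"
    and b: "\<And>y. integrable M (b y)"
    and Y: "countable Y"
  shows "(\<forall>y. \<exists>J\<in>borel_measurable M. AE t in M. (\<integral>x. \<phi> y t x \<partial>lam t) = J t) \<and>
    (\<exists>f\<in>M \<rightarrow>\<^sub>M borel. (AE t in M. f t \<in> U t) \<and>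
      (\<forall>y\<in>Y. (\<integral>\<^sup>+t. ennreal (\<phi> y t (f t) + b y t) \<partial>M) =
        (\<integral>\<^sup>+t. ennreal ((\<integral>x. \<phi> y t x \<partial>lam t) + b y t) \<partial>M)))"
proof -
  obtain \<beta> :: "(nat \<Rightarrow> nat) \<Rightarrow> 'x" where \<beta>: "continuous_on UNIV \<beta>" "surj \<beta>"
    using Suslin_space_baire_surj[OF X] by blast
  obtain u :: "nat \<Rightarrow> 'x \<Rightarrow> real" where u: "\<And>k. continuous_on UNIV (u k)" "\<And>k x. u k x \<in> {0..1}"
    and sep: "\<And>x x' (v :: 'x \<Rightarrow> real). (\<And>k. 0 < u k x \<longleftrightarrow> 0 < u k x') \<Longrightarrow> continuous_on UNIV v \<Longrightarrow> v x = v x'"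
    using countable_separating_functions[OF \<beta>] by blast
  let ?g = "coding u"
  have sep': "v x = v x'" if "?g x = ?g x'" "continuous_on UNIV v" for x x' and v :: "'x \<Rightarrow> real"
    using sep[OF _ that(2)] that(1) unfolding coding_def by metis
  have g [measurable]: "?g \<in> borel \<rightarrow>\<^sub>M cantor" by (rule coding_measurable[OF u(1)])
  let ?K = "\<lambda>t. distr (lam t) cantor ?g"
  have K: "?K \<in> M \<rightarrow>\<^sub>M prob_algebra cantor" by (rule relaxed_control_coding_measurable[OF lam(1) u])
  have KS: "?K \<in> M \<rightarrow>\<^sub>M subprob_algebra cantor" by (rule measurable_prob_algebraD[OF K])
  note lam_t = relaxed_controlsD[OF lam(1)]
  obtain s where s [measurable]: "s \<in> M \<Otimes>\<^sub>M cantor \<rightarrow>\<^sub>M borel"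
    and dec: "AE t in M. AE x in lam t. s (t, ?g x) \<in> U t \<and> ?g (s (t, ?g x)) = ?g x"
    using exists_decoding[OF assms(1,3) \<beta> U lam_t g K lam(2)] by blast
  note [measurable] = \<phi>(1) U
  have b_meas [measurable]: "b y \<in> borel_measurable M" for y using b by auto
  \<comment> \<open>The shifted integrand as a function of the code, evaluated at the decoded
    point.\<close>
  define \<eta> where "\<eta> y = (\<lambda>(t, q). ennreal (\<phi> y t (s (t, q)) + b y t))" for y
  have \<eta>: "\<eta> y \<in> borel_measurable (M \<Otimes>\<^sub>M cantor)" for y
  proof -
    have "(\<lambda>z. (fst z, s z)) \<in> M \<Otimes>\<^sub>M cantor \<rightarrow>\<^sub>M M \<Otimes>\<^sub>M borel" by measurable
    from measurable_compose[OF this \<phi>(1)[of y]]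
    have [measurable]: "(\<lambda>z. \<phi> y (fst z) (s z)) \<in> borel_measurable (M \<Otimes>\<^sub>M cantor)" by simp
    have "(\<lambda>z. ennreal (\<phi> y (fst z) (s z) + b y (fst z))) \<in> borel_measurable (M \<Otimes>\<^sub>M cantor)" by measurable
    then show ?thesis by (simp add: \<eta>_def case_prod_beta)
  qed
  let ?G = "{(t, x). t \<in> space M \<and> x \<in> U t}"
  define bad where "bad = {z \<in> space (M \<Otimes>\<^sub>M cantor). (fst z, s z) \<notin> ?G}"
  have bad [measurable]: "bad \<in> sets (M \<Otimes>\<^sub>M cantor)" unfolding bad_def by measurable
  have g_t: "?g \<in> lam t \<rightarrow>\<^sub>M cantor" if "t \<in> space M" for t
    using g measurable_cong_sets[OF lam_t(1)[OF that] refl] by blast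
  have \<phi>_int: "integrable (lam t) (\<phi> y t)" if t: "t \<in> space M" for t y
  proof -
    interpret P: prob_space "lam t" by (rule lam_t(2)[OF t])
    have "\<phi> y t \<in> borel_measurable (lam t)"
      using borel_measurable_continuous_onI[OF \<phi>(2)[OF t]] measurable_cong_sets[OF lam_t(1)[OF t] refl] by blast
    then show ?thesis using \<phi>(3)[OF t] by (intro P.integrable_const_bound[where B="b y t"]) auto
  qed
  have J: "AE t in M. (\<integral>\<^sup>+q. \<eta> y (t, q) \<partial>?K t) = ennreal ((\<integral>x. \<phi> y t x \<partial>lam t) + b y t)" for y
    using dec AE_space
  proof eventually_elim
    case (elim t)
    note t = elim(2)
    interpret P: prob_space "lam t" by (rule lam_t(2)[OF t])
    have "(\<lambda>q. \<eta> y (t, q)) \<in> borel_measurable cantor"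
      using measurable_compose[OF measurable_Pair1'[OF t] \<eta>] .
    then have "(\<integral>\<^sup>+q. \<eta> y (t, q) \<partial>?K t) = (\<integral>\<^sup>+x. \<eta> y (t, ?g x) \<partial>lam t)"
      using g_t[OF t] by (intro nn_integral_distr) auto
    also have "\<dots> = (\<integral>\<^sup>+x. ennreal (\<phi> y t x + b y t) \<partial>lam t)"
    proof (rule nn_integral_cong_AE, use elim(1) in eventually_elim)
      case (elim x)
      \<comment> \<open>The decoded point has the same code as \<open>x\<close>, and continuous
        functions do not distinguish points of equal code.\<close>
      then have "\<phi> y t (s (t, ?g x)) = \<phi> y t x" by (intro sep'[OF _ \<phi>(2)[OF t]]) simp
      then show ?case by (simp add: \<eta>_def)
    qed
    also have "\<dots> = ennreal (\<integral>x. \<phi> y t x + b y t \<partial>lam t)"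
    proof (rule nn_integral_eq_integral)
      show "AE x in lam t. 0 \<le> \<phi> y t x + b y t"
        using \<phi>(3)[OF t] by (intro AE_I2) (smt (verit))
    qed (simp add: \<phi>_int[OF t])
    also have "(\<integral>x. \<phi> y t x + b y t \<partial>lam t) = (\<integral>x. \<phi> y t x \<partial>lam t) + b y t"
      using \<phi>_int[OF t] by (simp add: P.prob_space)
    finally show ?case .
  qed
  have "\<exists>J\<in>borel_measurable M. AE t in M. (\<integral>x. \<phi> y t x \<partial>lam t) = J t" for y
  proof
    let ?J = "\<lambda>t. enn2real (\<integral>\<^sup>+q. \<eta> y (t, q) \<partial>?K t) - b y t"
    have "(\<lambda>t. \<integral>\<^sup>+q. \<eta> y (t, q) \<partial>?K t) \<in> borel_measurable M"
      using \<eta>[of y] KS by (intro nn_integral_measurable_subprob_algebra2) simp_all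
    then show "?J \<in> borel_measurable M" by measurable
    show "AE t in M. (\<integral>x. \<phi> y t x \<partial>lam t) = ?J t"
      using J[of y] AE_space
    proof eventually_elim
      case (elim t)
      \<comment> \<open>The bound makes the argument of \<open>ennreal\<close> nonnegative, so
        \<open>enn2real\<close> gives it back unchanged.\<close>
      have "\<bar>\<integral>x. \<phi> y t x \<partial>lam t\<bar> \<le> b y t"
      proof -
        interpret P: prob_space "lam t" by (rule lam_t(2)[OF elim(2)])
        have "\<bar>\<integral>x. \<phi> y t x \<partial>lam t\<bar> \<le> (\<integral>x. \<bar>\<phi> y t x\<bar> \<partial>lam t)" by (rule integral_abs_bound)
        also have "\<dots> \<le> (\<integral>x. b y t \<partial>lam t)"
          using \<phi>_int[OF elim(2)] \<phi>(3)[OF elim(2)] by (intro integral_mono) auto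
        finally show ?thesis by (simp add: P.prob_space)
      qed
      then show ?case using elim(1) by simp
    qed
  qed
  moreover
  \<comment> \<open>The indicator of \<open>bad\<close> joins the integrands: its integral against
    the kernel vanishes by \<open>dec\<close>, so \<open>f'\<close> avoids \<open>bad\<close> almost
    everywhere and decodes into \<open>U t\<close>.\<close>
  have H: "countable (insert (indicator bad) (\<eta> ` Y))" using Y by simp
  have Hm: "h \<in> borel_measurable (M \<Otimes>\<^sub>M cantor)" if "h \<in> insert (indicator bad) (\<eta> ` Y)" for h
    using that \<eta> by auto
  obtain f' where f': "f' \<in> M \<rightarrow>\<^sub>M cantor"
    and law: "\<And>h. h \<in> insert (indicator bad) (\<eta> ` Y) \<Longrightarrow>
      (\<integral>\<^sup>+t. h (t, f' t) \<partial>M) = (\<integral>\<^sup>+t. \<integral>\<^sup>+q. h (t, q) \<partial>?K t \<partial>M)"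
    using saturated_purification[OF assms(1,2) K H Hm] by blast
  note [measurable] = f'
  define f where "f t = s (t, f' t)" for t
  have "f \<in> M \<rightarrow>\<^sub>M borel" unfolding f_def by measurable
  moreover have "AE t in M. f t \<in> U t"
  proof -
    have "(\<integral>\<^sup>+t. \<integral>\<^sup>+q. indicator bad (t, q) \<partial>?K t \<partial>M) = (\<integral>\<^sup>+t. 0 \<partial>M)"
    proof (rule nn_integral_cong_AE, use dec AE_space in eventually_elim)
      case (elim t)
      note t = elim(2)
      have "(\<lambda>q. indicator bad (t, q) :: ennreal) \<in> borel_measurable cantor"
        by (rule measurable_compose[OF measurable_Pair1'[OF t]]) measurable
      then have "(\<integral>\<^sup>+q. indicator bad (t, q) \<partial>?K t) = (\<integral>\<^sup>+x. indicator bad (t, ?g x) \<partial>lam t)"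
        using g_t[OF t] by (intro nn_integral_distr) auto
      also have "\<dots> = (\<integral>\<^sup>+x. 0 \<partial>lam t)"
        by (rule nn_integral_cong_AE, use elim(1) in eventually_elim) (use t in \<open>auto simp: bad_def\<close>)
      finally show ?case by simp
    qed
    then have "(\<integral>\<^sup>+t. indicator bad (t, f' t) \<partial>M) = (0 :: ennreal)" using law[of "indicator bad"] by simp
    then have "AE t in M. indicator bad (t, f' t) = (0 :: ennreal)"
      by (subst (asm) nn_integral_0_iff_AE) measurable
    then show ?thesis using AE_space
      by eventually_elim (auto simp: bad_def f_def space_pair_measure split: split_indicator_asm)
  qed
  moreover have "(\<integral>\<^sup>+t. ennreal (\<phi> y t (f t) + b y t) \<partial>M) =
        (\<integral>\<^sup>+t. ennreal ((\<integral>x. \<phi> y t x \<partial>lam t) + b y t) \<partial>M)" if "y \<in> Y" for y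
  proof -
    have "(\<integral>\<^sup>+t. ennreal (\<phi> y t (f t) + b y t) \<partial>M) = (\<integral>\<^sup>+t. \<eta> y (t, f' t) \<partial>M)"
      by (simp add: \<eta>_def f_def)
    also have "\<dots> = (\<integral>\<^sup>+t. \<integral>\<^sup>+q. \<eta> y (t, q) \<partial>?K t \<partial>M)" using that by (intro law) auto
    also have "\<dots> = (\<integral>\<^sup>+t. ennreal ((\<integral>x. \<phi> y t x \<partial>lam t) + b y t) \<partial>M)"
      by (rule nn_integral_cong_AE[OF J])
    finally show ?thesis .
  qed
  ultimately show ?thesis by blast
qed

section \<open>From scalar components to Gelfand integrals\<close>

lemma (in complete_measure) borel_measurable_AE_eq:
  fixes f g :: "'a \<Rightarrow> real"
  assumes g: "g \<in> borel_measurable M" and eq: "AE t in M. f t = g t"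
  shows "f \<in> borel_measurable M"
proof (rule borel_measurableI)
  fix V :: "real set" assume "open V"
  obtain N where N: "{t \<in> space M. f t \<noteq> g t} \<subseteq> N" "N \<in> null_sets M"
    using eq by (auto elim!: AE_E simp: null_sets_def)
  have "f -` V \<inter> N \<inter> space M \<in> sets M" by (rule complete[OF _ N(2)]) auto
  moreover have "g -` V \<inter> space M - N \<in> sets M"
    using measurable_sets[OF g borel_open[OF \<open>open V\<close>]] N(2) by auto
  moreover have "f -` V \<inter> space M = (g -` V \<inter> space M - N) \<union> (f -` V \<inter> N \<inter> space M)"
    using N(1) by auto
  ultimately show "f -` V \<inter> space M \<in> sets M" by simp
qed

lemma weak_star_evaluation_measurable:
  "(\<lambda>F. blinfun_apply F y) \<in> borel_of (weak_star_topology :: ('e::real_normed_vector \<Rightarrow>\<^sub>L real) topology) \<rightarrow>\<^sub>M borel"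
proof (rule borel_measurableI)
  fix V :: "real set" assume "open V"
  have "openin (weak_star_topology :: ('e \<Rightarrow>\<^sub>L real) topology)
    {F \<in> topspace weak_star_topology. blinfun_apply F y \<in> V}"
    using strong_operator_topology_continuous_evaluation[of y] \<open>open V\<close>
    unfolding continuous_map_def by (auto simp: open_openin[symmetric])
  moreover have "(\<lambda>F. blinfun_apply F y) -` V \<inter> space (borel_of (weak_star_topology :: ('e \<Rightarrow>\<^sub>L real) topology)) =
    {F \<in> topspace weak_star_topology. blinfun_apply F y \<in> V}" by auto
  ultimately show "(\<lambda>F. blinfun_apply F y) -` V \<inter> space (borel_of (weak_star_topology :: ('e \<Rightarrow>\<^sub>L real) topology))
    \<in> sets (borel_of weak_star_topology)"
    unfolding sets_borel_of by (auto intro: sigma_sets.Basic)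
qed

lemma gelfand_integral_cong:
  assumes "\<And>t. t \<in> space N \<Longrightarrow> g t = h t"
  shows "gelfand_integral N g = gelfand_integral N h"
proof -
  have "has_gelfand_integral N g I \<longleftrightarrow> has_gelfand_integral N h I" for I
    unfolding has_gelfand_integral_def using assms
    by (simp cong: Bochner_Integration.integrable_cong Bochner_Integration.integral_cong)
  then have "has_gelfand_integral N g = has_gelfand_integral N h" by (rule ext)
  then show ?thesis unfolding gelfand_integral_def by (rule arg_cong)
qed

theorem theorem3p3:
  fixes M :: "'t measure"
    and \<Phi> :: "'t \<Rightarrow> 'x::t2_space \<Rightarrow> ('e::banach \<Rightarrow>\<^sub>L real)"
    and U :: "'t \<Rightarrow> 'x set"
    and lam :: "'t \<Rightarrow> 'x measure"
  assumes "finite_measure M"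
    and "complete_measure M"
    and "saturated_measure M"
    and "separable_space (euclidean :: 'e topology)"
    and "Suslin_space (euclidean :: 'x topology)"
    and "(\<lambda>(t, x). \<Phi> t x) \<in> (M \<Otimes>\<^sub>M borel) \<rightarrow>\<^sub>M borel_of weak_star_topology"
    and "integrably_bounded M \<Phi>"
    and "\<And>t. t \<in> space M \<Longrightarrow> continuous_map euclidean weak_star_topology (\<Phi> t)"
    and "\<And>t. t \<in> space M \<Longrightarrow> U t \<noteq> {} \<and> compact (U t)"
    and "{(t, x). t \<in> space M \<and> x \<in> U t} \<in> sets (M \<Otimes>\<^sub>M borel)"
    and "lam \<in> relaxed_controls M"
    and "concentrated_on M lam U"
  shows "\<exists>f \<in> M \<rightarrow>\<^sub>M borel. (AE t in M. f t \<in> U t) \<and>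
           gelfand_integral M (\<lambda>t. gelfand_integral (lam t) (\<Phi> t)) =
           gelfand_integral M (\<lambda>t. \<Phi> t (f t))"
proof (cases "space M = {}")
  case True
  \<comment> \<open>Over an empty space any \<open>f\<close> serves; the remaining case needs a
    point of \<open>space M\<close> to form the product of \<open>M\<close> with a kernel by
    binding.\<close>
  then show ?thesis
    by (intro bexI[of _ "\<lambda>_. undefined"] conjI gelfand_integral_cong) (auto intro: AE_I2)
next
  case False
  interpret finite_measure M by fact
  interpret complete_measure M by fact
  obtain \<psi> :: "'t \<Rightarrow> real" where \<psi>: "integrable M \<psi>" "\<And>t x. t \<in> space M \<Longrightarrow> norm (\<Phi> t x) \<le> \<psi> t"
    using assms(7) unfolding integrably_bounded_def by blast
  obtain Y :: "'e set" where Y: "countable Y" "closure Y = UNIV"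
    using assms(4) unfolding separable_space_def by auto
  let ?\<phi> = "\<lambda>y t x. blinfun_apply (\<Phi> t x) y"
  let ?b = "\<lambda>y t. \<psi> t * norm y"
  have \<phi>_meas: "(\<lambda>(t, x). ?\<phi> y t x) \<in> borel_measurable (M \<Otimes>\<^sub>M borel)" for y
    using measurable_compose[OF assms(6) weak_star_evaluation_measurable[of y]] by (simp add: case_prod_beta)
  have \<phi>_cont: "continuous_on UNIV (?\<phi> y t)" if "t \<in> space M" for y t
    using continuous_map_compose[OF assms(8)[OF that] strong_operator_topology_continuous_evaluation[of y]]
    by (simp add: comp_def)
  have \<phi>_bound: "\<bar>?\<phi> y t x\<bar> \<le> ?b y t" if "t \<in> space M" for y t x
    using norm_blinfun[of "\<Phi> t x" y] mult_right_mono[OF \<psi>(2)[OF that, of x] norm_ge_zero[of y]] by simp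
  have b_int: "integrable M (?b y)" for y using \<psi>(1) by simp
  note lam_t = relaxed_controlsD[OF assms(11)]
  have scalar: "(\<forall>y. \<exists>J\<in>borel_measurable M. AE t in M. (\<integral>x. ?\<phi> y t x \<partial>lam t) = J t) \<and>
    (\<exists>f\<in>M \<rightarrow>\<^sub>M borel. (AE t in M. f t \<in> U t) \<and>
      (\<forall>y\<in>Y. (\<integral>\<^sup>+t. ennreal (?\<phi> y t (f t) + ?b y t) \<partial>M) =
        (\<integral>\<^sup>+t. ennreal ((\<integral>x. ?\<phi> y t x \<partial>lam t) + ?b y t) \<partial>M)))"
    by (rule scalar_purification[OF assms(1,3) False assms(5,10-12) \<phi>_meas \<phi>_cont \<phi>_bound b_int Y(1)])
  then obtain f where f [measurable]: "f \<in> M \<rightarrow>\<^sub>M borel" and fU: "AE t in M. f t \<in> U t"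
    and f_eq: "\<And>y. y \<in> Y \<Longrightarrow> (\<integral>\<^sup>+t. ennreal (?\<phi> y t (f t) + ?b y t) \<partial>M) =
        (\<integral>\<^sup>+t. ennreal ((\<integral>x. ?\<phi> y t x \<partial>lam t) + ?b y t) \<partial>M)" by blast
  let ?G = "\<lambda>t. gelfand_integral (lam t) (\<Phi> t)"
  have G: "blinfun_apply (?G t) y = (\<integral>x. ?\<phi> y t x \<partial>lam t)" and G_norm: "norm (?G t) \<le> \<psi> t"
    if t: "t \<in> space M" for t y
  proof -
    interpret P: prob_space "lam t" by (rule lam_t(2)[OF t])
    have int: "integrable (lam t) (?\<phi> y t)" for y
    proof -
      have "?\<phi> y t \<in> borel_measurable (lam t)"
        using borel_measurable_continuous_onI[OF \<phi>_cont[OF t]] measurable_cong_sets[OF lam_t(1)[OF t] refl] by blast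
      then show ?thesis using \<phi>_bound[OF t] by (intro P.integrable_const_bound[where B="?b y t"]) auto
    qed
    have has: "has_gelfand_integral (lam t) (\<Phi> t) (?G t)"
      by (rule has_gelfand_integral_gelfand_integral[where \<psi>="\<lambda>_. \<psi> t"]) (use int \<psi>(2)[OF t] in auto)
    then show G: "blinfun_apply (?G t) y = (\<integral>x. ?\<phi> y t x \<partial>lam t)" for y
      unfolding has_gelfand_integral_def by blast
    show "norm (?G t) \<le> \<psi> t"
    proof (rule norm_blinfun_bound)
      show "0 \<le> \<psi> t" using order_trans[OF norm_ge_zero \<psi>(2)[OF t]] .
      fix y
      have "\<bar>\<integral>x. ?\<phi> y t x \<partial>lam t\<bar> \<le> (\<integral>x. \<bar>?\<phi> y t x\<bar> \<partial>lam t)" by (rule integral_abs_bound)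
      also have "\<dots> \<le> (\<integral>x. ?b y t \<partial>lam t)"
        using int \<phi>_bound[OF t] by (intro integral_mono) auto
      finally show "norm (blinfun_apply (?G t) y) \<le> \<psi> t * norm y" by (simp add: G P.prob_space)
    qed
  qed
  have G_bound: "\<bar>blinfun_apply (?G t) y\<bar> \<le> ?b y t" if "t \<in> space M" for t y
    using norm_blinfun[of "?G t" y] mult_right_mono[OF G_norm[OF that] norm_ge_zero[of y]] by simp
  have G_int: "integrable M (\<lambda>t. blinfun_apply (?G t) y)" for y
  proof (rule Bochner_Integration.integrable_bound[OF b_int[of y]])
    obtain J where J: "J \<in> borel_measurable M" "AE t in M. (\<integral>x. ?\<phi> y t x \<partial>lam t) = J t"
      using scalar by blast
    have "AE t in M. blinfun_apply (?G t) y = J t"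
      using J(2) AE_space by eventually_elim (simp add: G)
    \<comment> \<open>Completeness enters here: the components of the inner Gelfand integral are
      known to equal a measurable function only almost everywhere.\<close>
    then show "(\<lambda>t. blinfun_apply (?G t) y) \<in> borel_measurable M"
      by (rule borel_measurable_AE_eq[OF J(1)])
    show "AE t in M. norm (blinfun_apply (?G t) y) \<le> norm (?b y t)"
      using G_bound by (intro AE_I2) (fastforce intro: order_trans)
  qed
  have F_int: "integrable M (\<lambda>t. ?\<phi> y t (f t))" for y
  proof (rule Bochner_Integration.integrable_bound[OF b_int[of y]])
    have "(\<lambda>t. (t, f t)) \<in> M \<rightarrow>\<^sub>M M \<Otimes>\<^sub>M borel" by measurable
    from measurable_compose[OF this \<phi>_meas[of y]]
    show "(\<lambda>t. ?\<phi> y t (f t)) \<in> borel_measurable M" by simp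
    show "AE t in M. norm (?\<phi> y t (f t)) \<le> norm (?b y t)"
      using \<phi>_bound by (intro AE_I2) (fastforce intro: order_trans)
  qed
  let ?L = "gelfand_integral M ?G" and ?R = "gelfand_integral M (\<lambda>t. \<Phi> t (f t))"
  have "has_gelfand_integral M ?G ?L"
    by (rule has_gelfand_integral_gelfand_integral[OF G_int \<psi>(1) G_norm])
  then have L: "blinfun_apply ?L y = (\<integral>t. blinfun_apply (?G t) y \<partial>M)" for y
    unfolding has_gelfand_integral_def by blast
  have "has_gelfand_integral M (\<lambda>t. \<Phi> t (f t)) ?R"
    by (rule has_gelfand_integral_gelfand_integral[OF F_int \<psi>])
  then have R: "blinfun_apply ?R y = (\<integral>t. ?\<phi> y t (f t) \<partial>M)" for y
    unfolding has_gelfand_integral_def by blast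
  have LR: "blinfun_apply ?L y = blinfun_apply ?R y" if "y \<in> Y" for y
  proof -
    have F_nn: "0 \<le> ?\<phi> y t (f t) + ?b y t" if "t \<in> space M" for t
    proof -
      have "\<bar>?\<phi> y t (f t)\<bar> \<le> ?b y t" by (rule \<phi>_bound[OF that])
      then show ?thesis by linarith
    qed
    have G_nn: "0 \<le> blinfun_apply (?G t) y + ?b y t" if "t \<in> space M" for t
    proof -
      have "\<bar>blinfun_apply (?G t) y\<bar> \<le> ?b y t" by (rule G_bound[OF that])
      then show ?thesis by linarith
    qed
    \<comment> \<open>After the shift both integrands are nonnegative, so the equality of extended
      integrals passes to real integrals, where the shift cancels.\<close>
    have "ennreal (\<integral>t. ?\<phi> y t (f t) + ?b y t \<partial>M) = (\<integral>\<^sup>+t. ennreal (?\<phi> y t (f t) + ?b y t) \<partial>M)"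
      by (intro nn_integral_eq_integral[symmetric] AE_I2 Bochner_Integration.integrable_add F_int b_int F_nn)
    also have "\<dots> = (\<integral>\<^sup>+t. ennreal ((\<integral>x. ?\<phi> y t x \<partial>lam t) + ?b y t) \<partial>M)" by (rule f_eq[OF that])
    also have "\<dots> = (\<integral>\<^sup>+t. ennreal (blinfun_apply (?G t) y + ?b y t) \<partial>M)"
      by (intro nn_integral_cong) (simp add: G)
    also have "\<dots> = ennreal (\<integral>t. blinfun_apply (?G t) y + ?b y t \<partial>M)"
      by (intro nn_integral_eq_integral AE_I2 Bochner_Integration.integrable_add G_int b_int G_nn)
    finally have "ennreal (\<integral>t. ?\<phi> y t (f t) + ?b y t \<partial>M) = ennreal (\<integral>t. blinfun_apply (?G t) y + ?b y t \<partial>M)" .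
    moreover have "0 \<le> (\<integral>t. ?\<phi> y t (f t) + ?b y t \<partial>M)"
      by (intro Bochner_Integration.integral_nonneg_AE AE_I2 F_nn)
    moreover have "0 \<le> (\<integral>t. blinfun_apply (?G t) y + ?b y t \<partial>M)"
      by (intro Bochner_Integration.integral_nonneg_AE AE_I2 G_nn)
    ultimately have "(\<integral>t. ?\<phi> y t (f t) + ?b y t \<partial>M) = (\<integral>t. blinfun_apply (?G t) y + ?b y t \<partial>M)" by simp
    then show ?thesis unfolding L R using F_int[of y] G_int[of y] b_int[of y] by simp
  qed
  \<comment> \<open>Both sides are bounded functionals, so agreement on the dense set
    \<open>Y\<close> extends to every \<open>y\<close>.\<close>
  have "?L = ?R"
  proof (rule blinfun_eqI)
    fix y
    have "closed {y. blinfun_apply ?L y = blinfun_apply ?R y}"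
      by (intro closed_Collect_eq linear_continuous_on blinfun.bounded_linear_right)
    then have "closure Y \<subseteq> {y. blinfun_apply ?L y = blinfun_apply ?R y}"
      using LR by (intro closure_minimal) auto
    then show "blinfun_apply ?L y = blinfun_apply ?R y" using Y(2) by blast
  qed
  then show ?thesis using f fU by blast
qed

end
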